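(* Let $k\in\{1,\ldots,n-1\}$ and $0<\alpha\leq1$. Let $E\subset\mathbb{R}^n$ be a Borel set with $\mathcal{H}^k(E)<\infty$. Suppose that for $\mathcal{H}^k$-a.e. $x\in E$ there exists $1\leq p\leq\infty$ (possibly depending on $x$) such that $$\limsup_{r\to0}\,r^{-\alpha}\beta_p(x,r)<\infty.$$ Then $E$ is $C^{1,\alpha}$ $\mathcal{H}^k$-rectifiable.
   Context: $B(x,r)$ is the closed Euclidean ball of center $x$ and radius $r$ in $\mathbb{R}^n$. $\mathcal{H}^k$ is the $k$-dimensional Hausdorff measure with no normalizing factor: $\mathcal{H}^k(E)=\lim_{\delta\to0}\inf\{\sum_i \mathrm{diam}(E_i)^k: E\subset\bigcup_i E_i,\ \mathrm{diam}(E_i)\le\delta\}$. The $\beta$ numbers of $E$ are defined by $$\beta_p(x,r)^p:=\inf_V\frac{1}{r^k}\int_{E\cap B(x,r)}\left(\frac{\mathrm{dist}(y,V)}{r}\right)^p d\mathcal{H}^k(y)\quad(1\le p<\infty),$$ and $\beta_\infty(x,r):=\inf_V$ of the $\mathcal{H}^k$-essential supremum over $y\in E\cap B(x,r)$ of $\mathrm{dist}(y,V)/r$, where the infimum is over all affine $k$-planes $V\subset\mathbb{R}^n$ (not necessarily containing $x$). A $k$-dimensional $C^{1,\alpha}$ graph is a set $\{v+f(v):v\in V\}$, where $V$ is a linear $k$-plane of $\mathbb{R}^n$ and $f:V\to V^\perp$ is a $C^{1,\alpha}$ map ($C^1$ with $\alpha$-Hölder derivative). A Borel set $E\subseteq\mathbb{R}^n$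 is $C^{1,\alpha}$ $\mathcal{H}^k$-rectifiable if there are countably many $k$-dimensional $C^{1,\alpha}$ graphs $\Gamma_i$ with $\mathcal{H}^k(E\setminus\bigcup_i\Gamma_i)=0$. *)

theory Defs
  imports "HOL-Analysis.Analysis" "HOL-Probability.Essential_Supremum"
begin

section \<open>Hausdorff measure without normalising factor\<close>

text \<open>
  The library's \<^const>\<open>diameter\<close> is real-valued and unspecified on unbounded sets, hence the explicit
  boundedness condition. The empty set always costs 0, so sequences of sets also represent
  finite covers, and \<open>k = 0\<close> gives counting measure.
\<close>

definition hausdorff_cost :: "nat \<Rightarrow> 'a::metric_space set \<Rightarrow> ennreal" where
  "hausdorff_cost k A = (if A = {} then 0 else ennreal (diameter A ^ k))"

definition hausdorff_content :: "nat \<Rightarrow> real \<Rightarrow> 'a::metric_space set \<Rightarrow> ennreal" where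
  "hausdorff_content k \<delta> E =
     (INF A \<in> {A :: nat \<Rightarrow> 'a set. E \<subseteq> (\<Union>i. A i) \<and> (\<forall>i. bounded (A i) \<and> diameter (A i) \<le> \<delta>)}.
        \<Sum>i. hausdorff_cost k (A i))"

definition hausdorff_outer :: "nat \<Rightarrow> 'a::metric_space set \<Rightarrow> ennreal" where
  "hausdorff_outer k E = Lim (at_right 0) (\<lambda>\<delta>. hausdorff_content k \<delta> E)"

text \<open>
  \<^const>\<open>measure_of\<close> silently yields the zero measure if the given set function is not a measure;
  \<open>emeasure_hausdorff_measure\<close> below excludes this, and \<open>AE_hausdorff_measure_iff\<close> shows that
  almost everywhere means off a null set of the outer measure.
\<close>

definition hausdorff_measure :: "nat \<Rightarrow> 'a::metric_space measure" where
  "hausdorff_measure k = measure_of UNIV (sets borel) (hausdorff_outer k)"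

lemma space_hausdorff_measure [simp]: "space (hausdorff_measure k) = UNIV"
  by (simp add: hausdorff_measure_def space_measure_of_conv)

lemma sets_hausdorff_measure [simp, measurable_cong]: "sets (hausdorff_measure k) = sets borel"
  using sets.sigma_sets_eq[of borel] by (simp add: hausdorff_measure_def)

lemma hausdorff_content_antimono:
  assumes "\<delta> \<le> \<delta>'" shows "hausdorff_content k \<delta>' E \<le> hausdorff_content k \<delta> E"
  unfolding hausdorff_content_def
  by (rule INF_superset_mono) (use assms in \<open>auto intro: order_trans\<close>)

lemma hausdorff_content_tendsto:
  "((\<lambda>\<delta>. hausdorff_content k \<delta> E) \<longlongrightarrow> (SUP \<delta>\<in>{0<..}. hausdorff_content k \<delta> E)) (at_right 0)"
proof (rule order_tendstoI)
  fix a assume "a < (SUP \<delta>\<in>{0<..}. hausdorff_content k \<delta> E)"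
  then obtain d where d: "d > 0" "a < hausdorff_content k d E"
    by (auto simp: less_SUP_iff)
  have "\<forall>\<^sub>F \<delta> in at_right 0. \<delta> < d"
    using d(1) eventually_at_right by blast
  then show "\<forall>\<^sub>F \<delta> in at_right 0. a < hausdorff_content k \<delta> E"
    by eventually_elim (rule less_le_trans[OF d(2) hausdorff_content_antimono[OF less_imp_le]])
next
  fix a assume a: "(SUP \<delta>\<in>{0<..}. hausdorff_content k \<delta> E) < a"
  have "\<forall>\<^sub>F \<delta> in at_right (0::real). \<delta> > 0"
    by (simp add: eventually_at_right_less)
  then show "\<forall>\<^sub>F \<delta> in at_right 0. hausdorff_content k \<delta> E < a"
    by eventually_elim (rule le_less_trans[OF SUP_upper a], simp)
qed

lemma hausdorff_outer_eq_SUP: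
  "hausdorff_outer k E = (SUP \<delta>\<in>{0<..}. hausdorff_content k \<delta> E)"
  unfolding hausdorff_outer_def
  by (rule tendsto_Lim[OF _ hausdorff_content_tendsto]) simp

lemma hausdorff_content_le_outer: "\<delta> > 0 \<Longrightarrow> hausdorff_content k \<delta> E \<le> hausdorff_outer k E"
  unfolding hausdorff_outer_eq_SUP by (intro SUP_upper) auto

lemma hausdorff_content_le:
  assumes "E \<subseteq> (\<Union>i. A i)" "\<And>i. bounded (A i)" "\<And>i. diameter (A i) \<le> \<delta>"
  shows "hausdorff_content k \<delta> E \<le> (\<Sum>i. hausdorff_cost k (A i))"
  unfolding hausdorff_content_def by (rule INF_lower) (use assms in auto)

lemma hausdorff_content_approx:
  assumes "hausdorff_content k \<delta> E < c"
  obtains A where "E \<subseteq> (\<Union>i. A i)" "\<And>i. bounded (A i)" "\<And>i. diameter (A i) \<le> \<delta>"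
    "(\<Sum>i. hausdorff_cost k (A i)) < c"
  using assms unfolding hausdorff_content_def INF_less_iff by auto

lemma hausdorff_content_empty: "\<delta> \<ge> 0 \<Longrightarrow> hausdorff_content k \<delta> {} = 0"
  using hausdorff_content_le[of "{}" "\<lambda>_. {}" \<delta> k] by (simp add: hausdorff_cost_def)

lemma hausdorff_content_mono:
  assumes "E \<subseteq> F" shows "hausdorff_content k \<delta> E \<le> hausdorff_content k \<delta> F"
  unfolding hausdorff_content_def by (rule INF_superset_mono) (use assms in auto)

lemma hausdorff_outer_empty [simp]: "hausdorff_outer k ({} :: 'a::metric_space set) = 0"
proof -
  have "(SUP \<delta>\<in>{0::real<..}. hausdorff_content k \<delta> ({} :: 'a set)) \<le> 0"
    by (rule SUP_least) (simp add: hausdorff_content_empty)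
  then show ?thesis by (simp add: hausdorff_outer_eq_SUP)
qed

lemma hausdorff_outer_mono: "E \<subseteq> F \<Longrightarrow> hausdorff_outer k E \<le> hausdorff_outer k F"
  unfolding hausdorff_outer_eq_SUP by (intro SUP_mono) (auto intro: hausdorff_content_mono)

lemma hausdorff_content_UN:
  "hausdorff_content k \<delta> (\<Union>n::nat. E n) \<le> (\<Sum>n. hausdorff_content k \<delta> (E n))"
proof (rule ennreal_le_epsilon)
  fix e :: real assume e: "0 < e" and fin: "(\<Sum>n. hausdorff_content k \<delta> (E n)) < top"
  have fin': "hausdorff_content k \<delta> (E n) < top" for n
    using fin by (rule ennreal_suminf_lessD)
  have "\<exists>A. E n \<subseteq> (\<Union>i. A i) \<and> (\<forall>i. bounded (A i)) \<and> (\<forall>i. diameter (A i) \<le> \<delta>) \<and>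
     (\<Sum>i. hausdorff_cost k (A i)) \<le> hausdorff_content k \<delta> (E n) + ennreal (e * (1/2)^Suc n)" for n
  proof -
    have "hausdorff_content k \<delta> (E n) < hausdorff_content k \<delta> (E n) + ennreal (e * (1/2)^Suc n)"
      using fin'[of n] e ennreal_add_left_cancel_less[of "hausdorff_content k \<delta> (E n)" 0 "ennreal (e * (1/2)^Suc n)"]
      by (auto simp: less_top[symmetric])
    then show ?thesis by (rule hausdorff_content_approx) (use less_imp_le in blast)
  qed
  then obtain A where A: "\<And>n. E n \<subseteq> (\<Union>i. A n i)" "\<And>n i. bounded (A n i)"
     "\<And>n i. diameter (A n i) \<le> \<delta>"
     "\<And>n. (\<Sum>i. hausdorff_cost k (A n i)) \<le> hausdorff_content k \<delta> (E n) + ennreal (e * (1/2)^Suc n)"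
    by metis
  define B where "B m = case_prod A (prod_decode m)" for m
  have "hausdorff_content k \<delta> (\<Union>n::nat. E n) \<le> (\<Sum>m. hausdorff_cost k (B m))"
  proof (rule hausdorff_content_le)
    show "(\<Union>n. E n) \<subseteq> (\<Union>m. B m)"
    proof
      fix x assume "x \<in> (\<Union>n. E n)"
      then obtain n i where "x \<in> A n i" using A(1) by blast
      then have "x \<in> B (prod_encode (n, i))" by (simp add: B_def)
      then show "x \<in> (\<Union>m. B m)" by blast
    qed
  qed (auto simp: B_def A split: prod.splits)
  also have "\<dots> = (\<Sum>n. \<Sum>i. hausdorff_cost k (A n i))"
    using suminf_ennreal_2dimen[of "\<lambda>n. \<Sum>i. hausdorff_cost k (A n i)" "\<lambda>(n, i). hausdorff_cost k (A n i)"]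
    by (simp add: B_def split_def)
  also have "\<dots> \<le> (\<Sum>n. hausdorff_content k \<delta> (E n) + ennreal (e * (1/2)^Suc n))"
    by (intro suminf_le A) auto
  also have "\<dots> = (\<Sum>n. hausdorff_content k \<delta> (E n)) + (\<Sum>n. ennreal (e * (1/2)^Suc n))"
    by (intro suminf_add[symmetric]) auto
  also have "(\<Sum>n. ennreal (e * (1/2)^Suc n)) = ennreal e"
    using e sums_mult[OF power_half_series, of e]
    by (subst suminf_ennreal_eq[where x = e]) auto
  finally show "hausdorff_content k \<delta> (\<Union>n. E n) \<le> (\<Sum>n. hausdorff_content k \<delta> (E n)) + ennreal e" .
qed

lemma hausdorff_outer_UN:
  "hausdorff_outer k (\<Union>n::nat. E n) \<le> (\<Sum>n. hausdorff_outer k (E n))"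
  unfolding hausdorff_outer_eq_SUP[of k "\<Union>n. E n"]
proof (rule SUP_least)
  fix \<delta> :: real assume "\<delta> \<in> {0<..}"
  have "hausdorff_content k \<delta> (\<Union>n. E n) \<le> (\<Sum>n. hausdorff_content k \<delta> (E n))"
    by (rule hausdorff_content_UN)
  also have "\<dots> \<le> (\<Sum>n. hausdorff_outer k (E n))"
    using \<open>\<delta> \<in> {0<..}\<close> by (intro suminf_le hausdorff_content_le_outer) auto
  finally show "hausdorff_content k \<delta> (\<Union>n. E n) \<le> (\<Sum>n. hausdorff_outer k (E n))" .
qed

lemma hausdorff_outer_Un: "hausdorff_outer k (A \<union> B) \<le> hausdorff_outer k A + hausdorff_outer k B"
proof -
  have "hausdorff_outer k (A \<union> B) = hausdorff_outer k (\<Union>n::nat. if n = 0 then A else if n = 1 then B else {})"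
    by (rule arg_cong[where f = "hausdorff_outer k"]) (auto split: if_splits intro: exI[of _ "1::nat"] exI[of _ "0::nat"])
  also have "\<dots> \<le> (\<Sum>n. hausdorff_outer k (if n = 0 then A else if n = (1::nat) then B else {}))"
    by (rule hausdorff_outer_UN)
  also have "\<dots> = (\<Sum>n\<in>{0,1}. hausdorff_outer k (if n = 0 then A else if n = (1::nat) then B else {}))"
    by (rule suminf_finite) auto
  also have "\<dots> = hausdorff_outer k A + hausdorff_outer k B" by simp
  finally show ?thesis .
qed

lemma outer_measure_space_hausdorff: "outer_measure_space UNIV (hausdorff_outer k)"
  by (auto simp: outer_measure_space_def positive_def increasing_def countably_subadditive_def
      intro: hausdorff_outer_mono hausdorff_outer_UN)

lemma hausdorff_content_separated:
  assumes sep: "\<And>a b. a \<in> A \<Longrightarrow> b \<in> B \<Longrightarrow> dist a b \<ge> d" and "\<delta> < d"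
  shows "hausdorff_content k \<delta> A + hausdorff_content k \<delta> B \<le> hausdorff_content k \<delta> (A \<union> B)"
  unfolding hausdorff_content_def[of k \<delta> "A \<union> B"]
proof (rule INF_greatest, clarify)
  fix C :: "nat \<Rightarrow> 'a set"
  assume C: "A \<union> B \<subseteq> (\<Union>i. C i)" and *: "\<forall>i. bounded (C i) \<and> diameter (C i) \<le> \<delta>"
  define CA where "CA i = (if C i \<inter> A = {} then {} else C i)" for i
  define CB where "CB i = (if C i \<inter> A = {} then C i else {})" for i
  have disj: "C i \<inter> B = {}" if "C i \<inter> A \<noteq> {}" for i
  proof (rule ccontr)
    assume "C i \<inter> B \<noteq> {}"
    with that obtain a b where ab: "a \<in> C i" "a \<in> A" "b \<in> C i" "b \<in> B" by blast
    then have "dist a b \<le> diameter (C i)" using * by (intro diameter_bounded_bound) auto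
    moreover have "d \<le> dist a b" using sep ab by blast
    ultimately show False using * \<open>\<delta> < d\<close> by (meson linorder_not_less order_trans)
  qed
  have [simp]: "0 \<le> \<delta>"
    using * diameter_ge_0 by (meson order_trans)
  have "hausdorff_content k \<delta> A \<le> (\<Sum>i. hausdorff_cost k (CA i))"
  proof (rule hausdorff_content_le)
    show "A \<subseteq> (\<Union>i. CA i)"
    proof
      fix x assume "x \<in> A"
      then obtain i where i: "x \<in> C i" using C by blast
      with \<open>x \<in> A\<close> have "x \<in> CA i" by (auto simp: CA_def)
      then show "x \<in> (\<Union>i. CA i)" by blast
    qed
  qed (use * in \<open>auto simp: CA_def\<close>)
  moreover have "hausdorff_content k \<delta> B \<le> (\<Sum>i. hausdorff_cost k (CB i))"
  proof (rule hausdorff_content_le)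
    show "B \<subseteq> (\<Union>i. CB i)"
    proof
      fix x assume "x \<in> B"
      then obtain i where i: "x \<in> C i" using C by blast
      then have "C i \<inter> A = {}" using disj[of i] \<open>x \<in> B\<close> by blast
      then show "x \<in> (\<Union>i. CB i)" using i by (auto simp: CB_def)
    qed
  qed (use * in \<open>auto simp: CB_def\<close>)
  ultimately have "hausdorff_content k \<delta> A + hausdorff_content k \<delta> B
      \<le> (\<Sum>i. hausdorff_cost k (CA i)) + (\<Sum>i. hausdorff_cost k (CB i))"
    by (rule add_mono)
  also have "\<dots> = (\<Sum>i. hausdorff_cost k (CA i) + hausdorff_cost k (CB i))"
    by (rule suminf_add) auto
  also have "\<dots> = (\<Sum>i. hausdorff_cost k (C i))"
    by (rule suminf_cong) (auto simp: CA_def CB_def hausdorff_cost_def)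
  finally show "hausdorff_content k \<delta> A + hausdorff_content k \<delta> B \<le> (\<Sum>i. hausdorff_cost k (C i))" .
qed

lemma hausdorff_outer_separated:
  assumes sep: "\<And>a b. a \<in> A \<Longrightarrow> b \<in> B \<Longrightarrow> dist a b \<ge> d" and "d > 0"
  shows "hausdorff_outer k (A \<union> B) = hausdorff_outer k A + hausdorff_outer k B"
proof (rule antisym[OF hausdorff_outer_Un])
  have lim: "((\<lambda>\<delta>. hausdorff_content k \<delta> E) \<longlongrightarrow> hausdorff_outer k E) (at_right 0)" for E :: "'a set"
    unfolding hausdorff_outer_eq_SUP by (rule hausdorff_content_tendsto)
  have "\<forall>\<^sub>F \<delta> in at_right 0. \<delta> < d"
    using \<open>d > 0\<close> eventually_at_right by blast
  then have ev: "\<forall>\<^sub>F \<delta> in at_right 0. hausdorff_content k \<delta> A + hausdorff_content k \<delta> B \<le> hausdorff_content k \<delta> (A \<union> B)"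
    by eventually_elim (rule hausdorff_content_separated[OF sep])
  show "hausdorff_outer k A + hausdorff_outer k B \<le> hausdorff_outer k (A \<union> B)"
    by (rule tendsto_le[OF _ lim tendsto_add[OF lim lim] ev]) simp
qed

lemma hausdorff_outer_chain:
  fixes R :: "nat \<Rightarrow> 'a::metric_space set"
  assumes sep: "\<And>i j. i < j \<Longrightarrow> \<exists>d>0. \<forall>a\<in>R i. \<forall>b\<in>R j. dist a b \<ge> d"
  shows "(\<Sum>i<N. hausdorff_outer k (R i)) = hausdorff_outer k (\<Union>i<N. R i)"
proof (induction N)
  case (Suc N)
  have "\<exists>d>0. \<forall>i<N. \<forall>a\<in>R i. \<forall>b\<in>R N. dist a b \<ge> d"
  proof -
    from sep[of _ N] obtain D where D: "\<And>i. i < N \<Longrightarrow> D i > 0 \<and> (\<forall>a\<in>R i. \<forall>b\<in>R N. dist a b \<ge> D i)"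
      by metis
    define d where "d = Min (insert 1 (D ` {..<N}))"
    have "d > 0" "\<And>i. i < N \<Longrightarrow> d \<le> D i" unfolding d_def using D by (auto intro: Min_le)
    then show ?thesis using D by (meson order_trans)
  qed
  then obtain d where d: "d > 0" "\<And>i a b. i < N \<Longrightarrow> a \<in> R i \<Longrightarrow> b \<in> R N \<Longrightarrow> dist a b \<ge> d" by blast
  have "hausdorff_outer k ((\<Union>i<N. R i) \<union> R N) = hausdorff_outer k (\<Union>i<N. R i) + hausdorff_outer k (R N)"
    by (rule hausdorff_outer_separated[OF _ d(1)]) (use d(2) in auto)
  then show ?case using Suc by (simp add: lessThan_Suc Un_commute)
qed simp

lemma hausdorff_outer_closed_split:
  fixes F :: "'a::metric_space set"
  assumes F: "closed F"
  shows "hausdorff_outer k (X \<inter> F) + hausdorff_outer k (X - F) \<le> hausdorff_outer k X"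
proof (cases "F = {} \<or> hausdorff_outer k X = top")
  case True then show ?thesis by auto
next
  case False
  then have ne: "F \<noteq> {}" and fin: "hausdorff_outer k X < top" by (auto simp: less_top)
  define Y where "Y n = {x \<in> X. infdist x F \<ge> 1 / Suc n}" for n
  define R where "R n = Y (Suc n) - Y n" for n
  let ?H = "hausdorff_outer k"
  have far: "dist x y \<ge> u - v" if "infdist x F \<ge> u" "infdist y F \<le> v" for x y u v
    using infdist_triangle[of x F y] that by linarith
  have step: "?H (X \<inter> F) + ?H (Y n) \<le> ?H X" for n
  proof -
    have "?H ((X \<inter> F) \<union> Y n) = ?H (X \<inter> F) + ?H (Y n)"
    proof (rule hausdorff_outer_separated[where d = "1 / Suc n"])
      fix a b assume "a \<in> X \<inter> F" "b \<in> Y n"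
      then show "1 / Suc n \<le> dist a b"
        using infdist_le[of a F b] by (auto simp: Y_def dist_commute)
    qed auto
    then show ?thesis using hausdorff_outer_mono[of "(X \<inter> F) \<union> Y n" X k] by (auto simp: Y_def)
  qed
  have sepR: "\<exists>d>0. \<forall>a\<in>R i. \<forall>b\<in>R j. dist a b \<ge> d" if "Suc i < j" for i j
  proof (intro exI[of _ "1 / real (Suc (Suc i)) - 1 / real (Suc j)"] conjI ballI)
    show "1 / real (Suc (Suc i)) - 1 / real (Suc j) > 0"
      using that by (simp add: frac_less2)
    fix a b assume "a \<in> R i" "b \<in> R j"
    then show "1 / real (Suc (Suc i)) - 1 / real (Suc j) \<le> dist a b"
      by (intro far) (auto simp: R_def Y_def)
  qed
  have half: "(\<Sum>i<N. ?H (R (2*i + c))) \<le> ?H X" for N c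
  proof -
    have "(\<Sum>i<N. ?H (R (2*i + c))) = ?H (\<Union>i<N. R (2*i + c))"
      by (rule hausdorff_outer_chain) (rule sepR, simp)
    also have "\<dots> \<le> ?H X" by (rule hausdorff_outer_mono) (auto simp: R_def Y_def)
    finally show ?thesis .
  qed
  have sumR: "(\<Sum>i. ?H (R i)) \<le> 2 * ?H X"
  proof (rule suminf_le_const)
    fix n
    have "(\<Sum>i<n. ?H (R i)) \<le> (\<Sum>i<2*n. ?H (R i))"
      by (rule sum_mono2) auto
    also have "\<dots> = (\<Sum>i<n. ?H (R (2*i + 0))) + (\<Sum>i<n. ?H (R (2*i + 1)))"
      by (induction n) (auto simp: algebra_simps)
    also have "\<dots> \<le> ?H X + ?H X" by (intro add_mono half)
    finally show "(\<Sum>i<n. ?H (R i)) \<le> 2 * ?H X" by (simp add: mult_2)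
  qed auto
  have fsum: "(\<Sum>i. ?H (R i)) \<noteq> top"
    using sumR fin by (auto simp: top_unique ennreal_mult_eq_top_iff)
  have cover: "X - F \<subseteq> Y n \<union> (\<Union>i. R (i + n))" for n
  proof
    fix x assume x: "x \<in> X - F"
    then have "infdist x F > 0"
      using infdist_pos_not_in_closed[OF F ne] by auto
    then obtain m where m: "1 / real (Suc m) < infdist x F"
      using nat_approx_posE by blast
    define M where "M = (LEAST m. x \<in> Y m)"
    have "x \<in> Y m" using m x by (simp add: Y_def)
    then have M: "x \<in> Y M" unfolding M_def by (rule LeastI)
    show "x \<in> Y n \<union> (\<Union>i. R (i + n))"
    proof (cases "M \<le> n")
      case True
      have "1 / real (Suc n) \<le> 1 / real (Suc M)" using True by (simp add: frac_le)
      then have "x \<in> Y n" using M by (auto simp: Y_def)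
      then show ?thesis by simp
    next
      case False
      then obtain j where j: "M = Suc j" "n \<le> j" by (cases M) auto
      have "x \<notin> Y j" using j not_less_Least[of j "\<lambda>m. x \<in> Y m"] by (auto simp: M_def)
      then have "x \<in> R (j - n + n)" using M j by (auto simp: R_def)
      then show ?thesis by blast
    qed
  qed
  have bound: "?H (X \<inter> F) + ?H (X - F) \<le> ?H X + (\<Sum>i. ?H (R (i + n)))" for n
  proof -
    have "?H (X - F) \<le> ?H (Y n) + ?H (\<Union>i. R (i + n))"
      using hausdorff_outer_mono[OF cover] hausdorff_outer_Un order_trans by blast
    also have "\<dots> \<le> ?H (Y n) + (\<Sum>i. ?H (R (i + n)))"
      by (intro add_left_mono hausdorff_outer_UN)
    finally have "?H (X \<inter> F) + ?H (X - F) \<le> (?H (X \<inter> F) + ?H (Y n)) + (\<Sum>i. ?H (R (i + n)))"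
      by (metis add.assoc add_left_mono)
    also have "\<dots> \<le> ?H X + (\<Sum>i. ?H (R (i + n)))" by (intro add_right_mono step)
    finally show ?thesis .
  qed
  have "(\<lambda>n. \<Sum>i. ?H (R (i + n))) \<longlonglongrightarrow> 0"
  proof -
    define r where "r i = enn2real (?H (R i))" for i
    have "?H (R i) < top" for i
      using fsum by (intro ennreal_suminf_lessD[of "\<lambda>i. ?H (R i)"]) (simp add: less_top)
    then have r: "\<And>i. ?H (R i) = ennreal (r i)" "\<And>i. 0 \<le> r i"
      by (simp_all add: r_def)
    have s: "summable r"
      using fsum r by (intro summable_suminf_not_top) auto
    have eq: "(\<Sum>i. ?H (R (i + n))) = ennreal (\<Sum>i. r (i + n))" for n
      unfolding r(1) using s r(2) by (intro suminf_ennreal2) (auto intro: summable_ignore_initial_segment)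
    have "(\<lambda>n. \<Sum>i. r (i + n)) \<longlonglongrightarrow> 0"
      using suminf_exist_split2[OF s] by simp
    then show ?thesis unfolding eq by (simp add: tendsto_ennreal_iff ennreal_0[symmetric] del: ennreal_0 add: tendsto_ennrealI)
  qed
  then have "(\<lambda>n. ?H X + (\<Sum>i. ?H (R (i + n)))) \<longlonglongrightarrow> ?H X + 0"
    by (intro tendsto_add tendsto_const)
  from tendsto_lowerbound[OF this] bound show ?thesis by auto
qed

theorem emeasure_hausdorff_measure:
  assumes "A \<in> sets borel"
  shows "emeasure (hausdorff_measure k) A = hausdorff_outer k A"
proof -
  define L where "L = lambda_system UNIV UNIV (hausdorff_outer k :: 'a set \<Rightarrow> ennreal)"
  interpret P: sigma_algebra "UNIV :: 'a set" "Pow UNIV" by (rule sigma_algebra_Pow)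
  have ms: "measure_space UNIV L (hausdorff_outer k)"
    unfolding L_def by (rule P.caratheodory_lemma[unfolded Pow_UNIV]) (rule outer_measure_space_hausdorff)
  then interpret L: sigma_algebra "UNIV :: 'a set" L by (simp add: measure_space_def)
  have "F \<in> L" if "closed F" for F :: "'a set"
  proof -
    have "hausdorff_outer k (F \<inter> x) + hausdorff_outer k ((UNIV - F) \<inter> x) = hausdorff_outer k x" for x
    proof (rule antisym)
      show "hausdorff_outer k (F \<inter> x) + hausdorff_outer k ((UNIV - F) \<inter> x) \<le> hausdorff_outer k x"
        using hausdorff_outer_closed_split[OF that, of k x] by (simp add: Int_commute Diff_eq)
      show "hausdorff_outer k x \<le> hausdorff_outer k (F \<inter> x) + hausdorff_outer k ((UNIV - F) \<inter> x)"
        using hausdorff_outer_Un[of k "F \<inter> x" "(UNIV - F) \<inter> x"]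
        by (simp add: Int_Un_distrib2[symmetric])
    qed
    then show ?thesis by (simp add: L_def lambda_system_def)
  qed
  then have "sigma_sets UNIV (Collect closed) \<subseteq> L"
    by (intro L.sigma_sets_subset) auto
  then have sub: "sets borel \<subseteq> L" by (simp add: borel_eq_closed)
  show ?thesis unfolding hausdorff_measure_def
  proof (rule emeasure_measure_of_sigma)
    show "sigma_algebra UNIV (sets (borel :: 'a measure))" using sets.sigma_algebra_axioms[of borel] by simp
    show "positive (sets borel) (hausdorff_outer k :: 'a set \<Rightarrow> ennreal)" by (simp add: positive_def)
    show "countably_additive (sets borel) (hausdorff_outer k :: 'a set \<Rightarrow> ennreal)"
      using ms order_trans[OF _ sub] unfolding measure_space_def countably_additive_def by blast
  qed (rule assms)
qed

lemma hausdorff_outer_null_borel_hull: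
  assumes "hausdorff_outer k X = 0"
  obtains G where "G \<in> sets borel" "X \<subseteq> G" "hausdorff_outer k G = 0"
proof -
  define d :: "nat \<Rightarrow> real" where "d n = 1 / Suc n" for n
  have d: "d n > 0" for n by (simp add: d_def)
  have "\<exists>A. X \<subseteq> (\<Union>i. A i) \<and> (\<forall>i. bounded (A i)) \<and> (\<forall>i. diameter (A i) \<le> d n) \<and>
     (\<Sum>i. hausdorff_cost k (A i)) < ennreal (d n)" for n
  proof -
    have "hausdorff_content k (d n) X < ennreal (d n)"
      using hausdorff_content_le_outer[OF d, of k n X] assms d[of n] by simp
    then show ?thesis by (rule hausdorff_content_approx) blast
  qed
  then obtain A where A: "\<And>n. X \<subseteq> (\<Union>i. A n i)" "\<And>n i. bounded (A n i)"
     "\<And>n i. diameter (A n i) \<le> d n" "\<And>n. (\<Sum>i. hausdorff_cost k (A n i)) < ennreal (d n)"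
    by metis
  define G where "G = (\<Inter>n. \<Union>i. closure (A n i))"
  have "hausdorff_content k (d n) G \<le> ennreal (d n)" for n
  proof -
    have "hausdorff_content k (d n) G \<le> (\<Sum>i. hausdorff_cost k (closure (A n i)))"
      by (rule hausdorff_content_le) (use A in \<open>auto simp: G_def diameter_closure\<close>)
    also have "\<dots> = (\<Sum>i. hausdorff_cost k (A n i))"
      by (rule suminf_cong) (simp add: hausdorff_cost_def diameter_closure A(2))
    finally show ?thesis using A(4)[of n] by (simp add: order_trans less_imp_le)
  qed
  then have small: "hausdorff_content k \<delta> G \<le> ennreal (d n)" if "d n \<le> \<delta>" for n \<delta>
    using hausdorff_content_antimono[OF that] order_trans by blast
  have "hausdorff_content k \<delta> G \<le> 0" if "\<delta> > 0" for \<delta>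
  proof (rule ennreal_le_epsilon)
    fix e :: real assume "e > 0"
    with that have "0 < min \<delta> e" by simp
    then obtain n where "d n < min \<delta> e" unfolding d_def by (rule nat_approx_posE)
    then show "hausdorff_content k \<delta> G \<le> 0 + ennreal e"
      using order_trans[OF small[of n \<delta>] ennreal_leI[of "d n" e]] by simp
  qed
  then have "hausdorff_outer k G \<le> 0" unfolding hausdorff_outer_eq_SUP by (intro SUP_least) auto
  moreover have "G \<in> sets borel" unfolding G_def by measurable
  moreover have "X \<subseteq> G" unfolding G_def
    using A(1) by (intro INT_greatest) (rule order_trans[OF _ UN_mono[OF subset_refl closure_subset]])
  ultimately show thesis using that by simp
qed

lemma AE_hausdorff_measure_iff:
  "(AE x in hausdorff_measure k. P x) \<longleftrightarrow> hausdorff_outer k {x. \<not> P x} = 0"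
proof
  assume "AE x in hausdorff_measure k. P x"
  then obtain N where "{x. \<not> P x} \<subseteq> N" "emeasure (hausdorff_measure k) N = 0" "N \<in> sets borel"
    by (auto elim: AE_E)
  then show "hausdorff_outer k {x. \<not> P x} = 0"
    using hausdorff_outer_mono[of "{x. \<not> P x}" N k] by (simp add: emeasure_hausdorff_measure)
next
  assume "hausdorff_outer k {x. \<not> P x} = 0"
  then obtain G where "G \<in> sets borel" "{x. \<not> P x} \<subseteq> G" "hausdorff_outer k G = 0"
    by (rule hausdorff_outer_null_borel_hull)
  then show "AE x in hausdorff_measure k. P x"
    by (intro AE_I[of _ _ G]) (auto simp: emeasure_hausdorff_measure)
qed

section \<open>Beta numbers\<close>

text \<open>Real powers of extended nonnegative reals, for exponents \<open>a > 0\<close>.\<close>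

definition enn_powr :: "ennreal \<Rightarrow> real \<Rightarrow> ennreal" where
  "enn_powr t a = (if t = top then top else ennreal (enn2real t powr a))"

text \<open>
  Affine \<open>k\<close>-planes are automatically nonempty, since \<^term>\<open>aff_dim {} = -1\<close>.
\<close>

definition affine_planes :: "nat \<Rightarrow> 'a::euclidean_space set set" where
  "affine_planes k = {V. affine V \<and> aff_dim V = int k}"

definition beta_fin :: "nat \<Rightarrow> 'a::euclidean_space set \<Rightarrow> real \<Rightarrow> 'a \<Rightarrow> real \<Rightarrow> ennreal" where
  "beta_fin k E p x r = enn_powr
     (INF V \<in> affine_planes k. ennreal (1 / r ^ k) *
        (\<integral>\<^sup>+ y \<in> E \<inter> cball x r. ennreal ((infdist y V / r) powr p) \<partial>hausdorff_measure k))
     (1 / p)"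

text \<open>
  Taking the essential supremum in \<^typ>\<open>ennreal\<close> gives it the value 0 when
  \<open>E \<inter> cball x r\<close> is a null set.
\<close>

definition beta_inf :: "nat \<Rightarrow> 'a::euclidean_space set \<Rightarrow> 'a \<Rightarrow> real \<Rightarrow> ennreal" where
  "beta_inf k E x r =
     (INF V \<in> affine_planes k.
        esssup (restrict_space (hausdorff_measure k) (E \<inter> cball x r)) (\<lambda>y. ennreal (infdist y V / r)))"

definition beta :: "nat \<Rightarrow> 'a::euclidean_space set \<Rightarrow> ennreal \<Rightarrow> 'a \<Rightarrow> real \<Rightarrow> ennreal" where
  "beta k E p x r = (if p = \<infinity> then beta_inf k E x r else beta_fin k E (enn2real p) x r)"

section \<open>Graphs with Hoelder derivative and rectifiability\<close>

text \<open>
  The derivative is taken relative to the subspace \<open>V\<close>, so only its values on directions \<open>u \<in> V\<close>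
  are meaningful; the estimate says that \<open>v \<mapsto> Df(v)\<close> is \<open>\<alpha>\<close>-Hoelder on all of \<open>V\<close> in operator norm
  (in particular continuous, as \<open>\<alpha> > 0\<close>).
\<close>

definition C1_holder_on :: "real \<Rightarrow> 'a::real_normed_vector set \<Rightarrow> ('a \<Rightarrow> 'b::real_normed_vector) \<Rightarrow> bool" where
  "C1_holder_on \<alpha> V f \<longleftrightarrow>
     (\<exists>f'. (\<forall>v\<in>V. (f has_derivative f' v) (at v within V)) \<and>
        (\<exists>C. \<forall>v\<in>V. \<forall>w\<in>V. \<forall>u\<in>V. norm (f' v u - f' w u) \<le> C * dist v w powr \<alpha> * norm u))"

definition C1_holder_graph :: "nat \<Rightarrow> real \<Rightarrow> 'a::euclidean_space set \<Rightarrow> bool" where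
  "C1_holder_graph k \<alpha> \<Gamma> \<longleftrightarrow>
     (\<exists>V f. subspace V \<and> dim V = k \<and> f ` V \<subseteq> orthogonal_comp V \<and> C1_holder_on \<alpha> V f \<and>
        \<Gamma> = {v + f v | v. v \<in> V})"

definition C1_holder_rectifiable :: "nat \<Rightarrow> real \<Rightarrow> 'a::euclidean_space set \<Rightarrow> bool" where
  "C1_holder_rectifiable k \<alpha> E \<longleftrightarrow>
     E \<in> sets borel \<and>
     (\<exists>\<G>. countable \<G> \<and> (\<forall>\<Gamma>\<in>\<G>. C1_holder_graph k \<alpha> \<Gamma>) \<and> hausdorff_outer k (E - \<Union>\<G>) = 0)"

end

theory Submission
  imports Defs
begin

text \<open>
  By Markov's inequality, a bound \<open>\<beta>\<^sub>p(x, r) \<le> c r\<^sup>\<alpha>\<close> with any \<open>p \<ge> 1\<close> yields an affine plane \<open>W\<close> such that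
  the part of \<open>E \<inter> B(x, r)\<close> at distance more than \<open>\<tau> r\<close> from \<open>W\<close> has measure at most \<open>C r\<^sup>\<alpha> r\<^sup>k / \<tau>\<close>,
  and almost everywhere the upper density of \<open>E\<close> is finite. Subsets on which these bounds are uniform
  inherit them, so by exhaustion it suffices that every such set \<open>F\<close> of positive measure charges
  some \<open>C\<^sup>1\<^sup>,\<^sup>\<alpha>\<close> graph. No lower density is available, so we fix a ball \<open>B(x\<^sub>0, r)\<close>
  with \<open>\<mu>(F \<inter> B(x\<^sub>0, r)) \<ge> r\<^sup>k / 2\<close> and stop at \<open>y\<close> at the first dyadic scale where the density falls below
  a small \<open>\<delta>\<close>. Before stopping, the planes at neighbouring points and scales of size \<open>t\<close> differ by
  \<open>O(t\<^sup>\<alpha>)\<close>, because \<open>F\<close> cannot concentrate near a \<open>(k - 1)\<close>-plane. The points that are far from their own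
  plane at some scale \<open>t\<close> before stopping have measure \<open>O(t\<^sup>\<alpha> r\<^sup>k)\<close>, which is summable over the scales.
  All other points satisfy a cone condition over the plane at the top scale; hence the stopping balls
  are packed like disjoint balls in \<open>k\<close>-dimensional space, and the stopped points have measure at most a
  constant times \<open>\<delta> r\<^sup>k\<close>. On the remaining set of positive measure the planes converge at rate \<open>t\<^sup>\<alpha>\<close>; this is
  a Whitney jet, and Whitney's extension theorem gives the graph.
\<close>

section \<open>Orthogonal projections onto subspaces\<close>

text \<open>The obstacle is a circularity. Planes at neighbouring scales can be compared only where
  mass is bounded below, while finite measure bounds densities only from above. Starting from a ball
  of density 1/2, it is enough to lose less than half of its mass. The comparison constant
  \<open>K\<close> grows as \<open>\<delta>\<close> shrinks, so the choice of
  \<open>\<delta>\<close> must not refer to it. This is possible because \<open>K\<close> enters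
  only through \<open>K * r powr \<alpha>\<close>: for small \<open>r\<close> every plane before
  stopping tilts by at most 1/4 from the top plane, whatever \<open>K\<close> is, and the packing
  constant of the stopping balls then depends on \<open>k\<close> alone. The weak-type bound is used
  twice: most points of a ball are close to one plane, which compares planes, and few points are off
  by a fixed fraction of the scale, which are discarded. The height of order t^(1+\<alpha>) at the
  remaining points is not imposed; it follows by telescoping from the crude bound t / 400. After the
  Markov step all sets are arbitrary subsets under the outer measure: flatness with uniform
  constants passes to subsets, and additivity is used only when splitting by closed sets.\<close>

definition oproj :: "'a::euclidean_space set \<Rightarrow> 'a \<Rightarrow> 'a" where
  "oproj V x = (SOME y. y \<in> V \<and> (\<forall>v\<in>V. (x - y) \<bullet> v = 0))"

text \<open>Planes are used through this residual instead of \<open>infdist\<close>: its norm is the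
  distance to \<open>V\<close>, and by linearity residuals of differences of points split
  exactly.\<close>

definition rej :: "'a::euclidean_space set \<Rightarrow> 'a \<Rightarrow> 'a" where
  "rej V x = x - oproj V x"

lemma
  assumes "subspace V"
  shows oproj_mem: "oproj V x \<in> V" and rej_orth: "v \<in> V \<Longrightarrow> rej V x \<bullet> v = 0"
proof -
  have sp: "span V = V" using assms span_eq_iff by blast
  obtain y z where "y \<in> span V" "\<And>w. w \<in> span V \<Longrightarrow> orthogonal z w" "x = y + z"
    using orthogonal_subspace_decomp_exists by blast
  then have "y \<in> V \<and> (\<forall>v\<in>V. (x - y) \<bullet> v = 0)"
    using sp by (auto simp: orthogonal_def)
  then have "oproj V x \<in> V \<and> (\<forall>v\<in>V. (x - oproj V x) \<bullet> v = 0)"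
    unfolding oproj_def by (rule someI)
  then show "oproj V x \<in> V" "v \<in> V \<Longrightarrow> rej V x \<bullet> v = 0"
    by (auto simp: rej_def)
qed

lemma oproj_unique:
  assumes V: "subspace V" and y: "y \<in> V" "\<And>v. v \<in> V \<Longrightarrow> (x - y) \<bullet> v = 0"
  shows "oproj V x = y"
proof -
  have mem: "oproj V x - y \<in> V" using V y oproj_mem subspace_diff by blast
  have "(oproj V x - y) \<bullet> (oproj V x - y) = (x - y) \<bullet> (oproj V x - y) - rej V x \<bullet> (oproj V x - y)"
    by (simp add: rej_def algebra_simps)
  also have "\<dots> = 0" using y(2)[OF mem] rej_orth[OF V mem] by simp
  finally show ?thesis by simp
qed

lemma oproj_plus_rej: "oproj V x + rej V x = x"
  by (simp add: rej_def)

lemma oproj_add: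
  assumes V: "subspace V" shows "oproj V (x + y) = oproj V x + oproj V y"
proof (rule oproj_unique[OF V])
  show "oproj V x + oproj V y \<in> V" using V oproj_mem subspace_add by blast
  fix v assume "v \<in> V"
  then show "(x + y - (oproj V x + oproj V y)) \<bullet> v = 0"
    using rej_orth[OF V, of v x] rej_orth[OF V, of v y] by (simp add: rej_def algebra_simps)
qed

lemma oproj_scaleR:
  assumes V: "subspace V" shows "oproj V (c *\<^sub>R x) = c *\<^sub>R oproj V x"
proof (rule oproj_unique[OF V])
  show "c *\<^sub>R oproj V x \<in> V" using V oproj_mem subspace_scale by blast
  fix v assume "v \<in> V"
  then show "(c *\<^sub>R x - c *\<^sub>R oproj V x) \<bullet> v = 0"
    using rej_orth[OF V, of v x] by (simp add: rej_def flip: scaleR_diff_right)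
qed

lemma linear_oproj: "subspace V \<Longrightarrow> linear (oproj V)"
  by (simp add: linear_iff oproj_add oproj_scaleR)

lemma linear_rej: "subspace V \<Longrightarrow> linear (rej V)"
  by (simp add: linear_iff rej_def oproj_add oproj_scaleR algebra_simps)

lemma rej_diff: "subspace V \<Longrightarrow> rej V (x - y) = rej V x - rej V y"
  by (simp add: linear_diff linear_rej)

lemma oproj_diff: "subspace V \<Longrightarrow> oproj V (x - y) = oproj V x - oproj V y"
  by (simp add: linear_diff linear_oproj)

lemma oproj_id: "subspace V \<Longrightarrow> v \<in> V \<Longrightarrow> oproj V v = v"
  by (rule oproj_unique) auto

lemma rej_eq_0: "subspace V \<Longrightarrow> v \<in> V \<Longrightarrow> rej V v = 0"
  by (simp add: rej_def oproj_id)

lemma norm_oproj_rej: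
  assumes V: "subspace V" shows "(norm x)\<^sup>2 = (norm (oproj V x))\<^sup>2 + (norm (rej V x))\<^sup>2"
proof -
  have "orthogonal (oproj V x) (rej V x)"
    using rej_orth[OF V oproj_mem[OF V]] by (simp add: orthogonal_def inner_commute)
  from norm_add_Pythagorean[OF this] show ?thesis by (simp add: oproj_plus_rej)
qed

lemma norm_oproj_le: "subspace V \<Longrightarrow> norm (oproj V x) \<le> norm x"
  by (rule power2_le_imp_le[OF _ norm_ge_zero]) (simp add: norm_oproj_rej[of V x])

lemma norm_rej_le: "subspace V \<Longrightarrow> norm (rej V x) \<le> norm x"
  by (rule power2_le_imp_le[OF _ norm_ge_zero]) (simp add: norm_oproj_rej[of V x])

lemma norm_rej_min:
  assumes V: "subspace V" "v \<in> V" shows "norm (rej V x) \<le> norm (x - v)"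
  using norm_rej_le[OF V(1), of "x - v"] V by (simp add: rej_diff rej_eq_0)

lemma norm_rej_eq_infdist:
  assumes V: "subspace V" shows "norm (rej V x) = infdist x V"
proof (rule antisym)
  have ne: "V \<noteq> {}" using V subspace_0 by auto
  show "infdist x V \<le> norm (rej V x)"
    using infdist_le[OF oproj_mem[OF V], of x x] by (simp add: dist_norm rej_def)
  show "norm (rej V x) \<le> infdist x V"
    using ne norm_rej_min[OF V] by (auto simp: infdist_def dist_norm intro!: cINF_greatest)
qed

lemma inner_rej_rej: "subspace V \<Longrightarrow> rej V x \<bullet> rej V y = x \<bullet> rej V y"
  using rej_orth[OF _ oproj_mem, of V y x] by (simp add: rej_def algebra_simps inner_commute)

text \<open>Split \<open>w\<close> along \<open>V2\<close>: the projected part obeys the gap from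
  \<open>V2\<close> to \<open>V3\<close>, and the rest is already short and only shrinks under
  \<open>rej V3\<close>. Gaps therefore add, so the tilt can be telescoped over scales.\<close>

lemma gap_triangle:
  assumes V: "subspace V2" "subspace V3" and g: "norm (rej V2 w) \<le> g1 * norm w"
    "\<And>w. w \<in> V2 \<Longrightarrow> norm (rej V3 w) \<le> g2 * norm w" "0 \<le> g2"
  shows "norm (rej V3 w) \<le> (g1 + g2) * norm w"
proof -
  have "rej V3 w = rej V3 (oproj V2 w) + rej V3 (rej V2 w)"
    using linear_add[OF linear_rej[OF V(2)]] oproj_plus_rej by metis
  then have "norm (rej V3 w) \<le> norm (rej V3 (oproj V2 w)) + norm (rej V3 (rej V2 w))"
    by (simp add: norm_triangle_ineq)
  also have "\<dots> \<le> g2 * norm (oproj V2 w) + norm (rej V2 w)"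
    by (intro add_mono g(2) oproj_mem norm_rej_le V)
  also have "\<dots> \<le> g2 * norm w + g1 * norm w"
    by (intro add_mono mult_left_mono norm_oproj_le V g)
  finally show ?thesis by (simp add: algebra_simps)
qed

text \<open>A vector of \<open>V\<close> killed by \<open>oproj U\<close> equals its own residual,
  so a gap below 1 makes the projection injective on \<open>V\<close>, and equal dimensions make it
  onto \<open>U\<close>. The slope is precomposed with \<open>oproj U\<close> so that slopes of
  different planes are maps on one space and can be subtracted.\<close>

lemma graph_over_subspace:
  assumes V: "subspace V" "subspace U" "dim V = dim U"
    and gap: "\<And>w. w \<in> V \<Longrightarrow> norm (rej U w) \<le> norm w / 2"
  obtains L where "linear L" "\<And>x v. v \<in> U \<Longrightarrow> L x \<bullet> v = 0" "\<And>x. norm (L x) \<le> norm x"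
    "\<And>w. w \<in> V \<Longrightarrow> rej U w = L w" "\<And>x. L (oproj U x) = L x" "\<And>u. u \<in> U \<Longrightarrow> u + L u \<in> V"
proof -
  have lin: "linear (oproj U)" by (rule linear_oproj[OF V(2)])
  have inj: "inj_on (oproj U) V"
  proof (subst linear_inj_on_iff_eq_0[OF lin V(1)], intro ballI impI)
    fix w assume w: "w \<in> V" "oproj U w = 0"
    then have "norm w \<le> norm w / 2" using gap[of w] by (simp add: rej_def)
    then show "w = 0" by simp
  qed
  obtain h where h: "range h \<subseteq> V" "linear h" "\<And>w. w \<in> V \<Longrightarrow> h (oproj U w) = w"
    using linear_exists_left_inverse_on[OF lin V(1) inj] by auto
  have sp: "span V = V" using V(1) span_eq_iff by blast
  have img: "oproj U ` V = U"
  proof (rule subspace_dim_equal)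
    show "subspace (oproj U ` V)" using lin V(1) by (rule linear_subspace_image)
    show "oproj U ` V \<subseteq> U" using oproj_mem[OF V(2)] by auto
    show "dim U \<le> dim (oproj U ` V)"
      using dim_image_eq[OF lin, of V] inj V(1,3) sp by simp
  qed (rule V)
  have ph: "oproj U (h u) = u" if u: "u \<in> U" for u
  proof -
    obtain w where "w \<in> V" "u = oproj U w" using img u by blast
    then show ?thesis using h(3) by simp
  qed
  define L where "L x = rej U (h (oproj U x))" for x
  have Lu: "h u = u + L u" if u: "u \<in> U" for u
    using ph[OF u] oproj_plus_rej[of U "h u"] u by (simp add: L_def oproj_id V)
  have LP: "L (oproj U x) = L x" for x
    by (simp add: L_def oproj_id[OF V(2) oproj_mem[OF V(2)]])
  \<comment> \<open>The gap 1/2 absorbs the slope on the right: |L u| is at most (|u| + |L u|) /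
    2.\<close>
  have nU: "norm (L u) \<le> norm u" if u: "u \<in> U" for u
  proof -
    have "norm (L u) \<le> norm (h u) / 2"
      using gap[of "h u"] h(1) u by (auto simp: L_def oproj_id V)
    also have "\<dots> \<le> (norm u + norm (L u)) / 2" using norm_triangle_ineq[of u "L u"] Lu[OF u] by simp
    finally show ?thesis by simp
  qed
  show thesis
  proof
    show "linear L" unfolding L_def
      using linear_compose[OF linear_compose[OF lin h(2)] linear_rej[OF V(2)]] by (simp add: o_def)
    show "\<And>x v. v \<in> U \<Longrightarrow> L x \<bullet> v = 0" by (simp add: L_def rej_orth V)
    show "norm (L x) \<le> norm x" for x
      using nU[OF oproj_mem[OF V(2)], of x] norm_oproj_le[OF V(2), of x] by (simp add: LP)
    show "rej U w = L w" if "w \<in> V" for w using h(3)[OF that] by (simp add: L_def)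
    show "L (oproj U x) = L x" for x by (rule LP)
    show "u + L u \<in> V" if "u \<in> U" for u by (metis Lu h(1) range_subsetD that)
  qed
qed

text \<open>The map \<open>rej U - L2\<close> vanishes on \<open>V2\<close>. At the point
  \<open>w\<close> of the first plane above \<open>u\<close> it equals the difference of the slopes,
  so it sees only the residual \<open>d\<close> of \<open>w\<close> from \<open>V2\<close>. The
  factor 4 is the norm bound 2 of that map times |w| \<le> 2 |x|.\<close>

lemma graph_slope_diff:
  assumes V: "subspace V2" "subspace U"
    and L1: "\<And>x. norm (L1 x) \<le> norm x" "\<And>x. L1 (oproj U x) = L1 x" "\<And>u. u \<in> U \<Longrightarrow> u + L1 u \<in> V1"
      "\<And>x v. v \<in> U \<Longrightarrow> L1 x \<bullet> v = (0::real)"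
    and L2: "linear L2" "\<And>x. norm (L2 x) \<le> norm x" "\<And>x. L2 (oproj U x) = L2 x"
      "\<And>w. w \<in> V2 \<Longrightarrow> rej U w = L2 w"
    and gap: "\<And>w. w \<in> V1 \<Longrightarrow> norm (rej V2 w) \<le> g * norm w" "0 \<le> g"
  shows "norm (L1 x - L2 x) \<le> 4 * g * norm (x :: 'a::euclidean_space)"
proof -
  define u where "u = oproj U x"
  have uU: "u \<in> U" by (simp add: u_def oproj_mem V)
  define w where "w = u + L1 u"
  define d where "d = rej V2 w"
  have w: "w \<in> V1" using L1(3)[OF uU] by (simp add: w_def)
  have pw: "oproj U w = u" by (rule oproj_unique[OF V(2) uU]) (simp add: w_def L1(4))
  have "norm w \<le> norm u + norm (L1 u)" unfolding w_def by (rule norm_triangle_ineq)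
  also have "\<dots> \<le> 2 * norm x" using L1(1)[of u] norm_oproj_le[OF V(2), of x] by (simp add: u_def)
  finally have nd: "norm d \<le> g * (2 * norm x)"
    using gap(1)[OF w] gap(2) mult_left_mono order_trans unfolding d_def by blast
  have "rej U (oproj V2 w) = L2 (oproj V2 w)" by (rule L2(4)[OF oproj_mem[OF V(1)]])
  then have "rej U w - L2 w = rej U d - L2 d"
    by (simp add: d_def rej_def[of V2] rej_diff V linear_diff[OF L2(1)])
  moreover have "rej U w = L1 x" by (simp add: rej_def[of U] pw) (simp add: w_def u_def L1(2))
  moreover have "L2 w = L2 x" using L2(3)[of w] L2(3)[of x] by (simp add: pw u_def)
  ultimately have "L1 x - L2 x = rej U d - L2 d" by simp
  also have "norm \<dots> \<le> norm d + norm d"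
    using norm_triangle_ineq4 add_mono[OF norm_rej_le[OF V(2)] L2(2)] order_trans by blast
  finally show ?thesis using nd by simp
qed

section \<open>Packing\<close>

text \<open>Volume comparison: the cubes with centres \<open>c i\<close> and half sides
  \<open>s i\<close> are disjoint and lie in one cube. The centres are bare coordinate families, so
  the same count serves for points of the whole space and for points seen only through their
  projections to a plane.\<close>

lemma box_packing:
  fixes c :: "'i \<Rightarrow> 'e \<Rightarrow> real"
  assumes fin: "finite I" "finite B" and R: "0 \<le> R" and s: "\<And>i. i \<in> I \<Longrightarrow> 0 \<le> s i"
    and inside: "\<And>i e. i \<in> I \<Longrightarrow> e \<in> B \<Longrightarrow> \<bar>c i e\<bar> + s i \<le> R"
    and sep: "\<And>i j. i \<in> I \<Longrightarrow> j \<in> I \<Longrightarrow> i \<noteq> j \<Longrightarrow> \<exists>e\<in>B. s i + s j < \<bar>c i e - c j e\<bar>"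
  shows "(\<Sum>i\<in>I. s i ^ card B) \<le> R ^ card B"
proof -
  interpret product_sigma_finite "\<lambda>_ :: 'e. lborel :: real measure" ..
  let ?M = "PiM B (\<lambda>_. lborel :: real measure)"
  define Q where "Q i = PiE B (\<lambda>e. {c i e - s i..c i e + s i})" for i
  have meas: "emeasure ?M (PiE B (\<lambda>e. {l e - t..l e + t})) = ennreal ((2 * t) ^ card B)"
    if "0 \<le> t" for l :: "'e \<Rightarrow> real" and t
    using that fin(2) by (simp add: emeasure_PiM ennreal_power)
  have Qs: "Q i \<in> sets ?M" for i
    unfolding Q_def by (rule sets_PiM_I_finite) (auto simp: fin)
  have disj: "disjoint_family_on Q I"
  proof (unfold disjoint_family_on_def, intro ballI impI)
    fix i j assume ij: "i \<in> I" "j \<in> I" "i \<noteq> j"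
    from sep[OF this] obtain e where e: "e \<in> B" "s i + s j < \<bar>c i e - c j e\<bar>" by blast
    show "Q i \<inter> Q j = {}"
    proof (rule equals0I)
      fix f assume "f \<in> Q i \<inter> Q j"
      then have "f e \<in> {c i e - s i..c i e + s i}" "f e \<in> {c j e - s j..c j e + s j}"
        using e(1) by (auto simp: Q_def PiE_iff)
      then show False using e(2) by auto
    qed
  qed
  have "(\<Sum>i\<in>I. emeasure ?M (Q i)) = emeasure ?M (\<Union>i\<in>I. Q i)"
    by (rule sum_emeasure) (use Qs disj fin in auto)
  also have "\<dots> \<le> emeasure ?M (PiE B (\<lambda>e. {0 - R..0 + R}))"
  proof (rule emeasure_mono)
    show "(\<Union>i\<in>I. Q i) \<subseteq> PiE B (\<lambda>e. {0 - R..0 + R})"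
      unfolding Q_def using inside by (intro UN_least PiE_mono) (force simp: abs_le_iff)
    show "PiE B (\<lambda>e. {0 - R..0 + R}) \<in> sets ?M"
      by (rule sets_PiM_I_finite) (auto simp: fin)
  qed
  also have "\<dots> = ennreal ((2 * R) ^ card B)" by (rule meas[OF R])
  finally have "(\<Sum>i\<in>I. ennreal ((2 * s i) ^ card B)) \<le> ennreal ((2 * R) ^ card B)"
    using s by (simp add: Q_def meas)
  then have "(\<Sum>i\<in>I. (2 * s i) ^ card B) \<le> (2 * R) ^ card B"
    using s R by (subst (asm) sum_ennreal) auto
  then show ?thesis by (simp add: power_mult_distrib flip: sum_distrib_left)
qed

lemma separated_finite_card:
  fixes S :: "'a::euclidean_space set" and R \<rho> :: real
  assumes S: "S \<subseteq> cball a R" "pairwise (\<lambda>x y. \<rho> \<le> dist x y) S" and pos: "0 < \<rho>" "0 \<le> R"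
  shows "finite S" "real (card S) \<le> (3 * DIM('a) * R / \<rho> + 1) ^ DIM('a)"
proof -
  let ?n = "DIM('a)"
  let ?K = "(3 * ?n * R / \<rho> + 1) ^ ?n"
  have fin: "real (card T) \<le> ?K" if T: "T \<subseteq> S" "finite T" for T
  proof -
    \<comment> \<open>With this half side, points that are close in every coordinate have
      l1-distance at most 2 \<rho> / 3.\<close>
    define s where "s = \<rho> / (3 * ?n)"
    have s: "0 < s" using pos by (simp add: s_def)
    have "(\<Sum>x\<in>T. s ^ card (Basis :: 'a set)) \<le> (R + s) ^ card (Basis :: 'a set)"
    proof (rule box_packing[where c = "\<lambda>x e. (x - a) \<bullet> e"])
      fix x and e :: 'a assume "x \<in> T" "e \<in> Basis"
      then have "dist a x \<le> R" "\<bar>(x - a) \<bullet> e\<bar> \<le> norm (x - a)"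
        using S(1) T(1) by (auto simp: Basis_le_norm)
      then show "\<bar>(x - a) \<bullet> e\<bar> + s \<le> R + s" by (simp add: dist_norm norm_minus_commute)
    next
      fix x y assume xy: "x \<in> T" "y \<in> T" "x \<noteq> y"
      show "\<exists>e\<in>Basis. s + s < \<bar>(x - a) \<bullet> e - (y - a) \<bullet> e\<bar>"
      proof (rule ccontr)
        assume "\<not> ?thesis"
        then have "\<bar>(x - y) \<bullet> e\<bar> \<le> 2 * s" if "e \<in> Basis" for e
          using that by (force simp: algebra_simps)
        then have "(\<Sum>e\<in>Basis. \<bar>(x - y) \<bullet> e\<bar>) \<le> ?n * (2 * s)"
          by (rule sum_bounded_above)
        then have "norm (x - y) \<le> 2 * ?n * s" using norm_le_l1[of "x - y"] by simp
        also have "\<dots> < \<rho>" using pos by (simp add: s_def)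
        finally show False using xy S(2) T(1) by (force simp: pairwise_def dist_norm)
      qed
    qed (use T s pos in auto)
    then have "real (card T) \<le> (R + s) ^ ?n / s ^ ?n" using s by (simp add: field_simps)
    also have "\<dots> = ((R + s) / s) ^ ?n" by (simp add: power_divide)
    also have "(R + s) / s = 3 * ?n * R / \<rho> + 1" using pos by (simp add: s_def field_simps)
    finally show ?thesis .
  qed
  then have *: "card T \<le> nat \<lfloor>?K\<rfloor>" if "T \<subseteq> S" "finite T" for T
    using that by (simp add: le_nat_floor)
  show f: "finite S" using finite_if_finite_subsets_card_bdd[of S "nat \<lfloor>?K\<rfloor>"] * by blast
  show "real (card S) \<le> ?K" by (rule fin[OF subset_refl f])
qed

lemma maximal_pairwise_set:
  obtains Z where "Z \<subseteq> X" "pairwise P Z" "\<And>x. x \<in> X \<Longrightarrow> x \<notin> Z \<Longrightarrow> \<exists>z\<in>Z. \<not> (P x z \<and> P z x)"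
proof -
  let ?A = "{Z. Z \<subseteq> X \<and> pairwise P Z}"
  have "\<exists>M\<in>?A. \<forall>Z\<in>?A. M \<subseteq> Z \<longrightarrow> Z = M"
  proof (rule subset_Zorn_nonempty)
    show "?A \<noteq> {}" by (auto intro: exI[of _ "{}"])
    fix \<C> assume "\<C> \<noteq> {}" and ch: "subset.chain ?A \<C>"
    have "pairwise P (\<Union>\<C>)"
      by (rule pairwise_chain_Union)
         (use ch in \<open>auto simp: chain_subset_def subset_chain_def\<close>)
    then show "\<Union>\<C> \<in> ?A" using ch by (auto simp: subset_chain_def)
  qed
  then obtain Z where Z: "Z \<subseteq> X" "pairwise P Z"
    and max: "\<And>Y. Y \<subseteq> X \<Longrightarrow> pairwise P Y \<Longrightarrow> Z \<subseteq> Y \<Longrightarrow> Y = Z" by auto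
  show thesis
  proof (rule that[OF Z])
    fix x assume x: "x \<in> X" "x \<notin> Z"
    show "\<exists>z\<in>Z. \<not> (P x z \<and> P z x)"
    proof (rule ccontr)
      assume "\<not> ?thesis"
      then have "pairwise P (insert x Z)" using Z(2) by (auto simp: pairwise_insert)
      then show False using max[of "insert x Z"] x Z(1) by auto
    qed
  qed
qed

section \<open>Whitney's extension theorem\<close>

text \<open>Trading the powers of \<open>c\<close> for \<open>c\<close> and its square keeps the
  numerical factors of later estimates free of \<alpha>.\<close>

lemma powr_scale_le:
  assumes "1 \<le> c" "0 \<le> r" "\<alpha> \<le> (1::real)"
  shows "(c * r) powr \<alpha> \<le> c * r powr \<alpha>" "(c * r) powr (1 + \<alpha>) \<le> c\<^sup>2 * r powr (1 + \<alpha>)"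
proof -
  have "c powr \<alpha> \<le> c powr 1" "c powr (1 + \<alpha>) \<le> c powr 2"
    using assms by (intro powr_mono; simp)+
  then show "(c * r) powr \<alpha> \<le> c * r powr \<alpha>" "(c * r) powr (1 + \<alpha>) \<le> c\<^sup>2 * r powr (1 + \<alpha>)"
    using assms by (simp_all add: powr_mult mult_right_mono)
qed

lemma powr_one_plus: "0 \<le> r \<Longrightarrow> r powr (1 + \<alpha>) = r * r powr \<alpha>" for r :: real
  by (simp add: powr_mult_base)

text \<open>A profile with Lipschitz derivative. Its Taylor remainder is quadratic, and as \<alpha>
  \<le> 1 a quadratic remainder at the right scale yields order 1 + \<alpha>.\<close>

definition cap :: "real \<Rightarrow> real" where "cap s = (max 0 (1 - s))\<^sup>2"

definition cap' :: "real \<Rightarrow> real" where "cap' s = - 2 * max 0 (1 - s)"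

lemma cap_taylor: "\<bar>cap t - cap s - cap' s * (t - s)\<bar> \<le> (t - s)\<^sup>2"
proof -
  consider "s \<le> 1" "t \<le> 1" | "s \<le> 1" "1 < t" | "1 < s" "t \<le> 1" | "1 < s" "1 < t" by linarith
  then show ?thesis
  proof cases
    case 1
    then have "cap t - cap s - cap' s * (t - s) = (t - s)\<^sup>2"
      by (simp add: cap_def cap'_def power2_eq_square algebra_simps)
    then show ?thesis by simp
  next
    case 2
    define u v where "u = 1 - s" and "v = t - s"
    have uv: "0 \<le> u" "u \<le> v" using 2 by (auto simp: u_def v_def)
    have eq: "cap t - cap s - cap' s * (t - s) = u * (2 * v - u)"
      using 2 by (simp add: cap_def cap'_def u_def v_def power2_eq_square algebra_simps)
    have "u * (2 * v - u) \<le> v\<^sup>2"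
      using zero_le_power2[of "v - u"] by (simp add: power2_eq_square algebra_simps)
    moreover have "0 \<le> u * (2 * v - u)" using uv by (intro mult_nonneg_nonneg) auto
    ultimately show ?thesis unfolding eq v_def by simp
  next
    case 3
    then have "cap t - cap s - cap' s * (t - s) = (1 - t)\<^sup>2"
      by (simp add: cap_def cap'_def)
    also have "\<dots> \<le> (s - t)\<^sup>2" using 3 by (intro power_mono) auto
    finally show ?thesis
      using 3 by (simp add: cap_def cap'_def power2_commute)
  next
    case 4
    then show ?thesis by (simp add: cap_def cap'_def)
  qed
qed

text \<open>Quotient rule with an explicit second-order remainder, for a weighted sum
  \<open>u\<close> over the total weight \<open>S\<close>. Multiplied by \<open>S\<close>, the error
  becomes \<open>(S0 - S) *\<^sub>R w + Ru - RS *\<^sub>R w0\<close>, whose terms are all of order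
  e^2. In the application \<open>e\<close> is the increment divided by the distance to the closed
  set.\<close>

lemma quotient_taylor:
  fixes u u0 m Ru :: "'b::real_normed_vector" and S S0 \<sigma> RS e P Q :: real
  assumes u: "u = u0 + m + Ru" and S: "S = S0 + \<sigma> + RS" and half: "1/2 \<le> S" "1/2 \<le> S0"
    and P: "norm u0 \<le> P" "norm m \<le> P * e" "norm Ru \<le> P * e\<^sup>2"
    and Q: "\<bar>\<sigma>\<bar> \<le> Q * e" "\<bar>RS\<bar> \<le> Q * e\<^sup>2" "1 \<le> Q" and e: "0 \<le> e" "e \<le> 1"
  defines "w \<equiv> (m - \<sigma> *\<^sub>R (u0 /\<^sub>R S0)) /\<^sub>R S0"
  shows "norm (u0 /\<^sub>R S0) \<le> 2 * P" "norm w \<le> 6 * Q * P * e"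
    "norm (u /\<^sub>R S - u0 /\<^sub>R S0 - w) \<le> 30 * Q\<^sup>2 * P * e\<^sup>2"
proof -
  define w0 where "w0 = u0 /\<^sub>R S0"
  have P0: "0 \<le> P" using P(1) norm_ge_zero order_trans by blast
  have ee: "e\<^sup>2 \<le> e" using e by (simp add: power2_eq_square mult_left_le)
  have div: "norm (x /\<^sub>R T) \<le> 2 * norm x" if "1/2 \<le> T" for x :: 'b and T :: real
  proof -
    have "inverse T \<le> 2" using that le_imp_inverse_le[of "1/2" T] by simp
    then show ?thesis using that by (simp add: mult_right_mono)
  qed
  show w0: "norm (u0 /\<^sub>R S0) \<le> 2 * P" using div[OF half(2), of u0] P(1) by simp
  then have W0: "norm w0 \<le> 2 * P" by (simp add: w0_def)
  have Qe: "0 \<le> Q * e" "0 \<le> Q * e\<^sup>2" using Q(3) e by auto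
  have "norm (\<sigma> *\<^sub>R w0) \<le> (Q * e) * (2 * P)"
    unfolding norm_scaleR real_norm_def by (rule mult_mono[OF Q(1) W0]) (use Q(3) e in auto)
  then have "norm (m - \<sigma> *\<^sub>R w0) \<le> P * e + Q * e * (2 * P)"
    using P(2) norm_triangle_ineq4[of m "\<sigma> *\<^sub>R w0"] by simp
  also have "P * e \<le> Q * (P * e)" using mult_right_mono[of 1 Q "P * e"] Q(3) P0 e by simp
  finally have "norm (m - \<sigma> *\<^sub>R w0) \<le> 3 * Q * P * e" by (simp add: algebra_simps)
  then show w: "norm w \<le> 6 * Q * P * e"
    using div[OF half(2), of "m - \<sigma> *\<^sub>R w0"] by (simp add: w_def w0_def)
  have SS: "\<bar>S0 - S\<bar> \<le> 2 * Q * e"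
  proof -
    have "Q * e\<^sup>2 \<le> Q * e" using mult_left_mono[OF ee, of Q] Q(3) by simp
    then have "\<bar>\<sigma> + RS\<bar> \<le> Q * e + Q * e" using Q(1,2) by linarith
    then show ?thesis using S by (simp add: abs_minus_commute)
  qed
  have "S *\<^sub>R (u /\<^sub>R S - w0 - w) = u - S *\<^sub>R w0 - S *\<^sub>R w"
    using half by (simp add: scaleR_diff_right)
  also have "\<dots> = (S0 - S) *\<^sub>R w + Ru - RS *\<^sub>R w0"
  proof -
    have "S0 *\<^sub>R w = m - \<sigma> *\<^sub>R w0" "S0 *\<^sub>R w0 = u0"
      using half by (auto simp: w_def w0_def)
    moreover have "S *\<^sub>R w0 = S0 *\<^sub>R w0 + \<sigma> *\<^sub>R w0 + RS *\<^sub>R w0"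
      by (simp add: S scaleR_add_left)
    ultimately show ?thesis by (simp add: u scaleR_diff_left)
  qed
  finally have eq0: "S *\<^sub>R (u /\<^sub>R S - w0 - w) = (S0 - S) *\<^sub>R w + Ru - RS *\<^sub>R w0" .
  have "u /\<^sub>R S - w0 - w = (S *\<^sub>R (u /\<^sub>R S - w0 - w)) /\<^sub>R S"
    using half by (subst scaleR_scaleR) simp
  then have eq: "u /\<^sub>R S - w0 - w = ((S0 - S) *\<^sub>R w + Ru - RS *\<^sub>R w0) /\<^sub>R S"
    unfolding eq0 .
  have "norm ((S0 - S) *\<^sub>R w + Ru - RS *\<^sub>R w0) \<le> norm ((S0 - S) *\<^sub>R w) + norm Ru + norm (RS *\<^sub>R w0)"
    using norm_triangle_ineq4 norm_triangle_ineq order_trans add_right_mono by (smt (verit, best))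
  also have "\<dots> \<le> (2 * Q * e) * (6 * Q * P * e) + P * e\<^sup>2 + (Q * e\<^sup>2) * (2 * P)"
    unfolding norm_scaleR real_norm_def
    by (intro add_mono mult_mono SS w P(3) Q(2) W0) (use Qe in auto)
  also have "\<dots> = (12 * Q\<^sup>2 + 1 + 2 * Q) * (P * e\<^sup>2)"
    by (simp add: power2_eq_square algebra_simps)
  also have "\<dots> \<le> (15 * Q\<^sup>2) * (P * e\<^sup>2)"
  proof (rule mult_right_mono)
    have "Q * 1 \<le> Q * Q" using Q(3) by (intro mult_left_mono) auto
    then show "12 * Q\<^sup>2 + 1 + 2 * Q \<le> 15 * Q\<^sup>2" using Q(3) unfolding power2_eq_square by linarith
  qed (use P0 in simp)
  finally have "norm ((S0 - S) *\<^sub>R w + Ru - RS *\<^sub>R w0) \<le> 15 * Q\<^sup>2 * (P * e\<^sup>2)" .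
  then show "norm (u /\<^sub>R S - u0 /\<^sub>R S0 - w) \<le> 30 * Q\<^sup>2 * P * e\<^sup>2"
    using div[OF half(1), of "(S0 - S) *\<^sub>R w + Ru - RS *\<^sub>R w0"] eq unfolding w0_def by simp
qed

section \<open>Whitney's construction for a first-order Hoelder jet on a closed set\<close>

locale holder_jet =
  fixes A :: "'a::euclidean_space set" and g :: "'a \<Rightarrow> 'b::real_normed_vector"
    and L :: "'a \<Rightarrow> 'a \<Rightarrow> 'b" and K \<alpha> :: real
  assumes closed_A: "closed A" and ne: "A \<noteq> {}" and \<alpha>: "0 < \<alpha>" "\<alpha> \<le> 1" and K: "0 \<le> K"
    and lin: "\<And>a. a \<in> A \<Longrightarrow> linear (L a)"
    and jet0: "\<And>a b. a \<in> A \<Longrightarrow> b \<in> A \<Longrightarrow> norm (g b - g a - L a (b - a)) \<le> K * dist a b powr (1 + \<alpha>)"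
    and jet1: "\<And>a b u. a \<in> A \<Longrightarrow> b \<in> A \<Longrightarrow> norm (L a u - L b u) \<le> K * dist a b powr \<alpha> * norm u"
begin

definition T where "T a x = g a + L a (x - a)"

definition d where "d x = infdist x A"

definition near where "near x = (SOME p. p \<in> A \<and> dist x p = d x)"

text \<open>A maximal separated set in this sense plays the role of the centres of the Whitney cubes of \<open>- A\<close>.\<close>

definition separated where "separated z w \<longleftrightarrow> min (d z) (d w) / 20 \<le> dist z w"

definition Z where "Z = (SOME Z. Z \<subseteq> - A \<and> pairwise separated Z \<and>
  (\<forall>x\<in>-A. x \<notin> Z \<longrightarrow> (\<exists>z\<in>Z. \<not> separated x z)))"

text \<open>Vanishes outside the ball of radius \<open>d z / 4\<close>, hence lives where distances
  to \<open>A\<close> are comparable to \<open>d z\<close>, and is at least 1/2 within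
  \<open>d z / 20\<close>, the covering radius of \<open>Z\<close>. Squaring the norm removes its
  kink at \<open>z\<close>.\<close>

definition bump where "bump z y = cap ((norm (y - z))\<^sup>2 / (d z / 4)\<^sup>2)"

text \<open>An index set frozen at \<open>x\<close>: it contains every centre whose bump is nonzero
  somewhere in the ball of radius \<open>d x / 16\<close>, so one finite sum describes
  \<open>ext\<close> on that whole ball.\<close>

definition N where "N x = {z \<in> Z. dist x z \<le> d x / 2}"

definition ext where
  "ext y = (if y \<in> A then g y else (\<Sum>z\<in>N y. bump z y *\<^sub>R T (near z) y) /\<^sub>R (\<Sum>z\<in>N y. bump z y))"

lemma near: "near x \<in> A" "dist x (near x) = d x"
proof -
  obtain p where "p \<in> A" "dist x p = d x"
    using infdist_attains_inf[OF closed_A ne, of x] unfolding d_def by metis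
  then have "near x \<in> A \<and> dist x (near x) = d x" unfolding near_def by (intro someI) auto
  then show "near x \<in> A" "dist x (near x) = d x" by auto
qed

lemma d_nonneg: "0 \<le> d x" by (simp add: d_def infdist_nonneg)

lemma d_pos_iff: "0 < d x \<longleftrightarrow> x \<notin> A"
  using infdist_pos_not_in_closed[OF closed_A ne, of x] by (auto simp: d_def)

lemma d_lipschitz: "\<bar>d x - d y\<bar> \<le> dist x y"
  using infdist_triangle[of x A y] infdist_triangle[of y A x] by (auto simp: d_def dist_commute)

lemma near_A: "x \<in> A \<Longrightarrow> near x = x"
  using near(2)[of x] by (simp add: d_def)

lemma T_diff:
  assumes ab: "a \<in> A" "b \<in> A" and le: "dist a b \<le> \<rho>" "dist x a \<le> \<rho>"
  shows "norm (T a x - T b x) \<le> 2 * K * \<rho> powr (1 + \<alpha>)"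
proof -
  have \<rho>: "0 \<le> \<rho>" using le(1) zero_le_dist order_trans by blast
  have "T b x = g b + L b (x - a) + L b (a - b)"
    using linear_add[OF lin[OF ab(2)], of "x - a" "a - b"] by (simp add: T_def)
  then have "T a x - T b x = (L a (x - a) - L b (x - a)) + (g a - g b - L b (a - b))"
    by (simp add: T_def)
  also have "norm \<dots> \<le> norm (L a (x - a) - L b (x - a)) + norm (g a - g b - L b (a - b))"
    by (rule norm_triangle_ineq)
  also have "\<dots> \<le> K * dist a b powr \<alpha> * norm (x - a) + K * dist b a powr (1 + \<alpha>)"
    by (intro add_mono jet0 jet1 ab)
  also have "\<dots> \<le> K * \<rho> powr \<alpha> * \<rho> + K * \<rho> powr (1 + \<alpha>)"
    using le \<rho> K \<alpha> by (intro add_mono mult_mono powr_mono2) (auto simp: dist_norm norm_minus_commute)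
  also have "\<dots> = 2 * K * \<rho> powr (1 + \<alpha>)" using \<rho> by (simp add: powr_one_plus)
  finally show ?thesis .
qed

lemma
  shows Z_not_A: "z \<in> Z \<Longrightarrow> z \<notin> A"
    and Z_sep: "z \<in> Z \<Longrightarrow> w \<in> Z \<Longrightarrow> z \<noteq> w \<Longrightarrow> min (d z) (d w) / 20 \<le> dist z w"
    and Z_dense: "x \<notin> A \<Longrightarrow> \<exists>z\<in>Z. dist x z < d z / 20"
proof -
  obtain Z0 where "Z0 \<subseteq> - A" "pairwise separated Z0"
    "\<And>x. x \<in> - A \<Longrightarrow> x \<notin> Z0 \<Longrightarrow> \<exists>z\<in>Z0. \<not> (separated x z \<and> separated z x)"
    using maximal_pairwise_set[of "- A" separated] by blast
  moreover have "separated x z \<longleftrightarrow> separated z x" for x z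
    by (simp add: separated_def dist_commute min.commute)
  ultimately have "\<exists>Z. Z \<subseteq> - A \<and> pairwise separated Z \<and> (\<forall>x\<in>-A. x \<notin> Z \<longrightarrow> (\<exists>z\<in>Z. \<not> separated x z))"
    by (intro exI[of _ Z0]) auto
  then have Zp: "Z \<subseteq> - A \<and> pairwise separated Z \<and> (\<forall>x\<in>-A. x \<notin> Z \<longrightarrow> (\<exists>z\<in>Z. \<not> separated x z))"
    unfolding Z_def by (rule someI_ex)
  then show "z \<in> Z \<Longrightarrow> z \<notin> A"
    and "z \<in> Z \<Longrightarrow> w \<in> Z \<Longrightarrow> z \<noteq> w \<Longrightarrow> min (d z) (d w) / 20 \<le> dist z w"
    by (auto simp: pairwise_def separated_def)
  assume x: "x \<notin> A"
  show "\<exists>z\<in>Z. dist x z < d z / 20"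
  proof (cases "x \<in> Z")
    case True then show ?thesis using x d_pos_iff by (intro bexI[of _ x]) auto
  next
    case False
    then obtain z where "z \<in> Z" "\<not> separated x z" using Zp x by auto
    then show ?thesis by (intro bexI[of _ z]) (auto simp: separated_def)
  qed
qed

lemma bump_range: "0 \<le> bump z y" "bump z y \<le> 1"
  by (auto simp: bump_def cap_def power_le_one)

lemma bump_ge_half:
  assumes "dist y z < d z / 20" shows "1/2 \<le> bump z y"
proof -
  have dz: "0 < d z" using assms zero_le_dist[of y z] by linarith
  have "(norm (y - z))\<^sup>2 \<le> (d z / 20)\<^sup>2" using assms by (intro power_mono) (auto simp: dist_norm)
  then have s: "(norm (y - z))\<^sup>2 / (d z / 4)\<^sup>2 \<le> 1/25"
    using dz by (simp add: field_simps power_divide)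
  then have "24/25 \<le> max 0 (1 - (norm (y - z))\<^sup>2 / (d z / 4)\<^sup>2)" by linarith
  then have "(24/25)\<^sup>2 \<le> bump z y" unfolding bump_def cap_def by (rule power_mono) simp
  then show ?thesis by (simp add: power2_eq_square)
qed

lemma bump_nonzero:
  assumes "z \<in> Z" "bump z y \<noteq> 0" shows "dist y z < d z / 4"
proof (rule ccontr)
  assume n: "\<not> ?thesis"
  then have "(d z / 4)\<^sup>2 \<le> (norm (y - z))\<^sup>2"
    using d_nonneg[of z] by (intro power_mono) (auto simp: dist_norm)
  moreover have "0 < d z" using Z_not_A[OF assms(1)] d_pos_iff by blast
  ultimately have "1 \<le> (norm (y - z))\<^sup>2 / (d z / 4)\<^sup>2" by (simp add: le_divide_eq)
  then show False using assms n by (auto simp: bump_def cap_def)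
qed

lemma N_active:
  assumes "dist x y \<le> d x / 16" "z \<in> Z" "bump z y \<noteq> 0"
  shows "z \<in> N x"
proof -
  have "dist y z < d z / 4" by (rule bump_nonzero) fact+
  \<comment> \<open>Here \<open>d z\<close> is at most 4/3 of \<open>d y\<close>, and
    \<open>d y\<close> at most 17/16 of \<open>d x\<close>, which gives 5/12 of \<open>d x\<close>
    in total.\<close>
  then have "dist x z \<le> d x / 2"
    using assms(1) d_lipschitz[of x y] d_lipschitz[of y z] dist_triangle[of x z y] by linarith
  then show ?thesis using assms(2) by (simp add: N_def)
qed

lemma N_d:
  assumes "z \<in> N x" shows "d x / 2 \<le> d z" "d z \<le> 3 / 2 * d x"
  using assms d_lipschitz[of x z] by (auto simp: N_def)

text \<open>Bounded overlap. The centres are \<open>d x / 40\<close> separated in a ball of radius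
  \<open>d x / 2\<close>; the ratio 20 times the factor 3 of the packing lemma gives 60.\<close>

lemma N_finite:
  assumes "x \<notin> A" shows "finite (N x)" "real (card (N x)) \<le> (60 * DIM('a) + 1) ^ DIM('a)"
proof -
  have D: "0 < d x" using assms d_pos_iff by auto
  have sep: "pairwise (\<lambda>z w. d x / 40 \<le> dist z w) (N x)"
  proof (rule pairwiseI)
    fix z w assume zw: "z \<in> N x" "w \<in> N x" "z \<noteq> w"
    then have "min (d z) (d w) / 20 \<le> dist z w" by (intro Z_sep) (auto simp: N_def)
    then show "d x / 40 \<le> dist z w" using N_d(1)[OF zw(1)] N_d(1)[OF zw(2)] by linarith
  qed
  have sub: "N x \<subseteq> cball x (d x / 2)" by (auto simp: N_def)
  note * = separated_finite_card[OF sub sep]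
  show "finite (N x)" "real (card (N x)) \<le> (60 * DIM('a) + 1) ^ DIM('a)"
    using *(1) *(2) D by (auto simp: add.commute)
qed

lemma ext_local:
  assumes x: "x \<notin> A" and y: "dist x y \<le> d x / 16"
  shows "ext y = (\<Sum>z\<in>N x. bump z y *\<^sub>R T (near z) y) /\<^sub>R (\<Sum>z\<in>N x. bump z y)"
    "1/2 \<le> (\<Sum>z\<in>N x. bump z y)" "y \<notin> A"
proof -
  have D: "0 < d x" using x d_pos_iff by auto
  then have "0 < d y" using y d_lipschitz[of x y] by linarith
  then show yA: "y \<notin> A" using d_pos_iff by auto
  have yy: "dist y y \<le> d y / 16" using \<open>0 < d y\<close> by simp
  have z1: "bump z y = 0" if "z \<in> N y - N x" for z
    using that N_active[OF y, of z] by (auto simp: N_def)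
  have z2: "bump z y = 0" if "z \<in> N x - N y" for z
    using that N_active[OF yy, of z] by (auto simp: N_def)
  note fin = N_finite(1)[OF x] N_finite(1)[OF yA]
  have "(\<Sum>z\<in>N y. h z) = (\<Sum>z\<in>N x. h z)" if "\<And>z. bump z y = 0 \<Longrightarrow> h z = 0" for h :: "'a \<Rightarrow> 'c::comm_monoid_add"
  proof -
    have "(\<Sum>z\<in>N y. h z) = (\<Sum>z\<in>N y \<inter> N x. h z)"
      by (rule sum.mono_neutral_right) (use fin z1 that in auto)
    also have "\<dots> = (\<Sum>z\<in>N x. h z)"
      by (rule sum.mono_neutral_left) (use fin z2 that in auto)
    finally show ?thesis .
  qed
  note eq = this
  show "ext y = (\<Sum>z\<in>N x. bump z y *\<^sub>R T (near z) y) /\<^sub>R (\<Sum>z\<in>N x. bump z y)"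
    using yA eq[of "\<lambda>z. bump z y *\<^sub>R T (near z) y"] eq[of "\<lambda>z. bump z y"] by (simp add: ext_def)
  obtain z where z: "z \<in> Z" "dist y z < d z / 20" using Z_dense[OF yA] by blast
  then have half: "1/2 \<le> bump z y" by (intro bump_ge_half)
  then have "z \<in> N x" using N_active[OF y z(1)] by auto
  then have "bump z y \<le> (\<Sum>z\<in>N x. bump z y)"
    using fin(1) bump_range by (intro member_le_sum) auto
  then show "1/2 \<le> (\<Sum>z\<in>N x. bump z y)" using half by linarith
qed

text \<open>The bump of \<open>z\<close> varies at scale \<open>d z / 4\<close>, which is at least
  \<open>d x / 8\<close>; hence all bounds depend only on the increment relative to
  \<open>d x\<close>.\<close>

lemma bump_taylor:
  assumes x: "x \<notin> A" and z: "z \<in> N x"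
  obtains l where "linear l" "\<And>v. \<bar>l v\<bar> \<le> 128 * (norm v / d x)"
    "\<And>h. norm h \<le> d x \<Longrightarrow> \<bar>bump z (x + h) - bump z x - l h\<bar> \<le> 17000 * (norm h / d x)\<^sup>2"
proof -
  define D where "D = d x"
  define \<rho> where "\<rho> = d z / 4"
  define sx where "sx = (norm (x - z))\<^sup>2 / \<rho>\<^sup>2"
  define l where "l v = cap' sx * (2 * ((x - z) \<bullet> v) / \<rho>\<^sup>2)" for v
  have D: "0 < D" using x d_pos_iff by (auto simp: D_def)
  have "D / 8 \<le> \<rho>" using N_d(1)[OF z] by (simp add: D_def \<rho>_def)
  then have \<rho>: "0 < \<rho>" "(D / 8)\<^sup>2 \<le> \<rho>\<^sup>2" using D by (auto intro!: power_mono)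
  have div: "t / \<rho>\<^sup>2 \<le> 64 * t / D\<^sup>2" if "0 \<le> t" for t
  proof -
    have "t / \<rho>\<^sup>2 \<le> t / (D / 8)\<^sup>2" using \<rho> D that by (intro divide_left_mono) auto
    then show ?thesis by (simp add: power_divide mult.commute)
  qed
  have xz: "norm (x - z) \<le> D / 2" using z by (auto simp: N_def D_def dist_norm)
  have c': "\<bar>cap' sx\<bar> \<le> 2" by (auto simp: cap'_def sx_def abs_mult)
  have inner: "\<bar>2 * ((x - z) \<bullet> v) / \<rho>\<^sup>2\<bar> \<le> 64 * (norm v / D)" for v
  proof -
    have "\<bar>(x - z) \<bullet> v\<bar> \<le> (D / 2) * norm v"
      using Cauchy_Schwarz_ineq2[of "x - z" v] xz mult_right_mono[OF xz norm_ge_zero[of v]] by linarith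
    then have "2 * \<bar>(x - z) \<bullet> v\<bar> / \<rho>\<^sup>2 \<le> (D * norm v) / \<rho>\<^sup>2"
      using \<rho> by (intro divide_right_mono) auto
    also have "\<dots> \<le> 64 * (D * norm v) / D\<^sup>2" using D by (intro div) auto
    also have "\<dots> = 64 * (norm v / D)" using D by (simp add: power2_eq_square)
    finally show ?thesis using \<rho> by (simp add: abs_mult)
  qed
  show thesis
  proof
    have "l = (\<lambda>v. ((cap' sx * 2 / \<rho>\<^sup>2) *\<^sub>R (x - z)) \<bullet> v)" by (auto simp: l_def)
    then show "linear l" using bounded_linear.linear[OF bounded_linear_inner_right] by metis
    show "\<bar>l v\<bar> \<le> 128 * (norm v / d x)" for v
      using mult_mono[OF c' inner[of v]] by (simp add: l_def abs_mult D_def)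
    fix h :: 'a assume h: "norm h \<le> d x"
    define e where "e = norm h / D"
    have e: "0 \<le> e" "e \<le> 1" using h D by (auto simp: e_def D_def)
    have ee: "e\<^sup>2 \<le> e" using e by (simp add: power2_eq_square mult_left_le)
    define sy where "sy = (norm (x + h - z))\<^sup>2 / \<rho>\<^sup>2"
    define q where "q = (norm h)\<^sup>2 / \<rho>\<^sup>2"
    have "(norm (x + h - z))\<^sup>2 = (norm (x - z))\<^sup>2 + 2 * ((x - z) \<bullet> h) + (norm h)\<^sup>2"
      by (simp add: power2_norm_eq_inner inner_simps algebra_simps inner_commute)
    then have diff: "sy - sx = 2 * ((x - z) \<bullet> h) / \<rho>\<^sup>2 + q"
      by (simp add: sx_def sy_def q_def add_divide_distrib)
    have q: "0 \<le> q" "q \<le> 64 * e\<^sup>2"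
      using div[of "(norm h)\<^sup>2"] by (auto simp: q_def e_def power_divide)
    have sd: "\<bar>sy - sx\<bar> \<le> 128 * e"
      using inner[of h, folded e_def] q ee unfolding diff by linarith
    have bs: "bump z (x + h) = cap sy" "bump z x = cap sx" by (simp_all add: bump_def sx_def sy_def \<rho>_def)
    have ls: "l h = cap' sx * (sy - sx - q)" by (simp add: l_def diff)
    have "bump z (x + h) - bump z x - l h = (cap sy - cap sx - cap' sx * (sy - sx)) + cap' sx * q"
      unfolding bs ls by (simp add: right_diff_distrib)
    also have "\<bar>\<dots>\<bar> \<le> \<bar>cap sy - cap sx - cap' sx * (sy - sx)\<bar> + \<bar>cap' sx\<bar> * \<bar>q\<bar>"
      by (metis abs_triangle_ineq abs_mult)
    also have "\<dots> \<le> (128 * e)\<^sup>2 + 2 * (64 * e\<^sup>2)"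
    proof (intro add_mono mult_mono c')
      have "(sy - sx)\<^sup>2 \<le> (128 * e)\<^sup>2" using sd by (metis abs_ge_zero power2_abs power_mono)
      then show "\<bar>cap sy - cap sx - cap' sx * (sy - sx)\<bar> \<le> (128 * e)\<^sup>2"
        using cap_taylor order_trans by blast
    qed (use q in auto)
    also have "\<dots> \<le> 17000 * e\<^sup>2" by (simp add: power_mult_distrib)
    finally show "\<bar>bump z (x + h) - bump z x - l h\<bar> \<le> 17000 * (norm h / d x)\<^sup>2"
      by (simp add: e_def D_def)
  qed
qed

lemma linear_scaleR_const: "linear f \<Longrightarrow> linear (\<lambda>v. f v *\<^sub>R c)" for f :: "'c::real_vector \<Rightarrow> real"
  by (rule linearI) (simp_all add: linear_add linear_scale scaleR_add_left)

text \<open>\<open>w\<close> corrects the derivative \<open>L (near x)\<close> of the nearest jet.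
  The expansion is asked only for increments up to \<open>d x / 16\<close>; longer ones are compared
  through \<open>A\<close>.\<close>

definition expands where
  "expands C x w \<longleftrightarrow> linear w \<and> norm (ext x - T (near x) x) \<le> C * d x powr (1 + \<alpha>) \<and>
     (\<forall>v. norm (w v) \<le> C * d x powr \<alpha> * norm v) \<and>
     (\<forall>y. dist x y \<le> d x / 16 \<longrightarrow>
        norm (ext y - ext x - (L (near x) (y - x) + w (y - x))) \<le> C * dist x y powr (1 + \<alpha>))"

text \<open>After subtracting the Taylor polynomial at \<open>near x\<close>, \<open>ext\<close> is
  a weighted average of differences \<open>\<tau>\<close> of Taylor polynomials, of size
  \<open>D powr (1 + \<alpha>)\<close>, with weights varying at scale \<open>D = d x\<close>. The
  quotient rule leaves a remainder \<open>D powr (1 + \<alpha>)\<close> times the square of |h| / D,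
  which is at most |h|^(1+\<alpha>) because |h| \<le> D and \<alpha> \<le> 1.\<close>

lemma ext_estimate:
  obtains C where "0 \<le> C"
    "\<And>x. x \<notin> A \<Longrightarrow> \<exists>w. expands C x w"
proof -
  define M where "M = real ((60 * DIM('a) + 1) ^ DIM('a))"
  define Q where "Q = 17000 * M"
  define PP where "PP = 40000 * M * (18 * K)"
  have M: "1 \<le> M" unfolding M_def by (simp add: of_nat_power[symmetric] del: of_nat_power)
  have Q: "1 \<le> Q" using M by (simp add: Q_def)
  have PP: "0 \<le> PP" using M K by (simp add: PP_def)
  show thesis
  proof (rule that[of "30 * Q\<^sup>2 * PP"])
    show "0 \<le> 30 * Q\<^sup>2 * PP" using PP by simp
    fix x assume x: "x \<notin> A"
    define D p where "D = d x" and "p = near x"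
    \<comment> \<open>The factor is 2 * 3^2, from \<open>T_diff\<close> at distance 3 D.\<close>
    define U where "U = 18 * K * D powr (1 + \<alpha>)"
    have D: "0 < D" using x d_pos_iff by (auto simp: D_def)
    have U: "0 \<le> U" using K by (simp add: U_def)
    \<comment> \<open>40000 dominates the factors 1, 129 and 34128 arising for the value, the
      derivative and the remainder.\<close>
    define P where "P = 40000 * M * U"
    have P_eq: "P = PP * D powr (1 + \<alpha>)" by (simp add: P_def PP_def U_def)
    have P0: "0 \<le> P" using M U by (simp add: P_def)
    have fin: "finite (N x)" and card: "real (card (N x)) \<le> M"
      using N_finite[OF x] by (simp_all add: M_def)
    have nsum: "norm (\<Sum>z\<in>N x. f z) \<le> M * c" if "\<And>z. z \<in> N x \<Longrightarrow> norm (f z) \<le> c" "0 \<le> c"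
      for f :: "'a \<Rightarrow> 'c::real_normed_vector" and c
    proof -
      have "norm (\<Sum>z\<in>N x. f z) \<le> real (card (N x)) * c"
        by (rule sum_norm_bound) (rule that)
      also have "\<dots> \<le> M * c" by (rule mult_right_mono[OF card that(2)])
      finally show ?thesis .
    qed
    have "\<forall>z\<in>N x. \<exists>l. linear l \<and> (\<forall>v. \<bar>l v\<bar> \<le> 128 * (norm v / D)) \<and>
        (\<forall>h. norm h \<le> D \<longrightarrow> \<bar>bump z (x + h) - bump z x - l h\<bar> \<le> 17000 * (norm h / D)\<^sup>2)"
      using bump_taylor[OF x] unfolding D_def by metis
    then obtain l where l: "\<And>z. z \<in> N x \<Longrightarrow> linear (l z)"
      "\<And>z v. z \<in> N x \<Longrightarrow> \<bar>l z v\<bar> \<le> 128 * (norm v / D)"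
      "\<And>z h. z \<in> N x \<Longrightarrow> norm h \<le> D \<Longrightarrow> \<bar>bump z (x + h) - bump z x - l z h\<bar> \<le> 17000 * (norm h / D)\<^sup>2"
      by metis
    define \<tau> where "\<tau> z y = T (near z) y - T p y" for z y
    define dL where "dL z v = L (near z) v - L p v" for z v
    have pA: "p \<in> A" "dist x p = D" using near[of x] by (auto simp: p_def D_def)
    have np: "dist (near z) p \<le> 3 * D" "dist x (near z) \<le> 3 * D" if "z \<in> N x" for z
    proof -
      have "dist x z \<le> D / 2" "dist z (near z) \<le> 3 / 2 * D"
        using that N_d(2)[OF that] near(2)[of z] by (auto simp: N_def D_def)
      then show "dist (near z) p \<le> 3 * D" "dist x (near z) \<le> 3 * D"
        using dist_triangle[of x "near z" z] dist_triangle[of "near z" p x] pA(2) D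
        by (auto simp: dist_commute)
    qed
    have \<tau>0: "norm (\<tau> z x) \<le> U" if "z \<in> N x" for z
    proof -
      have "norm (\<tau> z x) \<le> 2 * K * (3 * D) powr (1 + \<alpha>)"
        unfolding \<tau>_def by (rule T_diff) (use near pA np[OF that] in auto)
      also have "\<dots> \<le> 2 * K * (3\<^sup>2 * D powr (1 + \<alpha>))"
        using K D \<alpha> by (intro mult_left_mono powr_scale_le) auto
      finally show ?thesis by (simp add: U_def)
    qed
    have dLb: "norm (dL z v) \<le> U * (norm v / D)" if "z \<in> N x" for z v
    proof -
      have "norm (dL z v) \<le> K * dist (near z) p powr \<alpha> * norm v"
        unfolding dL_def by (rule jet1) (use near pA in auto)
      also have "\<dots> \<le> K * (3 * D powr \<alpha>) * norm v"
      proof (intro mult_right_mono mult_left_mono K)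
        have "dist (near z) p powr \<alpha> \<le> (3 * D) powr \<alpha>"
          using np(1)[OF that] \<alpha> by (intro powr_mono2) auto
        also have "\<dots> \<le> 3 * D powr \<alpha>" using D \<alpha> by (intro powr_scale_le) auto
        finally show "dist (near z) p powr \<alpha> \<le> 3 * D powr \<alpha>" .
      qed simp
      also have "\<dots> \<le> 18 * K * D powr \<alpha> * norm v"
        using K by (simp add: mult_right_mono)
      also have "\<dots> = U * (norm v / D)" using D by (simp add: U_def powr_one_plus)
      finally show ?thesis .
    qed
    have dLlin: "linear (dL z)" for z
      unfolding dL_def by (intro linear_compose_sub lin near pA)
    have \<tau>h: "\<tau> z (x + h) = \<tau> z x + dL z h" for z h
    proof -
      have "L a (x + h - a) = L a (x - a) + L a h" if "a \<in> A" for a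
        using linear_add[OF lin[OF that], of "x - a" h] by (simp add: algebra_simps)
      then show ?thesis using near(1)[of z] pA(1) by (simp add: \<tau>_def T_def dL_def)
    qed
    define u0 where "u0 = (\<Sum>z\<in>N x. bump z x *\<^sub>R \<tau> z x)"
    define m where "m v = (\<Sum>z\<in>N x. bump z x *\<^sub>R dL z v + l z v *\<^sub>R \<tau> z x)" for v
    define S0 where "S0 = (\<Sum>z\<in>N x. bump z x)"
    define \<sigma> where "\<sigma> v = (\<Sum>z\<in>N x. l z v)" for v
    define w where "w v = (m v - \<sigma> v *\<^sub>R (u0 /\<^sub>R S0)) /\<^sub>R S0" for v
    have wlin: "linear w"
    proof -
      have "linear m" unfolding m_def
        by (intro linear_compose_sum linear_compose_add ballI linear_compose_scale_right dLlin linear_scaleR_const l)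
      moreover have "linear \<sigma>" unfolding \<sigma>_def by (intro linear_compose_sum ballI l)
      ultimately show ?thesis unfolding w_def
        by (intro linear_compose_scale_right linear_compose_sub linear_scaleR_const)
    qed
    have ext_y: "ext y = T p y + (\<Sum>z\<in>N x. bump z y *\<^sub>R \<tau> z y) /\<^sub>R (\<Sum>z\<in>N x. bump z y)"
      and half: "1/2 \<le> (\<Sum>z\<in>N x. bump z y)" if y: "dist x y \<le> D / 16" for y
    proof -
      note e = ext_local[OF x y[unfolded D_def]]
      show "1/2 \<le> (\<Sum>z\<in>N x. bump z y)" by (rule e(2))
      have "(\<Sum>z\<in>N x. bump z y *\<^sub>R T (near z) y) =
          (\<Sum>z\<in>N x. bump z y *\<^sub>R \<tau> z y) + (\<Sum>z\<in>N x. bump z y) *\<^sub>R T p y"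
        by (simp add: \<tau>_def scaleR_diff_right sum_subtractf scaleR_sum_left)
      then show "ext y = T p y + (\<Sum>z\<in>N x. bump z y *\<^sub>R \<tau> z y) /\<^sub>R (\<Sum>z\<in>N x. bump z y)"
        using e(1,2) by (simp add: scaleR_add_right)
    qed
    have bn: "\<bar>bump z y\<bar> \<le> 1" for z y using bump_range[of z y] by simp
    have est: "norm (u0 /\<^sub>R S0) \<le> 2 * P"
      "norm (w h) \<le> 6 * Q * P * (norm h / D)"
      "norm (ext (x + h) - ext x - (L p h + w h)) \<le> 30 * Q\<^sup>2 * P * (norm h / D)\<^sup>2"
      if h: "norm h \<le> D / 16" for h
    proof -
      define e where "e = norm h / D"
      have e: "0 \<le> e" "e \<le> 1" using h D by (auto simp: e_def divide_le_eq)
      have ee: "e\<^sup>2 \<le> e" using e by (simp add: power2_eq_square mult_left_le)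
      have hD: "norm h \<le> D" using h D by simp
      define R where "R z = bump z (x + h) - bump z x - l z h" for z
      define r where "r z = l z h *\<^sub>R dL z h + R z *\<^sub>R \<tau> z (x + h)" for z
      have Rb: "\<bar>R z\<bar> \<le> 17000 * e\<^sup>2" if "z \<in> N x" for z
        using l(3)[OF that hD] by (simp add: R_def e_def)
      have "(\<Sum>z\<in>N x. bump z (x + h) *\<^sub>R \<tau> z (x + h)) =
          (\<Sum>z\<in>N x. bump z x *\<^sub>R \<tau> z x + (bump z x *\<^sub>R dL z h + l z h *\<^sub>R \<tau> z x) + r z)"
      proof (rule sum.cong[OF refl])
        fix z
        have "bump z (x + h) = bump z x + l z h + R z" by (simp add: R_def)
        then show "bump z (x + h) *\<^sub>R \<tau> z (x + h) =
            bump z x *\<^sub>R \<tau> z x + (bump z x *\<^sub>R dL z h + l z h *\<^sub>R \<tau> z x) + r z"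
          unfolding r_def \<tau>h by (simp add: scaleR_add_left scaleR_add_right algebra_simps)
      qed
      then have u: "(\<Sum>z\<in>N x. bump z (x + h) *\<^sub>R \<tau> z (x + h)) = u0 + m h + (\<Sum>z\<in>N x. r z)"
        by (simp add: sum.distrib u0_def m_def)
      have S: "(\<Sum>z\<in>N x. bump z (x + h)) = S0 + \<sigma> h + (\<Sum>z\<in>N x. R z)"
        by (simp add: S0_def \<sigma>_def R_def sum.distrib sum_subtractf)
      have u0b: "norm u0 \<le> P"
      proof -
        have "norm u0 \<le> M * U" unfolding u0_def
        proof (rule nsum[OF _ U])
          fix z assume "z \<in> N x"
          then show "norm (bump z x *\<^sub>R \<tau> z x) \<le> U"
            using mult_mono[OF bn \<tau>0] by simp
        qed
        also have "\<dots> \<le> P" using M U by (simp add: P_def)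
        finally show ?thesis .
      qed
      have mb: "norm (m h) \<le> P * e"
      proof -
        have "norm (m h) \<le> M * (129 * U * e)" unfolding m_def
        proof (rule nsum)
          fix z assume z: "z \<in> N x"
          have lz: "\<bar>l z h\<bar> \<le> 128 * e" "norm (dL z h) \<le> U * e"
            using l(2)[OF z, of h] dLb[OF z, of h] by (simp_all add: e_def)
          have "norm (bump z x *\<^sub>R dL z h + l z h *\<^sub>R \<tau> z x) \<le> \<bar>bump z x\<bar> * norm (dL z h) + \<bar>l z h\<bar> * norm (\<tau> z x)"
            by (rule order_trans[OF norm_triangle_ineq]) simp
          also have "\<dots> \<le> 1 * (U * e) + (128 * e) * U"
            by (intro add_mono mult_mono lz bn \<tau>0 z) (use e U in auto)
          finally show "norm (bump z x *\<^sub>R dL z h + l z h *\<^sub>R \<tau> z x) \<le> 129 * U * e" by simp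
        qed (use U e in auto)
        also have "\<dots> \<le> P * e" using M U e by (simp add: P_def mult_right_mono)
        finally show ?thesis .
      qed
      have rb: "norm (\<Sum>z\<in>N x. r z) \<le> P * e\<^sup>2"
      proof -
        have "norm (\<Sum>z\<in>N x. r z) \<le> M * (40000 * U * e\<^sup>2)"
        proof (rule nsum)
          fix z assume z: "z \<in> N x"
          have "norm (\<tau> z (x + h)) \<le> U + U * e"
            unfolding \<tau>h using norm_triangle_ineq add_mono[OF \<tau>0[OF z] dLb[OF z, of h]] order_trans
            unfolding e_def by blast
          also have "\<dots> \<le> 2 * U" using mult_left_mono[OF e(2) U] by simp
          finally have \<tau>2: "norm (\<tau> z (x + h)) \<le> 2 * U" .
          have lz: "\<bar>l z h\<bar> \<le> 128 * e" "norm (dL z h) \<le> U * e"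
            using l(2)[OF z, of h] dLb[OF z, of h] by (simp_all add: e_def)
          have "norm (r z) \<le> \<bar>l z h\<bar> * norm (dL z h) + \<bar>R z\<bar> * norm (\<tau> z (x + h))"
            unfolding r_def by (rule order_trans[OF norm_triangle_ineq]) simp
          also have "\<dots> \<le> (128 * e) * (U * e) + (17000 * e\<^sup>2) * (2 * U)"
            by (intro add_mono mult_mono lz Rb \<tau>2 z) (use e U in auto)
          also have "\<dots> \<le> 40000 * U * e\<^sup>2" using U by (simp add: power2_eq_square)
          finally show "norm (r z) \<le> 40000 * U * e\<^sup>2" .
        qed (use U in auto)
        then show ?thesis by (simp add: P_def)
      qed
      have \<sigma>b: "\<bar>\<sigma> h\<bar> \<le> Q * e"
      proof -
        have "norm (\<sigma> h) \<le> M * (128 * e)" unfolding \<sigma>_def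
          by (rule nsum) (use l(2)[of _ h] e in \<open>auto simp: e_def\<close>)
        also have "\<dots> \<le> Q * e" using M e by (simp add: Q_def)
        finally show ?thesis by simp
      qed
      have RSb: "\<bar>\<Sum>z\<in>N x. R z\<bar> \<le> Q * e\<^sup>2"
        using nsum[of R "17000 * e\<^sup>2"] Rb by (simp add: Q_def)
      have dx: "dist x (x + h) \<le> D / 16" "dist x x \<le> D / 16" using h D by (auto simp: dist_norm)
      note q = quotient_taylor[OF u S half[OF dx(1)] half[OF dx(2), folded S0_def] u0b mb rb \<sigma>b RSb Q e]
      show "norm (u0 /\<^sub>R S0) \<le> 2 * P" by (rule q(1))
      show "norm (w h) \<le> 6 * Q * P * (norm h / D)" using q(2) by (simp add: w_def e_def)
      have "T p (x + h) = T p x + L p h"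
        using linear_add[OF lin[OF pA(1)], of "x - p" h] by (simp add: T_def algebra_simps)
      then have eq: "ext (x + h) - ext x - (L p h + w h) = (\<Sum>z\<in>N x. bump z (x + h) *\<^sub>R \<tau> z (x + h)) /\<^sub>R (\<Sum>z\<in>N x. bump z (x + h)) - u0 /\<^sub>R S0 - w h"
        by (simp add: ext_y[OF dx(1)] ext_y[OF dx(2)] u0_def S0_def)
      show "norm (ext (x + h) - ext x - (L p h + w h)) \<le> 30 * Q\<^sup>2 * P * (norm h / D)\<^sup>2"
        unfolding eq using q(3) unfolding w_def e_def .
    qed
    have C1: "2 * PP \<le> 30 * Q\<^sup>2 * PP" and C2: "6 * Q * PP \<le> 30 * Q\<^sup>2 * PP"
    proof -
      have "1 * Q \<le> Q * Q" using Q by (intro mult_right_mono) auto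
      then have "2 \<le> 30 * Q\<^sup>2" "6 * Q \<le> 30 * Q\<^sup>2" using Q unfolding power2_eq_square by linarith+
      then show "2 * PP \<le> 30 * Q\<^sup>2 * PP" "6 * Q * PP \<le> 30 * Q\<^sup>2 * PP"
        using PP by (simp_all only: mult_right_mono)
    qed
    show "\<exists>w. expands (30 * Q\<^sup>2 * PP) x w"
      unfolding expands_def
    proof (intro exI[of _ w] conjI allI impI wlin)
      have "norm (ext x - T p x) \<le> 2 * P"
        using est(1)[of 0] ext_y[of x] D by (simp add: u0_def S0_def)
      also have "\<dots> \<le> 30 * Q\<^sup>2 * PP * D powr (1 + \<alpha>)"
        using mult_right_mono[OF C1, of "D powr (1 + \<alpha>)"] by (simp add: P_eq)
      finally show "norm (ext x - T (near x) x) \<le> 30 * Q\<^sup>2 * PP * d x powr (1 + \<alpha>)"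
        by (simp add: p_def D_def)
    next
      fix v
      have "norm (w v) \<le> 6 * Q * P * (norm v / D)"
      proof (cases "v = 0")
        case True then show ?thesis using linear_0[OF wlin] by simp
      next
        case False
        \<comment> \<open>The bound on \<open>w\<close> is known for vectors of norm at most D / 16;
          linearity rescales it to all \<open>v\<close>.\<close>
        define c where "c = D / (16 * norm v)"
        have c: "0 < c" using False D by (simp add: c_def)
        have "norm (w (c *\<^sub>R v)) \<le> 6 * Q * P * (norm (c *\<^sub>R v) / D)"
          using False D by (intro est(2)) (simp add: c_def)
        then have "c * norm (w v) \<le> c * (6 * Q * P * (norm v / D))"
          using c by (simp add: linear_scale[OF wlin] algebra_simps)
        then show ?thesis using c by (rule mult_left_le_imp_le)
      qed
      also have "\<dots> = (6 * Q * PP) * (D powr \<alpha> * norm v)"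
        using D by (simp add: P_eq powr_one_plus)
      also have "\<dots> \<le> (30 * Q\<^sup>2 * PP) * (D powr \<alpha> * norm v)"
        by (rule mult_right_mono[OF C2]) simp
      finally show "norm (w v) \<le> 30 * Q\<^sup>2 * PP * d x powr \<alpha> * norm v"
        by (simp add: D_def mult.assoc)
    next
      fix y assume y: "dist x y \<le> d x / 16"
      define h where "h = y - x"
      have nh: "norm h = dist x y" by (simp add: h_def dist_norm norm_minus_commute)
      have "norm (ext (x + h) - ext x - (L p h + w h)) \<le> 30 * Q\<^sup>2 * P * (norm h / D)\<^sup>2"
        by (rule est(3)) (use y nh D_def in auto)
      also have "(norm h / D)\<^sup>2 \<le> (norm h / D) powr (1 + \<alpha>)"
      proof -
        have "(norm h / D) powr 2 \<le> (norm h / D) powr (1 + \<alpha>)"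
          by (rule powr_mono') (use y nh D D_def \<alpha> in auto)
        then show ?thesis using D by simp
      qed
      then have "30 * Q\<^sup>2 * P * (norm h / D)\<^sup>2 \<le> 30 * Q\<^sup>2 * P * (norm h / D) powr (1 + \<alpha>)"
        using P0 by (intro mult_left_mono) auto
      also have "\<dots> = 30 * Q\<^sup>2 * PP * dist x y powr (1 + \<alpha>)"
        using D nh by (simp add: P_eq powr_divide)
      finally show "norm (ext y - ext x - (L (near x) (y - x) + w (y - x))) \<le> 30 * Q\<^sup>2 * PP * dist x y powr (1 + \<alpha>)"
        by (simp add: h_def p_def)
    qed
  qed
qed

text \<open>Increments up to \<open>d x / 16\<close> are handled by \<open>expands\<close>. For a
  longer one both endpoints are within 17 |x - y| of \<open>A\<close>, so \<open>ext\<close> is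
  close there to Taylor polynomials at nearest points, and these are compared by
  \<open>T_diff\<close>. The last clause keeps values in a subspace; it makes the extension map into
  an orthogonal complement, as a graph requires.\<close>

theorem whitney_extension:
  obtains F L' C where "\<And>a. a \<in> A \<Longrightarrow> F a = g a" "\<And>x. linear (L' x)" "0 \<le> C"
    "\<And>x y. norm (F y - F x - L' x (y - x)) \<le> C * dist x y powr (1 + \<alpha>)"
    "\<And>W. subspace W \<Longrightarrow> g ` A \<subseteq> W \<Longrightarrow> (\<And>a v. a \<in> A \<Longrightarrow> L a v \<in> W) \<Longrightarrow> range F \<subseteq> W"
proof -
  obtain C where C: "0 \<le> C"
    and local: "\<And>x. x \<notin> A \<Longrightarrow> \<exists>w. expands C x w"
    by (rule ext_estimate) (rule that)
  have "\<exists>w. expands C x w" for x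
  proof (cases "x \<in> A")
    case True
    then have "d x = 0" by (simp add: d_def)
    then show ?thesis using True lin[OF True] unfolding expands_def
      by (intro exI[of _ "\<lambda>_. 0"]) (auto simp: near_A ext_def T_def linear_0 linear_iff)
  next
    case False then show ?thesis by (rule local)
  qed
  then obtain w where ex: "\<And>x. expands C x (w x)" by metis
  have w: "linear (w x)" "norm (ext x - T (near x) x) \<le> C * d x powr (1 + \<alpha>)"
    "norm (w x v) \<le> C * d x powr \<alpha> * norm v"
    "dist x y \<le> d x / 16 \<Longrightarrow>
       norm (ext y - ext x - (L (near x) (y - x) + w x (y - x))) \<le> C * dist x y powr (1 + \<alpha>)" for x y v
    using ex[of x] unfolding expands_def by blast+
  define L' where "L' x v = L (near x) v + w x v" for x v
  define C' where "C' = 600 * C + 2400 * K"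
  have C': "C \<le> C'" using C K by (simp add: C'_def)
  show thesis
  proof
    show "ext a = g a" if "a \<in> A" for a using that by (simp add: ext_def)
    show "linear (L' x)" for x unfolding L'_def by (intro linear_compose_add lin near w)
    show "0 \<le> C'" using C C' by simp
    show "norm (ext y - ext x - L' x (y - x)) \<le> C' * dist x y powr (1 + \<alpha>)" for x y
    proof (cases "dist x y \<le> d x / 16")
      case True
      have "C * dist x y powr (1 + \<alpha>) \<le> C' * dist x y powr (1 + \<alpha>)"
        using C' by (rule mult_right_mono) simp
      then show ?thesis using w(4)[OF True] by (simp add: L'_def)
    next
      case False
      define r where "r = dist x y"
      define R where "R = r powr (1 + \<alpha>)"
      define p q where "p = near x" and "q = near y"
      have r: "0 \<le> r" "d x \<le> 16 * r" using False by (auto simp: r_def)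
      have dy: "d y \<le> 17 * r" using d_lipschitz[of x y] r by (simp add: r_def)
      have pq: "dist q p \<le> 34 * r"
        using dist_triangle[of q p y] dist_triangle[of y p x] near(2)[of x] near(2)[of y] r dy
        by (simp add: p_def q_def r_def dist_commute)
      have "norm (ext y - T q y) \<le> C * (17 * r) powr (1 + \<alpha>)"
        using w(2)[of y] C powr_mono2[OF _ d_nonneg dy, of "1 + \<alpha>"] \<alpha>
        unfolding q_def by (meson add_nonneg_nonneg less_imp_le mult_left_mono order_trans zero_le_one)
      also have "\<dots> \<le> C * (17\<^sup>2 * R)"
        unfolding R_def using r \<alpha> by (intro mult_left_mono C powr_scale_le) auto
      finally have e1: "norm (ext y - T q y) \<le> 289 * C * R" by simp
      have "norm (ext x - T p x) \<le> C * (16 * r) powr (1 + \<alpha>)"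
        using w(2)[of x] C powr_mono2[OF _ d_nonneg r(2), of "1 + \<alpha>"] \<alpha>
        unfolding p_def by (meson add_nonneg_nonneg less_imp_le mult_left_mono order_trans zero_le_one)
      also have "\<dots> \<le> C * (16\<^sup>2 * R)"
        unfolding R_def using r \<alpha> by (intro mult_left_mono C powr_scale_le) auto
      finally have e2: "norm (T p x - ext x) \<le> 256 * C * R" by (simp add: norm_minus_commute)
      have "norm (T q y - T p y) \<le> 2 * K * (34 * r) powr (1 + \<alpha>)"
        by (rule T_diff) (use near[of x] near[of y] pq dy r in \<open>auto simp: p_def q_def\<close>)
      also have "\<dots> \<le> 2 * K * (34\<^sup>2 * R)"
        unfolding R_def using r \<alpha> K by (intro mult_left_mono powr_scale_le) auto
      finally have e3: "norm (T q y - T p y) \<le> 2312 * K * R" by simp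
      have "norm (w x (y - x)) \<le> C * (16 * r) powr \<alpha> * r"
      proof -
        have "d x powr \<alpha> \<le> (16 * r) powr \<alpha>" using powr_mono2[OF _ d_nonneg r(2)] \<alpha> by simp
        then have "C * d x powr \<alpha> * norm (y - x) \<le> C * (16 * r) powr \<alpha> * r"
          using C by (intro mult_mono) (auto simp: r_def dist_norm norm_minus_commute)
        then show ?thesis using w(3)[of x "y - x"] by linarith
      qed
      also have "\<dots> \<le> C * (16 * r powr \<alpha>) * r"
        using r \<alpha> C by (intro mult_left_mono mult_right_mono powr_scale_le) auto
      also have "\<dots> = 16 * C * R" using r by (simp add: R_def powr_one_plus)
      finally have e4: "norm (w x (y - x)) \<le> 16 * C * R" .
      have "T p y = T p x + L p (y - x)"
        using linear_add[OF lin[OF near(1)], of x "x - p" "y - x"] by (simp add: T_def p_def)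
      then have eq: "ext y - ext x - L' x (y - x) = (ext y - T q y) + (T q y - T p y) + (T p x - ext x) - w x (y - x)"
        by (simp add: L'_def p_def)
      have "norm (ext y - ext x - L' x (y - x)) \<le> norm (ext y - T q y) + norm (T q y - T p y) + norm (T p x - ext x) + norm (w x (y - x))"
            unfolding eq using norm_triangle_ineq4[of "(ext y - T q y) + (T q y - T p y) + (T p x - ext x)" "w x (y - x)"]
          norm_triangle_ineq[of "(ext y - T q y) + (T q y - T p y)" "T p x - ext x"]
          norm_triangle_ineq[of "ext y - T q y" "T q y - T p y"] by linarith
      also have "\<dots> \<le> 289 * C * R + 2312 * K * R + 256 * C * R + 16 * C * R"
        using e1 e2 e3 e4 by linarith
      also have "\<dots> = (561 * C + 2312 * K) * R" by (simp add: algebra_simps)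
      also have "\<dots> \<le> C' * R" using C K by (intro mult_right_mono) (auto simp: C'_def R_def)
      finally show ?thesis by (simp add: R_def r_def)
    qed
    fix W assume W: "subspace W" "g ` A \<subseteq> W" "\<And>a v. a \<in> A \<Longrightarrow> L a v \<in> W"
    have "T a x \<in> W" if "a \<in> A" for a x
      using W that by (auto simp: T_def intro: subspace_add)
    then show "range ext \<subseteq> W"
      using W near by (auto simp: ext_def intro!: subspace_scale subspace_sum)
  qed
qed

end

section \<open>From jets to Hoelder graphs\<close>

lemma powr_bound_small:
  fixes C \<alpha> e :: real
  assumes "0 \<le> C" "0 < \<alpha>" "0 < e"
  obtains \<delta> where "0 < \<delta>" "\<And>t. 0 \<le> t \<Longrightarrow> t \<le> \<delta> \<Longrightarrow> C * t powr \<alpha> < e"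
proof
  define \<delta> where "\<delta> = (e / (C + 1)) powr (1 / \<alpha>)"
  show "0 < \<delta>" using assms by (simp add: \<delta>_def)
  fix t assume t: "0 \<le> t" "t \<le> \<delta>"
  have "t powr \<alpha> \<le> \<delta> powr \<alpha>" using t assms by (intro powr_mono2) auto
  also have "\<dots> = e / (C + 1)" using assms by (simp add: \<delta>_def powr_powr)
  finally have "C * t powr \<alpha> \<le> C * (e / (C + 1))" using assms by (intro mult_left_mono) auto
  also have "\<dots> < e" using assms by (simp add: field_simps)
  finally show "C * t powr \<alpha> < e" .
qed

lemma holder_uniformly_continuous:
  assumes "0 \<le> C" "0 < \<alpha>" "\<And>x y. x \<in> A \<Longrightarrow> y \<in> A \<Longrightarrow> dist (f x) (f y) \<le> C * dist x y powr \<alpha>"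
  shows "uniformly_continuous_on A f"
  unfolding uniformly_continuous_on_def
proof (intro allI impI)
  fix e :: real assume "0 < e"
  with powr_bound_small[OF assms(1,2)] obtain \<delta>
    where "0 < \<delta>" "\<And>t. 0 \<le> t \<Longrightarrow> t \<le> \<delta> \<Longrightarrow> C * t powr \<alpha> < e" by metis
  then show "\<exists>\<delta>>0. \<forall>x\<in>A. \<forall>x'\<in>A. dist x' x < \<delta> \<longrightarrow> dist (f x') (f x) < e"
    using assms(3) by (meson le_less_trans less_imp_le zero_le_dist)
qed

text \<open>The good points of the stopping argument are not known to form a closed set. Values and
  derivatives on basis vectors are uniformly continuous, so they extend to the closure, and the jet
  inequalities pass to limits of sequences.\<close>

lemma holder_jet_closure:
  fixes A :: "'a::euclidean_space set" and g :: "'a \<Rightarrow> 'b::euclidean_space"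
  assumes ne: "A \<noteq> {}" and \<alpha>: "0 < \<alpha>" "\<alpha> \<le> 1" and K: "0 \<le> K" "0 \<le> M"
    and lin: "\<And>a. a \<in> A \<Longrightarrow> linear (L a)"
    and lip: "\<And>a b. a \<in> A \<Longrightarrow> b \<in> A \<Longrightarrow> dist (g a) (g b) \<le> M * dist a b"
    and jet0: "\<And>a b. a \<in> A \<Longrightarrow> b \<in> A \<Longrightarrow> norm (g b - g a - L a (b - a)) \<le> K * dist a b powr (1 + \<alpha>)"
    and jet1: "\<And>a b u. a \<in> A \<Longrightarrow> b \<in> A \<Longrightarrow> norm (L a u - L b u) \<le> K * dist a b powr \<alpha> * norm u"
    and W: "closed W" "subspace W" "g ` A \<subseteq> W" "\<And>a v. a \<in> A \<Longrightarrow> L a v \<in> W"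
  obtains g' L' where "\<And>a. a \<in> A \<Longrightarrow> g' a = g a" "holder_jet (closure A) g' L' K \<alpha>"
    "g' ` closure A \<subseteq> W" "\<And>a v. a \<in> closure A \<Longrightarrow> L' a v \<in> W"
proof -
  have "uniformly_continuous_on A g"
    by (rule holder_uniformly_continuous[of M 1]) (use K lip in auto)
  then obtain g' where g': "uniformly_continuous_on (closure A) g'" "\<And>x. x \<in> A \<Longrightarrow> g x = g' x"
    by (rule uniformly_continuous_on_extension_on_closure) blast
  have "\<exists>h. uniformly_continuous_on (closure A) h \<and> (\<forall>x\<in>A. L x i = h x)" if i: "i \<in> Basis" for i :: 'a
  proof -
    have "uniformly_continuous_on A (\<lambda>a. L a i)"
    proof (rule holder_uniformly_continuous[OF K(1) \<alpha>(1)])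
      show "dist (L x i) (L y i) \<le> K * dist x y powr \<alpha>" if "x \<in> A" "y \<in> A" for x y
        using jet1[OF that, of i] i by (simp add: dist_norm)
    qed
    then show ?thesis by (rule uniformly_continuous_on_extension_on_closure) blast
  qed
  then obtain l where l: "\<And>i. i \<in> Basis \<Longrightarrow> uniformly_continuous_on (closure A) (l i)"
    "\<And>i x. i \<in> Basis \<Longrightarrow> x \<in> A \<Longrightarrow> L x i = l i x"
    by metis
  define L' where "L' x v = (\<Sum>i\<in>Basis. (v \<bullet> i) *\<^sub>R l i x)" for x v
  have L'_A: "L' a v = L a v" if "a \<in> A" for a v
  proof -
    have "L a v = L a (\<Sum>i\<in>Basis. (v \<bullet> i) *\<^sub>R i)" by (simp add: euclidean_representation)
    also have "\<dots> = (\<Sum>i\<in>Basis. (v \<bullet> i) *\<^sub>R L a i)"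
      using lin[OF that] by (simp add: linear_sum linear_scale)
    finally show ?thesis using that l(2) by (simp add: L'_def)
  qed
  have seq: "\<exists>s. (\<forall>n. s n \<in> A) \<and> s \<longlonglongrightarrow> x" if "x \<in> closure A" for x
    using that closure_sequential by blast
  have tg: "(\<lambda>n. g (s n)) \<longlonglongrightarrow> g' x"
    if "x \<in> closure A" "\<And>n. s n \<in> A" "s \<longlonglongrightarrow> x" for s x
  proof -
    have "(\<lambda>n. g' (s n)) \<longlonglongrightarrow> g' x"
      using uniformly_continuous_imp_continuous[OF g'(1)] that closure_subset
      unfolding continuous_on_sequentially comp_def by blast
    then show ?thesis using g'(2) that by simp
  qed
  have tL: "(\<lambda>n. L (s n) (v n)) \<longlonglongrightarrow> L' x u"
    if "x \<in> closure A" "\<And>n. s n \<in> A" "s \<longlonglongrightarrow> x" "v \<longlonglongrightarrow> u" for s x v u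
  proof -
    have "(\<lambda>n. l i (s n)) \<longlonglongrightarrow> l i x" if "i \<in> Basis" for i
      using uniformly_continuous_imp_continuous[OF l(1)[OF that]] \<open>x \<in> closure A\<close> \<open>\<And>n. s n \<in> A\<close>
        \<open>s \<longlonglongrightarrow> x\<close> closure_subset
      unfolding continuous_on_sequentially comp_def by blast
    then have "(\<lambda>n. L' (s n) (v n)) \<longlonglongrightarrow> L' x u"
      unfolding L'_def using that(4) by (intro tendsto_intros) auto
    then show ?thesis using L'_A that by simp
  qed
  show thesis
  proof (rule that[of g' L'])
    show "g' a = g a" if "a \<in> A" for a using g'(2)[OF that] by simp
    show "holder_jet (closure A) g' L' K \<alpha>"
    proof (rule holder_jet.intro)
      show "closed (closure A)" "closure A \<noteq> {}" using ne by auto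
      show "linear (L' a)" for a
        unfolding L'_def by (rule linearI) (simp_all add: inner_simps scaleR_add_left sum.distrib scaleR_sum_right)
      fix a b assume a: "a \<in> closure A" and b: "b \<in> closure A"
      obtain s where s: "\<And>n. s n \<in> A" "s \<longlonglongrightarrow> a" using seq[OF a] by blast
      obtain t where t: "\<And>n. t n \<in> A" "t \<longlonglongrightarrow> b" using seq[OF b] by blast
      have "(\<lambda>n. norm (g (t n) - g (s n) - L (s n) (t n - s n))) \<longlonglongrightarrow> norm (g' b - g' a - L' a (b - a))"
        by (intro tendsto_intros tg tL a b s t)
      moreover have "(\<lambda>n. K * dist (s n) (t n) powr (1 + \<alpha>)) \<longlonglongrightarrow> K * dist a b powr (1 + \<alpha>)"
        by (intro tendsto_intros tendsto_powr' s t) (use \<alpha> in auto)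
      ultimately show "norm (g' b - g' a - L' a (b - a)) \<le> K * dist a b powr (1 + \<alpha>)"
        by (rule LIMSEQ_le) (use jet0 s t in blast)
      fix u
      have "(\<lambda>n. norm (L (s n) u - L (t n) u)) \<longlonglongrightarrow> norm (L' a u - L' b u)"
        by (intro tendsto_intros tL a b s t)
      moreover have "(\<lambda>n. K * dist (s n) (t n) powr \<alpha> * norm u) \<longlonglongrightarrow> K * dist a b powr \<alpha> * norm u"
        by (intro tendsto_intros tendsto_powr' s t) (use \<alpha> in auto)
      ultimately show "norm (L' a u - L' b u) \<le> K * dist a b powr \<alpha> * norm u"
        by (rule LIMSEQ_le) (use jet1 s t in blast)
    qed (use \<alpha> K in auto)
    show "g' ` closure A \<subseteq> W"
    proof (rule image_subsetI)
      fix x assume x: "x \<in> closure A"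
      obtain s where s: "\<And>n. s n \<in> A" "s \<longlonglongrightarrow> x" using seq[OF x] by blast
      show "g' x \<in> W"
        by (rule closed_sequentially[OF W(1) _ tg[OF x s]]) (use W(3) s(1) in blast)
    qed
    fix x v assume x: "x \<in> closure A"
    obtain s where s: "\<And>n. s n \<in> A" "s \<longlonglongrightarrow> x" using seq[OF x] by blast
    show "L' x v \<in> W"
      by (rule closed_sequentially[OF W(1) _ tL[OF x s tendsto_const]]) (use W(4) s(1) in blast)
  qed
qed

text \<open>A first order Taylor estimate between all pairs of points already forces the Hoelder bound on the
  derivative: compare the two expansions at a third point.\<close>

lemma C1_holder_on_taylor:
  fixes F :: "'a::euclidean_space \<Rightarrow> 'b::real_normed_vector"
  assumes \<alpha>: "0 < \<alpha>" "\<alpha> \<le> 1" and lin: "\<And>x. linear (L x)" and C: "0 \<le> C"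
    and tay: "\<And>x y. norm (F y - F x - L x (y - x)) \<le> C * dist x y powr (1 + \<alpha>)"
  shows "C1_holder_on \<alpha> V F"
  unfolding C1_holder_on_def
proof (intro exI[of _ L] conjI ballI exI[of _ "6 * C"])
  fix v
  show "(F has_derivative L v) (at v within V)"
    unfolding has_derivative_within_alt
  proof (intro conjI allI impI)
    show "bounded_linear (L v)" using lin linear_conv_bounded_linear by blast
    fix e :: real assume "0 < e"
    with powr_bound_small[OF C \<alpha>(1)] obtain \<delta>
      where \<delta>: "0 < \<delta>" "\<And>t. 0 \<le> t \<Longrightarrow> t \<le> \<delta> \<Longrightarrow> C * t powr \<alpha> < e" by metis
    show "\<exists>\<delta>>0. \<forall>y\<in>V. norm (y - v) < \<delta> \<longrightarrow> norm (F y - F v - L v (y - v)) \<le> e * norm (y - v)"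
    proof (intro exI[of _ \<delta>] conjI ballI impI \<delta>)
      fix y assume y: "norm (y - v) < \<delta>"
      have "norm (F y - F v - L v (y - v)) \<le> C * norm (y - v) powr (1 + \<alpha>)"
        using tay[of y v] by (simp add: dist_norm norm_minus_commute)
      also have "\<dots> = (C * norm (y - v) powr \<alpha>) * norm (y - v)" by (simp add: powr_one_plus)
      also have "\<dots> \<le> e * norm (y - v)"
        using \<delta>(2)[of "norm (y - v)"] y by (intro mult_right_mono) auto
      finally show "norm (F y - F v - L v (y - v)) \<le> e * norm (y - v)" .
    qed
  qed
next
  fix v w u :: 'a
  show "norm (L v u - L w u) \<le> 6 * C * dist v w powr \<alpha> * norm u"
  proof (cases "v = w \<or> u = 0")
    case True then show ?thesis using C by (auto simp: linear_0[OF lin])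
  next
    case False
    define t where "t = dist v w"
    have t: "0 < t" using False by (simp add: t_def)
    define c where "c = t / norm u"
    have c: "0 < c" using False t by (simp add: c_def)
    define z where "z = w + c *\<^sub>R u"
    have wz: "dist w z = t" using False t by (simp add: z_def dist_norm c_def)
    have vz: "dist v z \<le> 2 * t" using dist_triangle[of v z w] wz by (simp add: t_def)
    define R1 R2 R3 where "R1 = F z - F v - L v (z - v)" and "R2 = F z - F w - L w (z - w)"
      and "R3 = F w - F v - L v (w - v)"
    have "norm R1 \<le> C * (2 * t) powr (1 + \<alpha>)"
      using tay[of z v] mult_left_mono[OF powr_mono2[OF _ zero_le_dist vz, of "1 + \<alpha>"] C] \<alpha>
      by (simp add: R1_def)
    also have "\<dots> \<le> C * (2\<^sup>2 * t powr (1 + \<alpha>))"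
      using t \<alpha> C by (intro mult_left_mono powr_scale_le) auto
    finally have R1: "norm R1 \<le> 4 * C * t powr (1 + \<alpha>)" by simp
    have R2: "norm R2 \<le> C * t powr (1 + \<alpha>)" using tay[of z w] wz by (simp add: R2_def)
    have R3: "norm R3 \<le> C * t powr (1 + \<alpha>)" using tay[of w v] by (simp add: R3_def t_def)
    have "L v (z - v) = L v (z - w) + L v (w - v)"
      using linear_add[OF lin, of v "z - w" "w - v"] by simp
    then have "L v (z - w) - L w (z - w) = R2 + R3 - R1"
      by (simp add: R1_def R2_def R3_def)
    moreover have "L v (z - w) - L w (z - w) = c *\<^sub>R (L v u - L w u)"
      using lin by (simp add: z_def linear_scale scaleR_diff_right)
    ultimately have "c * norm (L v u - L w u) = norm (R2 + R3 - R1)" using c by (metis abs_of_pos norm_scaleR)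
    also have "\<dots> \<le> norm R2 + norm R3 + norm R1"
      using norm_triangle_ineq4[of "R2 + R3" R1] norm_triangle_ineq[of R2 R3] by linarith
    also have "\<dots> \<le> 6 * C * t powr (1 + \<alpha>)" using R1 R2 R3 by linarith
    also have "\<dots> = c * (6 * C * t powr \<alpha> * norm u)" using False t by (simp add: powr_one_plus c_def)
    finally show ?thesis using c unfolding t_def by (rule mult_left_le_imp_le)
  qed
qed

text \<open>Closedness lets a graph split the outer measure of an arbitrary set additively, which
  the exhaustion argument relies on.\<close>

lemma closed_C1_holder_graph:
  assumes "C1_holder_graph k \<alpha> \<Gamma>" shows "closed \<Gamma>"
proof -
  obtain V f where V: "subspace V" and f: "f ` V \<subseteq> orthogonal_comp V" "C1_holder_on \<alpha> V f"
    and \<Gamma>: "\<Gamma> = {v + f v | v. v \<in> V}"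
    using assms unfolding C1_holder_graph_def by blast
  have "continuous_on V f"
    using f(2) has_derivative_continuous unfolding C1_holder_on_def continuous_on_eq_continuous_within by blast
  moreover have "continuous_on UNIV (oproj V)" "continuous_on UNIV (rej V)"
    using linear_continuous_on linear_conv_bounded_linear linear_oproj[OF V] linear_rej[OF V] by blast+
  ultimately have "continuous_on UNIV (\<lambda>x. f (oproj V x))" "continuous_on UNIV (rej V)"
    using continuous_on_compose2[of V f UNIV "oproj V"] oproj_mem[OF V] by auto
  then have "closed {x. rej V x = f (oproj V x)}" by (intro closed_Collect_eq)
  also have "{x. rej V x = f (oproj V x)} = \<Gamma>"
  proof (intro set_eqI iffI)
    fix x assume "x \<in> {x. rej V x = f (oproj V x)}"
    then have "x = oproj V x + f (oproj V x)" using oproj_plus_rej[of V x] by simp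
    then show "x \<in> \<Gamma>" using oproj_mem[OF V] \<Gamma> by blast
  next
    fix x assume "x \<in> \<Gamma>"
    then obtain v where v: "v \<in> V" "x = v + f v" using \<Gamma> by blast
    have "oproj V x = v"
      by (rule oproj_unique[OF V v(1)])
         (use f(1) v in \<open>auto simp: orthogonal_comp_def orthogonal_def inner_commute\<close>)
    then show "x \<in> {x. rej V x = f (oproj V x)}" using v by (simp add: rej_def)
  qed
  finally show ?thesis .
qed

text \<open>The cone condition makes \<open>oproj U\<close> injective on \<open>S\<close> with a
  2-Lipschitz inverse \<open>s\<close>, so bounds stated on \<open>S\<close> transfer to its
  projection \<open>A\<close> at the cost of a factor at most 4. Whitney's theorem is applied in the
  ambient space, with derivatives precomposed with the projection, and the extension is then
  restricted to \<open>U\<close>.\<close>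

lemma jet_graph:
  fixes U :: "'a::euclidean_space set"
  assumes U: "subspace U" "dim U = k" and S: "S \<noteq> {}"
    and \<alpha>: "0 < \<alpha>" "\<alpha> \<le> 1" and K: "0 \<le> K"
    and lin: "\<And>y. y \<in> S \<Longrightarrow> linear (L y)"
    and orth: "\<And>y x v. y \<in> S \<Longrightarrow> v \<in> U \<Longrightarrow> L y x \<bullet> v = 0"
    and LP: "\<And>y x. y \<in> S \<Longrightarrow> L y (oproj U x) = L y x"
    and lip: "\<And>y z. y \<in> S \<Longrightarrow> z \<in> S \<Longrightarrow> norm (rej U (y - z)) \<le> norm (y - z) / 2"
    and jet0: "\<And>y z. y \<in> S \<Longrightarrow> z \<in> S \<Longrightarrow> norm (rej U (z - y) - L y (z - y)) \<le> K * dist y z powr (1 + \<alpha>)"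
    and jet1: "\<And>y z u. y \<in> S \<Longrightarrow> z \<in> S \<Longrightarrow> norm (L y u - L z u) \<le> K * dist y z powr \<alpha> * norm u"
  obtains \<Gamma> where "C1_holder_graph k \<alpha> \<Gamma>" "S \<subseteq> \<Gamma>"
proof -
  define A where "A = oproj U ` S"
  define W where "W = orthogonal_comp U"
  have half: "norm (y - z) \<le> 2 * norm (oproj U y - oproj U z)" "norm (rej U (y - z)) \<le> 1 * norm (oproj U y - oproj U z)"
    if "y \<in> S" "z \<in> S" for y z
  proof -
    have "norm (y - z) \<le> norm (oproj U (y - z)) + norm (rej U (y - z))"
      using norm_triangle_ineq[of "oproj U (y - z)" "rej U (y - z)"] by (simp add: oproj_plus_rej)
    then show "norm (y - z) \<le> 2 * norm (oproj U y - oproj U z)" "norm (rej U (y - z)) \<le> 1 * norm (oproj U y - oproj U z)"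
      using lip[OF that] by (auto simp: oproj_diff[OF U(1)])
  qed
  define s where "s = inv_into S (oproj U)"
  have inj: "inj_on (oproj U) S"
  proof (rule inj_onI)
    fix y z assume "y \<in> S" "z \<in> S" "oproj U y = oproj U z"
    then show "y = z" using half(1)[of y z] by simp
  qed
  have s: "s a \<in> S" "oproj U (s a) = a" if "a \<in> A" for a
    using that inv_into_into[of a "oproj U" S] f_inv_into_f[of a "oproj U" S] by (auto simp: s_def A_def)
  have sS: "s (oproj U y) = y" if "y \<in> S" for y
    using inj that by (simp add: s_def)
  have ds: "dist (s a) (s b) \<le> 2 * dist a b" if "a \<in> A" "b \<in> A" for a b
    using half(1)[OF s(1)[OF that(1)] s(1)[OF that(2)]] s that by (simp add: dist_norm)
  define g where "g a = rej U (s a)" for a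
  define L2 where "L2 a = L (s a)" for a
  have subs: "closed W" "subspace W"
    unfolding W_def by (simp_all add: closed_subspace subspace_orthogonal_comp)
  have gW: "g ` A \<subseteq> W" using rej_orth[OF U(1)]
    by (auto simp: g_def W_def orthogonal_comp_def orthogonal_def inner_commute)
  have LW: "L2 a v \<in> W" if "a \<in> A" for a v
    using orth[OF s(1)[OF that]] by (auto simp: L2_def W_def orthogonal_comp_def orthogonal_def inner_commute)
  have A: "A \<noteq> {}" using S by (simp add: A_def)
  have K4: "0 \<le> 4 * K" using K by simp
  have linA: "linear (L2 a)" if "a \<in> A" for a using lin[OF s(1)[OF that]] by (simp add: L2_def)
  have lipA: "dist (g a) (g b) \<le> 1 * dist a b" if "a \<in> A" "b \<in> A" for a b
    using half(2)[OF s(1)[OF that(1)] s(1)[OF that(2)]] s that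
    by (simp add: g_def dist_norm rej_diff[OF U(1)])
  have j0: "norm (g b - g a - L2 a (b - a)) \<le> 4 * K * dist a b powr (1 + \<alpha>)" if ab: "a \<in> A" "b \<in> A" for a b
  proof -
    have "L2 a (b - a) = L (s a) (s b - s a)"
      using LP[OF s(1)[OF ab(1)], of "s b - s a"] s ab by (simp add: L2_def oproj_diff[OF U(1)])
    then have "norm (g b - g a - L2 a (b - a)) \<le> K * dist (s a) (s b) powr (1 + \<alpha>)"
      using jet0[OF s(1)[OF ab(1)] s(1)[OF ab(2)]] by (simp add: g_def rej_diff[OF U(1)])
    also have "\<dots> \<le> K * (2 * dist a b) powr (1 + \<alpha>)"
      using ds[OF ab] \<alpha> by (intro mult_left_mono powr_mono2 K) auto
    also have "\<dots> \<le> K * (2\<^sup>2 * dist a b powr (1 + \<alpha>))"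
      using \<alpha> by (intro mult_left_mono powr_scale_le K) auto
    finally show ?thesis by simp
  qed
  have j1: "norm (L2 a u - L2 b u) \<le> 4 * K * dist a b powr \<alpha> * norm u" if ab: "a \<in> A" "b \<in> A" for a b u
  proof -
    have "norm (L2 a u - L2 b u) \<le> K * dist (s a) (s b) powr \<alpha> * norm u"
      using jet1[OF s(1)[OF ab(1)] s(1)[OF ab(2)]] by (simp add: L2_def)
    also have "\<dots> \<le> K * (2 * dist a b) powr \<alpha> * norm u"
      using ds[OF ab] \<alpha> by (intro mult_right_mono mult_left_mono powr_mono2 K) auto
    also have "\<dots> \<le> K * (2 * dist a b powr \<alpha>) * norm u"
      using \<alpha> by (intro mult_right_mono mult_left_mono powr_scale_le K) auto
    also have "\<dots> \<le> 4 * K * dist a b powr \<alpha> * norm u" using K by (simp add: mult_right_mono)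
    finally show ?thesis .
  qed
  obtain g' L' where g': "\<And>a. a \<in> A \<Longrightarrow> g' a = g a" and jet: "holder_jet (closure A) g' L' (4 * K) \<alpha>"
    and W': "g' ` closure A \<subseteq> W" "\<And>a v. a \<in> closure A \<Longrightarrow> L' a v \<in> W"
    by (rule holder_jet_closure[OF A \<alpha> K4 zero_le_one linA lipA j0 j1 subs gW LW]) (blast intro: that)+
  interpret holder_jet "closure A" g' L' "4 * K" \<alpha> by (rule jet)
  obtain F D C where F: "\<And>a. a \<in> closure A \<Longrightarrow> F a = g' a" "\<And>x. linear (D x)" "0 \<le> C"
    "\<And>x y. norm (F y - F x - D x (y - x)) \<le> C * dist x y powr (1 + \<alpha>)"
    "\<And>W. subspace W \<Longrightarrow> g' ` closure A \<subseteq> W \<Longrightarrow> (\<And>a v. a \<in> closure A \<Longrightarrow> L' a v \<in> W) \<Longrightarrow> range F \<subseteq> W"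
    by (rule whitney_extension) (blast intro: that)
  have FW: "range F \<subseteq> W" by (rule F(5)[OF subs(2) W'])
  show thesis
  proof (rule that[of "{v + F v | v. v \<in> U}"])
    show "C1_holder_graph k \<alpha> {v + F v | v. v \<in> U}"
      unfolding C1_holder_graph_def
      using U FW C1_holder_on_taylor[OF \<alpha> F(2,3,4)] by (intro exI[of _ U] exI[of _ F]) (auto simp: W_def)
    show "S \<subseteq> {v + F v | v. v \<in> U}"
    proof
      fix y assume y: "y \<in> S"
      then have "oproj U y \<in> A" by (simp add: A_def)
      then have "F (oproj U y) = g (oproj U y)" using F(1) g' closure_subset by (metis subsetD)
      then have "F (oproj U y) = rej U y" by (simp add: g_def sS[OF y])
      then show "y \<in> {v + F v | v. v \<in> U}"
        using oproj_mem[OF U(1), of y] oproj_plus_rej[of U y] by (metis (mono_tags, lifting) mem_Collect_eq)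
    qed
  qed
qed

section \<open>Hausdorff measure: densities and exhaustion\<close>

text \<open>Kept abstract in \<open>\<phi>\<close> because it is applied both to contents at a fixed
  scale and to the outer measure. Bounding finite subsums matches what packing arguments
  deliver.\<close>

lemma countable_subadditive_cover:
  fixes \<phi> :: "'a set \<Rightarrow> ennreal"
  assumes empty: "\<phi> {} = 0" and mono: "\<And>X Y. X \<subseteq> Y \<Longrightarrow> \<phi> X \<le> \<phi> Y"
    and UN: "\<And>A :: nat \<Rightarrow> 'a set. \<phi> (\<Union>n. A n) \<le> (\<Sum>n. \<phi> (A n))"
    and C: "countable C" "X \<subseteq> (\<Union>c\<in>C. A c)"
    and B: "\<And>S. finite S \<Longrightarrow> S \<subseteq> C \<Longrightarrow> (\<Sum>c\<in>S. \<phi> (A c)) \<le> B"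
  shows "\<phi> X \<le> B"
proof -
  define A' where "A' n = (if n \<in> to_nat_on C ` C then A (from_nat_into C n) else {})" for n
  have "X \<subseteq> (\<Union>n. A' n)"
  proof
    fix x assume "x \<in> X"
    then obtain c where c: "c \<in> C" "x \<in> A c" using C(2) by blast
    then have "x \<in> A' (to_nat_on C c)" using C(1) by (simp add: A'_def)
    then show "x \<in> (\<Union>n. A' n)" by blast
  qed
  then have "\<phi> X \<le> (\<Sum>n. \<phi> (A' n))" using mono UN order_trans by blast
  also have "\<dots> \<le> B"
  proof (rule suminf_le_const)
    fix N
    define J where "J = {n \<in> {..<N}. n \<in> to_nat_on C ` C}"
    have "(\<Sum>n<N. \<phi> (A' n)) = (\<Sum>n\<in>J. \<phi> (A (from_nat_into C n)))"
      unfolding J_def by (rule sum.mono_neutral_cong_right) (auto simp: A'_def empty)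
    also have "\<dots> = (\<Sum>c\<in>from_nat_into C ` J. \<phi> (A c))"
    proof (rule sum.reindex[symmetric, unfolded o_def])
      show "inj_on (from_nat_into C) J"
        by (rule inj_on_inverseI[of _ "to_nat_on C"]) (use C(1) in \<open>auto simp: J_def\<close>)
    qed
    also have "\<dots> \<le> B"
      by (rule B) (use C(1) in \<open>auto simp: J_def\<close>)
    finally show "(\<Sum>n<N. \<phi> (A' n)) \<le> B" .
  qed simp
  finally show ?thesis .
qed

lemma hausdorff_outer_cover:
  assumes "countable C" "X \<subseteq> (\<Union>c\<in>C. A c)"
    "\<And>S. finite S \<Longrightarrow> S \<subseteq> C \<Longrightarrow> (\<Sum>c\<in>S. hausdorff_outer k (A c)) \<le> B"
  shows "hausdorff_outer k X \<le> B"
  by (rule countable_subadditive_cover[OF _ _ _ assms])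
     (auto intro: hausdorff_outer_mono hausdorff_outer_UN)

text \<open>\<open>X\<close> is arbitrary: the closed sets are peeled off one after another with
  \<open>hausdorff_outer_closed_split\<close>.\<close>

lemma hausdorff_outer_disjoint_sum:
  assumes "finite S" "\<And>c. c \<in> S \<Longrightarrow> closed (A c)" "disjoint_family_on A S"
  shows "(\<Sum>c\<in>S. hausdorff_outer k (X \<inter> A c)) \<le> hausdorff_outer k X"
  using assms
proof (induction S arbitrary: X rule: finite_induct)
  case (insert c S)
  have "(\<Sum>a\<in>S. hausdorff_outer k (X \<inter> A a)) = (\<Sum>a\<in>S. hausdorff_outer k ((X - A c) \<inter> A a))"
  proof (rule sum.cong[OF refl])
    fix a assume a: "a \<in> S"
    then have "A a \<inter> A c = {}"
      using insert.prems(2) insert.hyps(2) by (auto simp: disjoint_family_on_def)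
    then have "X \<inter> A a = (X - A c) \<inter> A a" by blast
    then show "hausdorff_outer k (X \<inter> A a) = hausdorff_outer k ((X - A c) \<inter> A a)" by simp
  qed
  also have "\<dots> \<le> hausdorff_outer k (X - A c)"
    using insert.prems by (intro insert.IH) (auto simp: disjoint_family_on_def)
  finally have "(\<Sum>a\<in>insert c S. hausdorff_outer k (X \<inter> A a))
      \<le> hausdorff_outer k (X \<inter> A c) + hausdorff_outer k (X - A c)"
    using insert.hyps by (simp add: add_left_mono)
  also have "\<dots> \<le> hausdorff_outer k X"
    using hausdorff_outer_closed_split[of "A c" k X] insert.prems(1) by simp
  finally show ?case .
qed simp

lemma hausdorff_outer_singleton:
  assumes "1 \<le> k" shows "hausdorff_outer k {x} = 0"
proof -
  have "hausdorff_content k \<delta> {x} \<le> 0" if "\<delta> > 0" for \<delta>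
  proof -
    have "hausdorff_content k \<delta> {x} \<le> (\<Sum>i::nat. hausdorff_cost k {x})"
      by (rule hausdorff_content_le) (use that in auto)
    also have "hausdorff_cost k {x} = 0" using assms by (simp add: hausdorff_cost_def)
    finally show ?thesis by simp
  qed
  then have "hausdorff_outer k {x} \<le> 0" unfolding hausdorff_outer_eq_SUP by (intro SUP_least) auto
  then show ?thesis by simp
qed

text \<open>By Vitali, disjoint balls of mass above (N + 1) r^k have sum of r^k at most h / (N + 1),
  and their fivefold enlargements cover. This bounds the content at scale 10 / (N + 1) by 10^k h /
  (N + 1). Contents are used because the enlarged balls are counted by their diameters.\<close>

lemma upper_density_finite:
  fixes E :: "'a::euclidean_space set"
  assumes fin: "hausdorff_outer k E < \<infinity>"
  shows "hausdorff_outer k {x \<in> E. \<forall>N::nat. \<exists>r::real. 0 < r \<and> r \<le> 1 / Suc N \<and>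
           ennreal (Suc N * r ^ k) < hausdorff_outer k (E \<inter> cball x r)} = 0" (is "hausdorff_outer k ?B = 0")
proof -
  obtain h where h: "0 \<le> h" "hausdorff_outer k E = ennreal h"
    using fin by (cases "hausdorff_outer k E") auto
  have small: "hausdorff_content k \<delta> ?B \<le> ennreal (10 ^ k * h / Suc N)"
    if N: "10 / Suc N \<le> \<delta>" for \<delta> and N :: nat
  proof -
    define r where "r x = (SOME r::real. 0 < r \<and> r \<le> 1 / Suc N \<and>
      ennreal (Suc N * r ^ k) < hausdorff_outer k (E \<inter> cball x r))" for x
    have *: "0 < r x \<and> r x \<le> 1 / Suc N \<and> ennreal (Suc N * r x ^ k) < hausdorff_outer k (E \<inter> cball x (r x))"
      if "x \<in> ?B" for x
      unfolding r_def by (rule someI_ex) (use that in blast)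
    then have r: "\<And>x. x \<in> ?B \<Longrightarrow> 0 < r x \<and> r x \<le> 1 / Suc N"
      "\<And>x. x \<in> ?B \<Longrightarrow> ennreal (Suc N * r x ^ k) < hausdorff_outer k (E \<inter> cball x (r x))"
      by blast+
    have sub: "?B \<subseteq> (\<Union>x\<in>?B. cball x (r x))"
    proof
      fix x assume "x \<in> ?B"
      then show "x \<in> (\<Union>x\<in>?B. cball x (r x))" using r(1)[of x] by (intro UN_I[of x]) auto
    qed
    obtain C where C: "countable C" "C \<subseteq> ?B"
      "pairwise (\<lambda>i j. disjnt (cball i (r i)) (cball j (r j))) C" "?B \<subseteq> (\<Union>i\<in>C. cball i (5 * r i))"
      by (rule Vitali_covering_lemma_cballs[OF sub r(1)]) (assumption, rule that)
    show ?thesis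
    proof (rule countable_subadditive_cover[OF _ _ _ C(1,4)])
      have "0 \<le> \<delta>" using N by (meson divide_nonneg_nonneg of_nat_0_le_iff order_trans zero_le_numeral)
      then show "hausdorff_content k \<delta> ({} :: 'a set) = 0" by (rule hausdorff_content_empty)
      fix S assume S: "finite S" "S \<subseteq> C"
      have "(\<Sum>c\<in>S. hausdorff_content k \<delta> (cball c (5 * r c))) \<le> (\<Sum>c\<in>S. ennreal (10 ^ k / Suc N) * hausdorff_outer k (E \<inter> cball c (r c)))"
      proof (rule sum_mono)
        fix c assume "c \<in> S"
        then have c: "c \<in> ?B" using S C by blast
        have diam: "diameter (cball c (5 * r c)) = 10 * r c" using r(1)[OF c] by (simp add: diameter_cball)
        have r10: "10 * r c \<le> 10 / Suc N" using r(1)[OF c] by simp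
        have "hausdorff_content k \<delta> (cball c (5 * r c)) \<le> (\<Sum>i::nat. hausdorff_cost k (if i = 0 then cball c (5 * r c) else {}))"
          by (rule hausdorff_content_le) (use r10 N diam \<open>0 \<le> \<delta>\<close> in \<open>auto intro: exI[of _ 0]\<close>)
        also have "\<dots> = (\<Sum>i\<in>{0::nat}. hausdorff_cost k (if i = 0 then cball c (5 * r c) else {}))"
          by (rule suminf_finite) (auto simp: hausdorff_cost_def)
        also have "\<dots> = ennreal ((10 * r c) ^ k)"
          using r(1)[OF c] diam by (simp add: hausdorff_cost_def)
        also have "\<dots> = ennreal (10 ^ k / Suc N) * ennreal (Suc N * r c ^ k)"
          using r(1)[OF c] by (subst ennreal_mult[symmetric]) (auto simp: power_mult_distrib)
        also have "\<dots> \<le> ennreal (10 ^ k / Suc N) * hausdorff_outer k (E \<inter> cball c (r c))"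
          using r(2)[OF c] by (intro mult_left_mono) auto
        finally show "hausdorff_content k \<delta> (cball c (5 * r c)) \<le> ennreal (10 ^ k / Suc N) * hausdorff_outer k (E \<inter> cball c (r c))" .
      qed
      also have "\<dots> = ennreal (10 ^ k / Suc N) * (\<Sum>c\<in>S. hausdorff_outer k (E \<inter> cball c (r c)))"
        by (simp add: sum_distrib_left)
      also have "\<dots> \<le> ennreal (10 ^ k / Suc N) * hausdorff_outer k E"
      proof (intro mult_left_mono hausdorff_outer_disjoint_sum S)
        show "disjoint_family_on (\<lambda>c. cball c (r c)) S"
          using C(3) S(2) unfolding disjoint_family_on_def pairwise_def disjnt_def by blast
      qed auto
      also have "\<dots> = ennreal (10 ^ k * h / Suc N)"
        using h by (simp add: ennreal_mult[symmetric])
      finally show "(\<Sum>c\<in>S. hausdorff_content k \<delta> (cball c (5 * r c))) \<le> ennreal (10 ^ k * h / Suc N)" .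
    qed (auto intro: hausdorff_content_mono hausdorff_content_UN)
  qed
  have "hausdorff_content k \<delta> ?B \<le> 0" if \<delta>: "0 < \<delta>" for \<delta>
  proof (rule ennreal_le_epsilon)
    fix e :: real assume e: "0 < e"
    define m where "m = min (\<delta> / 10) (e / (10 ^ k * h + 1))"
    have "0 < 10 ^ k * h + 1" using h by (intro add_nonneg_pos) auto
    then have "0 < m" using \<delta> e by (simp add: m_def)
    then obtain N :: nat where "1 / Suc N < m" by (rule nat_approx_posE)
    then have N: "1 / Suc N < \<delta> / 10" "1 / Suc N < e / (10 ^ k * h + 1)" by (auto simp: m_def)
    then have "10 / Suc N \<le> \<delta>" by simp
    from small[OF this] have "hausdorff_content k \<delta> ?B \<le> ennreal (10 ^ k * h / Suc N)" .
    also have "10 ^ k * h / Suc N \<le> (10 ^ k * h) * (e / (10 ^ k * h + 1))"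
      using mult_left_mono[OF less_imp_le[OF N(2)], of "10 ^ k * h"] h by simp
    then have "ennreal (10 ^ k * h / Suc N) \<le> ennreal ((10 ^ k * h) * (e / (10 ^ k * h + 1)))"
      by (rule ennreal_leI)
    also have "\<dots> \<le> ennreal e"
    proof (rule ennreal_leI)
      have "10 ^ k * h * (e / (10 ^ k * h + 1)) \<le> (10 ^ k * h + 1) * (e / (10 ^ k * h + 1))"
        using e h by (intro mult_right_mono) auto
      also have "\<dots> = e" using h by (simp add: add_nonneg_eq_0_iff)
      finally show "10 ^ k * h * (e / (10 ^ k * h + 1)) \<le> e" .
    qed
    finally show "hausdorff_content k \<delta> ?B \<le> 0 + ennreal e" by simp
  qed
  then have "hausdorff_outer k ?B \<le> 0" unfolding hausdorff_outer_eq_SUP by (intro SUP_least) auto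
  then show ?thesis by simp
qed

text \<open>Otherwise each set of a cover of cost below 2 h would carry at most half its cost, since
  it lies in a ball about a point of \<open>F\<close> with its diameter as radius; the total would
  fall below h. The density 1/2 is absolute, so \<delta> can be chosen in terms of \<open>k\<close>
  alone.\<close>

lemma upper_density_ge_half:
  fixes F :: "'a::metric_space set"
  assumes k: "1 \<le> k" and fin: "hausdorff_outer k F < \<infinity>" and pos: "0 < hausdorff_outer k F"
    and r1: "0 < r1"
  obtains x r where "x \<in> F" "0 < r" "r \<le> r1" "ennreal (r ^ k / 2) < hausdorff_outer k (F \<inter> cball x r)"
proof (rule ccontr)
  assume n: "\<not> thesis"
  note witness = that
  have low: "hausdorff_outer k (F \<inter> cball x r) \<le> ennreal (r ^ k / 2)"
    if "x \<in> F" "0 < r" "r \<le> r1" for x r using n witness[OF that] not_le by blast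
  obtain h where h: "0 \<le> h" "hausdorff_outer k F = ennreal h"
    using fin by (cases "hausdorff_outer k F") auto
  have h0: "0 < h" using pos h by simp
  have "hausdorff_content k r1 F < ennreal (2 * h)"
    using hausdorff_content_le_outer[OF r1, of k F] h h0 ennreal_lessI[of "2 * h" h] by (auto intro: le_less_trans)
  then obtain A where A: "F \<subseteq> (\<Union>i. A i)" "\<And>i. bounded (A i)" "\<And>i. diameter (A i) \<le> r1"
    "(\<Sum>i. hausdorff_cost k (A i)) < ennreal (2 * h)" by (rule hausdorff_content_approx) blast
  have each: "hausdorff_outer k (F \<inter> A i) \<le> ennreal (1/2) * hausdorff_cost k (A i)" for i
  proof (cases "F \<inter> A i = {}")
    case False
    then obtain x where x: "x \<in> F" "x \<in> A i" by blast
    have "A i \<subseteq> cball x (diameter (A i))"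
      using diameter_bounded_bound[OF A(2) x(2)] by auto
    then have *: "hausdorff_outer k (F \<inter> A i) \<le> hausdorff_outer k (F \<inter> cball x (diameter (A i)))"
      by (intro hausdorff_outer_mono) auto
    show ?thesis
    proof (cases "diameter (A i) = 0")
      \<comment> \<open>A radius 0 is outside the assumed density bound; points are null because k
        \<ge> 1.\<close>
      case True
      have "hausdorff_outer k (F \<inter> cball x (diameter (A i))) \<le> hausdorff_outer k {x}"
        by (rule hausdorff_outer_mono) (use True in auto)
      then show ?thesis using * hausdorff_outer_singleton[OF k, of x] by simp
    next
      case False
      then have d: "0 < diameter (A i)" using diameter_ge_0[OF A(2), of i] by simp
      have "hausdorff_outer k (F \<inter> A i) \<le> ennreal (diameter (A i) ^ k / 2)"
        using * low[OF x(1) d A(3)] by (rule order_trans)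
      also have "\<dots> = ennreal (1/2) * hausdorff_cost k (A i)"
      proof -
        have "hausdorff_cost k (A i) = ennreal (diameter (A i) ^ k)"
          using x by (auto simp: hausdorff_cost_def)
        moreover have "ennreal (diameter (A i) ^ k / 2) = ennreal (1/2) * ennreal (diameter (A i) ^ k)"
          using d by (subst ennreal_mult[symmetric]) auto
        ultimately show ?thesis by (simp only:)
      qed
      finally show ?thesis .
    qed
  qed simp
  have "ennreal h \<le> hausdorff_outer k (\<Union>i. F \<inter> A i)"
    unfolding h(2)[symmetric] by (rule hausdorff_outer_mono) (use A(1) in auto)
  also have "\<dots> \<le> (\<Sum>i. hausdorff_outer k (F \<inter> A i))" by (rule hausdorff_outer_UN)
  also have "\<dots> \<le> (\<Sum>i. ennreal (1/2) * hausdorff_cost k (A i))" by (intro suminf_le each) auto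
  also have "\<dots> = ennreal (1/2) * (\<Sum>i. hausdorff_cost k (A i))" by simp
  also have "\<dots> < ennreal (1/2) * ennreal (2 * h)"
  proof (rule ennreal_mult_strict_left_mono[OF A(4)])
    show "0 < ennreal (1/2)" by (subst ennreal_less_zero_iff) simp
    show "ennreal (1/2) < top" by (rule ennreal_less_top)
  qed
  also have "\<dots> = ennreal h" using h0 by (subst ennreal_mult[symmetric]) auto
  finally show False by simp
qed

text \<open>A countable family attaining the infimum of the uncovered measure must leave a null set:
  a graph charging the rest would strictly lower the infimum, as the measure is finite.\<close>

lemma rectifiable_exhaustion:
  fixes F :: "'a::euclidean_space set"
  assumes fin: "hausdorff_outer k F < \<infinity>"
    and ex: "\<And>F'. F' \<subseteq> F \<Longrightarrow> 0 < hausdorff_outer k F' \<Longrightarrow>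
      \<exists>\<Gamma>. C1_holder_graph k \<alpha> \<Gamma> \<and> 0 < hausdorff_outer k (F' \<inter> \<Gamma>)"
  obtains \<G> where "countable \<G>" "\<And>\<Gamma>. \<Gamma> \<in> \<G> \<Longrightarrow> C1_holder_graph k \<alpha> \<Gamma>" "hausdorff_outer k (F - \<Union>\<G>) = 0"
proof -
  define \<A> where "\<A> = {\<G> :: 'a set set. countable \<G> \<and> (\<forall>\<Gamma>\<in>\<G>. C1_holder_graph k \<alpha> \<Gamma>)}"
  define I where "I = (\<lambda>\<G>. hausdorff_outer k (F - \<Union>\<G>)) ` \<A>"
  have "{} \<in> \<A>" by (simp add: \<A>_def)
  then have "I \<noteq> {}" by (auto simp: I_def)
  then obtain f where f: "range f \<subseteq> I" "Inf I = (INF i::nat. f i)"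
    using ennreal_Inf_countable_INF by metis
  have "\<forall>i. \<exists>\<G>\<in>\<A>. f i = hausdorff_outer k (F - \<Union>\<G>)" using f(1) by (auto simp: I_def)
  then obtain G where G: "\<And>i. G i \<in> \<A>" "\<And>i. f i = hausdorff_outer k (F - \<Union>(G i))" by metis
  define \<G> where "\<G> = (\<Union>i. G i)"
  have \<G>: "\<G> \<in> \<A>" using G(1) by (auto simp: \<G>_def \<A>_def)
  have min: "hausdorff_outer k (F - \<Union>\<G>) \<le> Inf I"
    unfolding f(2) G(2) by (intro INF_greatest hausdorff_outer_mono) (auto simp: \<G>_def)
  define F' where "F' = F - \<Union>\<G>"
  have "hausdorff_outer k F' = 0"
  proof (rule ccontr)
    assume "hausdorff_outer k F' \<noteq> 0"
    then obtain \<Gamma> where \<Gamma>: "C1_holder_graph k \<alpha> \<Gamma>" "0 < hausdorff_outer k (F' \<inter> \<Gamma>)"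
      using ex[of F'] by (auto simp: F'_def zero_less_iff_neq_zero)
    have "insert \<Gamma> \<G> \<in> \<A>" using \<G> \<Gamma>(1) by (auto simp: \<A>_def)
    then have "Inf I \<le> hausdorff_outer k (F - \<Union>(insert \<Gamma> \<G>))" unfolding I_def by (rule INF_lower)
    also have "F - \<Union>(insert \<Gamma> \<G>) = F' - \<Gamma>" by (auto simp: F'_def)
    finally have le: "hausdorff_outer k F' \<le> hausdorff_outer k (F' - \<Gamma>)" using min by (simp add: F'_def)
    have split: "hausdorff_outer k (F' \<inter> \<Gamma>) + hausdorff_outer k (F' - \<Gamma>) \<le> hausdorff_outer k F'"
      by (rule hausdorff_outer_closed_split[OF closed_C1_holder_graph[OF \<Gamma>(1)]])
    have "hausdorff_outer k F' < \<infinity>"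
      using hausdorff_outer_mono[of F' F k] fin by (auto simp: F'_def intro: le_less_trans)
    moreover have "hausdorff_outer k (F' - \<Gamma>) \<le> hausdorff_outer k F'" by (rule hausdorff_outer_mono) auto
    ultimately have "hausdorff_outer k (F' - \<Gamma>) < hausdorff_outer k (F' \<inter> \<Gamma>) + hausdorff_outer k (F' - \<Gamma>)"
      using \<Gamma>(2) ennreal_add_left_cancel_less[of "hausdorff_outer k (F' - \<Gamma>)" 0]
      by (auto simp: add.commute top_unique)
    then show False using split le by (meson leD order_trans)
  qed
  then show thesis using that[of \<G>] \<G> by (auto simp: \<A>_def F'_def)
qed

section \<open>Comparison of approximating planes\<close>

lemma subspace_norm_le_l1:
  fixes W :: "'a::euclidean_space set"
  assumes W: "subspace W"
  obtains B where "finite B" "card B = dim W" "B \<subseteq> W" "\<And>e. e \<in> B \<Longrightarrow> norm e = 1"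
    "\<And>u. u \<in> W \<Longrightarrow> norm u \<le> (\<Sum>e\<in>B. \<bar>u \<bullet> e\<bar>)"
proof -
  obtain B where B: "B \<subseteq> W" "pairwise orthogonal B" "\<And>x. x \<in> B \<Longrightarrow> norm x = 1" "independent B"
    "card B = dim W" "span B = W" using orthonormal_basis_subspace[OF W] by blast
  have fin: "finite B" using B(4) by (rule independent_imp_finite)
  show thesis
  proof (rule that[OF fin B(5,1,3)])
    fix u assume "u \<in> W"
    then have "u = (\<Sum>e\<in>B. (u \<bullet> e) *\<^sub>R e)"
      using orthonormal_basis_expand[OF B(2,3) _ fin, of u] B(6) by simp
    then have "norm u = norm (\<Sum>e\<in>B. (u \<bullet> e) *\<^sub>R e)" by (rule arg_cong)
    also have "\<dots> \<le> (\<Sum>e\<in>B. norm ((u \<bullet> e) *\<^sub>R e))" by (rule norm_sum)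
    also have "\<dots> = (\<Sum>e\<in>B. \<bar>u \<bullet> e\<bar>)" by (rule sum.cong) (simp_all add: B(3))
    finally show "norm u \<le> (\<Sum>e\<in>B. \<bar>u \<bullet> e\<bar>)" .
  qed
qed

text \<open>Real-valued, so that density estimates are ordinary arithmetic; for \<open>F\<close> of
  finite measure \<open>ennreal_mass\<close> recovers the outer measure. The set \<open>X\<close>
  may be arbitrary.\<close>

definition mass :: "nat \<Rightarrow> 'a::metric_space set \<Rightarrow> 'a set \<Rightarrow> real" where
  "mass k F X = enn2real (hausdorff_outer k (F \<inter> X))"

locale finite_hausdorff =
  fixes F :: "'a::euclidean_space set" and k :: nat
  assumes finite_F: "hausdorff_outer k F < \<infinity>"
begin

abbreviation \<mu> where "\<mu> \<equiv> mass k F"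

lemma ennreal_mass: "ennreal (\<mu> X) = hausdorff_outer k (F \<inter> X)"
proof -
  have "hausdorff_outer k (F \<inter> X) \<le> hausdorff_outer k F" by (rule hausdorff_outer_mono) auto
  then have "hausdorff_outer k (F \<inter> X) < top" using finite_F by (auto intro: le_less_trans)
  then show ?thesis by (simp add: mass_def)
qed

lemma mass_nonneg [simp]: "0 \<le> \<mu> X"
  by (simp add: mass_def)

lemma mass_mono:
  assumes "F \<inter> X \<subseteq> Y" shows "\<mu> X \<le> \<mu> Y"
proof -
  have "ennreal (\<mu> X) \<le> ennreal (\<mu> Y)"
    unfolding ennreal_mass by (rule hausdorff_outer_mono) (use assms in auto)
  then show ?thesis by simp
qed

lemma mass_cover:
  assumes "countable J" "F \<inter> X \<subseteq> (\<Union>c\<in>J. A c)" "0 \<le> B"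
    and "\<And>S. finite S \<Longrightarrow> S \<subseteq> J \<Longrightarrow> (\<Sum>c\<in>S. \<mu> (A c)) \<le> B"
  shows "\<mu> X \<le> B"
proof -
  have "ennreal (\<mu> X) \<le> ennreal B" unfolding ennreal_mass
  proof (rule hausdorff_outer_cover[OF assms(1)])
    show "F \<inter> X \<subseteq> (\<Union>c\<in>J. F \<inter> A c)" using assms(2) by blast
    fix S assume "finite S" "S \<subseteq> J"
    then have "ennreal (\<Sum>c\<in>S. \<mu> (A c)) \<le> ennreal B" using assms(4) by (intro ennreal_leI)
    then show "(\<Sum>c\<in>S. hausdorff_outer k (F \<inter> A c)) \<le> ennreal B"
      by (simp add: ennreal_mass[symmetric])
  qed
  then show ?thesis using assms(3) by simp
qed

lemma mass_Un: "\<mu> (X \<union> Y) \<le> \<mu> X + \<mu> Y"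
proof -
  have "ennreal (\<mu> (X \<union> Y)) \<le> ennreal (\<mu> X) + ennreal (\<mu> Y)"
    unfolding ennreal_mass Int_Un_distrib by (rule hausdorff_outer_Un)
  also have "\<dots> = ennreal (\<mu> X + \<mu> Y)" by (rule ennreal_plus[symmetric]) auto
  finally show ?thesis by (subst (asm) ennreal_le_iff) auto
qed

lemma mass_disjoint_balls:
  assumes "finite S" "pairwise (\<lambda>i j. disjnt (cball i (r i)) (cball j (r j))) S"
    "\<And>c. c \<in> S \<Longrightarrow> cball c (r c) \<subseteq> Y"
  shows "(\<Sum>c\<in>S. \<mu> (cball c (r c))) \<le> \<mu> Y"
proof -
  have "ennreal (\<Sum>c\<in>S. \<mu> (cball c (r c))) = (\<Sum>c\<in>S. hausdorff_outer k ((F \<inter> Y) \<inter> cball c (r c)))"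
    unfolding sum_ennreal[OF mass_nonneg, symmetric] ennreal_mass
    by (rule sum.cong) (use assms(3) in \<open>auto intro!: arg_cong[of _ _ "hausdorff_outer k"]\<close>)
  also have "\<dots> \<le> hausdorff_outer k (F \<inter> Y)"
  proof (rule hausdorff_outer_disjoint_sum[OF assms(1)])
    show "disjoint_family_on (\<lambda>c. cball c (r c)) S"
      using assms(2) unfolding disjoint_family_on_def pairwise_def disjnt_def by blast
  qed simp
  finally show ?thesis unfolding ennreal_mass[symmetric] by (subst (asm) ennreal_le_iff) auto
qed

end

text \<open>
  \<open>p x r + V x r\<close> is the approximating plane in \<open>cball x r\<close>; the last assumption is a weak-type
  bound on the distances, which is what all the numbers \<open>\<beta>\<^sub>p\<close> with \<open>p \<ge> 1\<close> control simultaneously.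
\<close>

locale flat_set = finite_hausdorff F k for F :: "'a::euclidean_space set" and k +
  fixes \<alpha> \<Lambda> C r0 :: real and p :: "'a \<Rightarrow> real \<Rightarrow> 'a" and V :: "'a \<Rightarrow> real \<Rightarrow> 'a set"
  assumes k: "1 \<le> k" and \<alpha>: "0 < \<alpha>" "\<alpha> \<le> 1" and \<Lambda>: "0 \<le> \<Lambda>" and C: "0 < C" and r0: "0 < r0"
    and growth: "\<And>x r. x \<in> F \<Longrightarrow> 0 < r \<Longrightarrow> r \<le> r0 \<Longrightarrow> \<mu> (cball x r) \<le> \<Lambda> * r ^ k"
    and V: "\<And>x r. subspace (V x r)" "\<And>x r. dim (V x r) = k"
    and weak: "\<And>x r \<tau>. x \<in> F \<Longrightarrow> 0 < r \<Longrightarrow> r \<le> r0 \<Longrightarrow> 0 < \<tau> \<Longrightarrow>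
      \<mu> {y \<in> cball x r. \<tau> * r < norm (rej (V x r) (y - p x r))} \<le> C * r powr \<alpha> / \<tau> * r ^ k"
begin

text \<open>\<open>X\<close> is (k - 1)-dimensional up to an error \<sigma> t, so about
  \<sigma>^(1-k) balls of radius k \<sigma> t cover it, each of mass at most a constant times
  (\<sigma> t)^k. One power of \<sigma> is gained.\<close>

lemma thin_mass:
  fixes t \<sigma> :: real
  assumes B: "finite B" "card B = k - 1" "\<And>e. e \<in> B \<Longrightarrow> norm e = 1"
    and X: "X \<subseteq> F" "X \<subseteq> cball a t" and t: "0 < t" "k * t \<le> r0" and \<sigma>: "0 < \<sigma>" "\<sigma> \<le> 1"
    and thin: "\<And>x x'. x \<in> X \<Longrightarrow> x' \<in> X \<Longrightarrow> norm (x - x') \<le> (\<Sum>e\<in>B. \<bar>(x - x') \<bullet> e\<bar>) + \<sigma> * t"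
  shows "\<mu> X \<le> 5 ^ k * real k ^ k * \<Lambda> * \<sigma> * t ^ k"
proof -
  define f where "f x = restrict (\<lambda>e. \<lfloor>((x - a) \<bullet> e) / (\<sigma> * t)\<rfloor>) B" for x
  define N where "N = \<lceil>1 / \<sigma>\<rceil>"
  define R where "R = PiE B (\<lambda>_. {-N..N})"
  have st: "0 < \<sigma> * t" using t \<sigma> by simp
  have fR: "f ` X \<subseteq> R"
  proof (rule image_subsetI)
    fix x assume x: "x \<in> X"
    have "\<lfloor>((x - a) \<bullet> e) / (\<sigma> * t)\<rfloor> \<in> {-N..N}" if e: "e \<in> B" for e
    proof -
      have "\<bar>(x - a) \<bullet> e\<bar> \<le> norm (x - a) * norm e" by (rule Cauchy_Schwarz_ineq2)
      also have "\<dots> \<le> t" using X(2) x B(3)[OF e] by (auto simp: dist_norm norm_minus_commute)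
      finally have "\<bar>((x - a) \<bullet> e) / (\<sigma> * t)\<bar> \<le> t / (\<sigma> * t)"
        unfolding abs_divide abs_of_pos[OF st] by (rule divide_right_mono) (use st in simp)
      then have "\<bar>((x - a) \<bullet> e) / (\<sigma> * t)\<bar> \<le> 1 / \<sigma>" using t by simp
      then have b: "- (1 / \<sigma>) \<le> ((x - a) \<bullet> e) / (\<sigma> * t)" "((x - a) \<bullet> e) / (\<sigma> * t) \<le> 1 / \<sigma>"
        by linarith+
      show ?thesis
        using floor_mono[OF b(1)] floor_mono[OF b(2)] floor_le_ceiling[of "1 / \<sigma>"]
        unfolding N_def floor_minus atLeastAtMost_iff by linarith
    qed
    then show "f x \<in> R" by (auto simp: f_def R_def)
  qed
  have finR: "finite R" using B(1) by (auto simp: R_def intro: finite_PiE)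
  have fin: "finite (f ` X)" by (rule finite_subset[OF fR finR])
  have "0 < 1 / \<sigma>" using \<sigma> by simp
  then have N0: "0 \<le> N" unfolding N_def by linarith
  have "card (f ` X) \<le> card R" by (rule card_mono[OF finR fR])
  also have "card R = nat (2 * N + 1) ^ (k - 1)" using B by (simp add: R_def card_PiE)
  finally have "real (card (f ` X)) \<le> real (nat (2 * N + 1)) ^ (k - 1)" by (simp flip: of_nat_power)
  \<comment> \<open>2 N + 1 is at most 2 / \<sigma> + 3, and 1 \<le> 1 / \<sigma>.\<close>
  also have "\<dots> \<le> (5 / \<sigma>) ^ (k - 1)"
  proof (rule power_mono)
    have "real_of_int N \<le> 1 / \<sigma> + 1" by (simp add: N_def)
    moreover have "1 \<le> 1 / \<sigma>" using \<sigma> by simp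
    ultimately show "real (nat (2 * N + 1)) \<le> 5 / \<sigma>" using N0 by simp
  qed simp
  finally have card: "real (card (f ` X)) \<le> (5 / \<sigma>) ^ (k - 1)" .
  \<comment> \<open>One point of \<open>X\<close> per occupied grid cell: the growth bound holds
    only for balls centred in \<open>F\<close>.\<close>
  define s where "s = inv_into X f"
  have s: "s j \<in> X" "f (s j) = j" if "j \<in> f ` X" for j
    using that by (auto simp: s_def inv_into_into f_inv_into_f)
  have close: "norm (x - s (f x)) \<le> k * (\<sigma> * t)" if x: "x \<in> X" for x
  proof -
    let ?y = "s (f x)"
    have y: "?y \<in> X" "f ?y = f x" using s x by auto
    have "\<bar>(x - ?y) \<bullet> e\<bar> \<le> \<sigma> * t" if e: "e \<in> B" for e
    proof -
      have "\<lfloor>((x - a) \<bullet> e) / (\<sigma> * t)\<rfloor> = \<lfloor>((?y - a) \<bullet> e) / (\<sigma> * t)\<rfloor>"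
        using fun_cong[OF y(2), of e] e by (simp add: f_def)
      then have "\<bar>((x - a) \<bullet> e) / (\<sigma> * t) - ((?y - a) \<bullet> e) / (\<sigma> * t)\<bar> \<le> 1" by linarith
      then have "\<bar>((x - ?y) \<bullet> e) / (\<sigma> * t)\<bar> \<le> 1"
        by (simp add: inner_diff_left diff_divide_distrib)
      then show ?thesis using st by (simp add: abs_divide)
    qed
    then have "(\<Sum>e\<in>B. \<bar>(x - ?y) \<bullet> e\<bar>) \<le> card B * (\<sigma> * t)" by (rule sum_bounded_above)
    then have "norm (x - ?y) \<le> card B * (\<sigma> * t) + \<sigma> * t" using thin[OF x y(1)] by linarith
    also have "\<dots> = k * (\<sigma> * t)" using B(2) k by (simp add: of_nat_diff algebra_simps)
    finally show ?thesis .
  qed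
  have kst: "0 < k * (\<sigma> * t)" "k * (\<sigma> * t) \<le> r0"
  proof -
    show "0 < k * (\<sigma> * t)" using k st by simp
    have "k * (\<sigma> * t) \<le> k * (1 * t)" using \<sigma> t by (intro mult_left_mono mult_right_mono) auto
    then show "k * (\<sigma> * t) \<le> r0" using t by simp
  qed
  show ?thesis
  proof (rule mass_cover[of "f ` X" _ "\<lambda>j. cball (s j) (k * (\<sigma> * t))"])
    show "countable (f ` X)" using fin by (rule countable_finite)
    show "F \<inter> X \<subseteq> (\<Union>j\<in>f ` X. cball (s j) (k * (\<sigma> * t)))"
      using close by (auto simp: dist_norm norm_minus_commute)
    show "0 \<le> 5 ^ k * real k ^ k * \<Lambda> * \<sigma> * t ^ k" using \<Lambda> \<sigma> t by simp
    fix S assume S: "finite S" "S \<subseteq> f ` X"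
    have "(\<Sum>j\<in>S. \<mu> (cball (s j) (k * (\<sigma> * t)))) \<le> card S * (\<Lambda> * (k * (\<sigma> * t)) ^ k)"
    proof (rule sum_bounded_above)
      fix j assume "j \<in> S"
      then have "s j \<in> F" using s(1) S(2) X(1) by blast
      then show "\<mu> (cball (s j) (k * (\<sigma> * t))) \<le> \<Lambda> * (k * (\<sigma> * t)) ^ k" using kst by (rule growth)
    qed
    also have "\<dots> \<le> (5 / \<sigma>) ^ (k - 1) * (\<Lambda> * (k * (\<sigma> * t)) ^ k)"
    proof (rule mult_right_mono)
      show "real (card S) \<le> (5 / \<sigma>) ^ (k - 1)"
        using card card_mono[OF fin S(2)] by linarith
    qed (use \<Lambda> st in simp)
    also have "\<dots> = 5 ^ (k - 1) * real k ^ k * \<Lambda> * \<sigma> * t ^ k"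
    proof -
      have "\<sigma> ^ k = \<sigma> * \<sigma> ^ (k - 1)" using k by (simp flip: power_Suc)
      then show ?thesis using \<sigma> by (simp add: power_mult_distrib power_divide)
    qed
    also have "\<dots> \<le> 5 ^ k * real k ^ k * \<Lambda> * \<sigma> * t ^ k"
      using \<Lambda> \<sigma> t by (intro mult_right_mono power_increasing) auto
    finally show "(\<Sum>j\<in>S. \<mu> (cball (s j) (k * (\<sigma> * t)))) \<le> 5 ^ k * real k ^ k * \<Lambda> * \<sigma> * t ^ k" .
  qed
qed

text \<open>
  If \<open>rej V2\<close> were large on some \<open>w \<in> V1\<close>, the points close to both planes would concentrate near
  the hyperplane of \<open>V1\<close> orthogonal to \<open>oproj V1 (rej V2 w)\<close>, contradicting the bound of the previous lemma.
\<close>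

lemma gap_of_common_points:
  fixes t \<sigma> \<eta> :: real
  assumes V1: "subspace V1" "dim V1 = k" and V2: "subspace V2"
    and X: "X \<subseteq> F" "X \<subseteq> cball a t" and t: "0 < t" "k * t \<le> r0" and \<sigma>: "0 < \<sigma>" "\<sigma> \<le> 1" and \<eta>: "0 \<le> \<eta>"
    and near1: "\<And>x x'. x \<in> X \<Longrightarrow> x' \<in> X \<Longrightarrow> norm (rej V1 (x - x')) \<le> 2 * \<eta> * t"
    and near2: "\<And>x x'. x \<in> X \<Longrightarrow> x' \<in> X \<Longrightarrow> norm (rej V2 (x - x')) \<le> 2 * \<eta> * t"
    and mass: "5 ^ k * real k ^ k * \<Lambda> * \<sigma> * t ^ k < \<mu> X" and w: "w \<in> V1"
  shows "norm (rej V2 w) \<le> 6 * \<eta> / \<sigma> * norm w"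
proof (rule ccontr)
  assume "\<not> ?thesis"
  then have big: "6 * \<eta> / \<sigma> * norm w < norm (rej V2 w)" by simp
  define q where "q = rej V2 w"
  have "0 \<le> 6 * \<eta> / \<sigma> * norm w" using \<eta> \<sigma> by simp
  then have q0: "0 < norm q" using big unfolding q_def by linarith
  have w0: "0 < norm w" using q0 norm_rej_le[OF V2, of w] unfolding q_def by linarith
  have qw: "norm q \<le> norm w" unfolding q_def by (rule norm_rej_le[OF V2])
  define b where "b = oproj V1 q"
  have bV: "b \<in> V1" by (simp add: b_def oproj_mem V1)
  \<comment> \<open>A vector of \<open>V1\<close> with small residual from \<open>V2\<close> is thus
    nearly orthogonal to \<open>b\<close>, which makes \<open>b\<close> the thin direction.\<close>
  have vb: "v \<bullet> b = rej V2 v \<bullet> q" if "v \<in> V1" for v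
  proof -
    have "v \<bullet> b = v \<bullet> q" using rej_orth[OF V1(1) that, of q]
      by (simp add: b_def rej_def inner_diff_left inner_diff_right inner_commute)
    also have "\<dots> = rej V2 v \<bullet> q" by (simp add: q_def inner_rej_rej V2)
    finally show ?thesis .
  qed
  have "(norm q)\<^sup>2 = w \<bullet> b" using vb[OF w] by (simp add: q_def power2_norm_eq_inner)
  also have "\<dots> \<le> norm w * norm b" by (rule norm_cauchy_schwarz)
  finally have nb: "(norm q)\<^sup>2 \<le> norm w * norm b" .
  then have b0: "b \<noteq> 0" using q0 by auto
  define H where "H = {v \<in> V1. \<forall>x\<in>span {b}. orthogonal x v}"
  have "dim H + dim (span {b}) = dim V1" unfolding H_def
    by (rule dim_subspace_orthogonal_to_vectors) (use V1 bV span_minimal[of "{b}" V1] in auto)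
  moreover have "dim (span {b}) = 1" using b0 by (simp add: dim_span dim_insert)
  ultimately have dimH: "dim H = k - 1" using V1(2) by simp
  have subH: "subspace H"
    unfolding H_def subspace_def using V1(1)
    by (auto simp: orthogonal_def inner_add_right subspace_0 subspace_add subspace_scale)
  obtain B where B: "finite B" "card B = dim H" "B \<subseteq> H" "\<And>e. e \<in> B \<Longrightarrow> norm e = 1"
    "\<And>u. u \<in> H \<Longrightarrow> norm u \<le> (\<Sum>e\<in>B. \<bar>u \<bullet> e\<bar>)"
    by (rule subspace_norm_le_l1[OF subH]) (rule that)
  have B1: "e \<in> V1" "b \<bullet> e = 0" if "e \<in> B" for e
    using B(3) that span_base[of b "{b}"] by (auto simp: H_def orthogonal_def)
  have thin: "norm (x - x') \<le> (\<Sum>e\<in>B. \<bar>(x - x') \<bullet> e\<bar>) + \<sigma> * t" if x: "x \<in> X" "x' \<in> X" for x x'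
  proof -
    define v where "v = oproj V1 (x - x')"
    define u where "u = v - ((v \<bullet> b) / (norm b)\<^sup>2) *\<^sub>R b"
    have vV: "v \<in> V1" by (simp add: v_def oproj_mem V1)
    have xv: "x - x' = v + rej V1 (x - x')" by (simp add: v_def oproj_plus_rej)
    have "rej V2 v = rej V2 (x - x') - rej V2 (rej V1 (x - x'))"
      by (subst xv) (simp add: linear_add[OF linear_rej[OF V2]])
    then have "norm (rej V2 v) \<le> norm (rej V2 (x - x')) + norm (rej V2 (rej V1 (x - x')))"
      by (simp add: norm_triangle_ineq4)
    also have "\<dots> \<le> 2 * \<eta> * t + 2 * \<eta> * t"
      using near2[OF x] near1[OF x] norm_rej_le[OF V2, of "rej V1 (x - x')"] by linarith
    finally have rv: "norm (rej V2 v) \<le> 4 * \<eta> * t" by simp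
    have "\<bar>v \<bullet> b\<bar> \<le> norm (rej V2 v) * norm q" unfolding vb[OF vV] by (rule Cauchy_Schwarz_ineq2)
    also have "\<dots> \<le> 4 * \<eta> * t * norm q" using rv by (intro mult_right_mono) auto
    finally have vb': "\<bar>v \<bullet> b\<bar> \<le> 4 * \<eta> * t * norm q" .
    have uH: "u \<in> H"
    proof -
      have "u \<in> V1" unfolding u_def using vV bV V1(1) by (intro subspace_diff subspace_scale)
      moreover have "b \<bullet> u = 0"
        using b0 by (simp add: u_def inner_diff_right power2_norm_eq_inner inner_commute)
      ultimately show ?thesis by (auto simp: H_def orthogonal_def span_singleton)
    qed
    have "norm (v - u) = \<bar>v \<bullet> b\<bar> / norm b"
      using b0 by (simp add: u_def power2_eq_square)
    also have "\<dots> \<le> (4 * \<eta> * t * norm q) / norm b" using vb' by (intro divide_right_mono) auto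
    also have "\<dots> \<le> 4 * \<eta> * t * (norm w / norm q)"
    proof -
      \<comment> \<open>The lower bound on |b| prevents the division by it from losing more than |w|
        / |q|, a ratio at least 1.\<close>
      have "norm q / norm b \<le> norm w / norm q"
        using nb q0 b0 by (simp add: divide_le_eq pos_le_divide_eq power2_eq_square field_simps)
      then show ?thesis using mult_left_mono[of "norm q / norm b" "norm w / norm q" "4 * \<eta> * t"] \<eta> t by simp
    qed
    finally have vu: "norm (v - u) \<le> 4 * \<eta> * t * (norm w / norm q)" .
    have "2 * \<eta> * t * 1 \<le> 2 * \<eta> * t * (norm w / norm q)"
      using \<eta> t q0 qw by (intro mult_left_mono) auto
    then have nr: "norm (rej V1 (x - x')) \<le> 2 * \<eta> * t * (norm w / norm q)" using near1[OF x] by linarith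
    have "norm (v - u) + norm (rej V1 (x - x')) \<le> 6 * \<eta> * (norm w / norm q) * t"
    proof -
      have "6 * \<eta> * r * t = 4 * \<eta> * t * r + 2 * \<eta> * t * r" for r :: real by (simp add: algebra_simps)
      then show ?thesis using add_mono[OF vu nr] by (simp only:)
    qed
    also have "\<dots> \<le> \<sigma> * t"
    proof (intro mult_right_mono)
      have "6 * \<eta> * norm w \<le> \<sigma> * norm q" using big \<sigma> by (simp add: q_def field_simps)
      then show "6 * \<eta> * (norm w / norm q) \<le> \<sigma>" using q0 by (simp add: divide_le_eq)
    qed (use t in simp)
    finally have rest: "norm (v - u) + norm (rej V1 (x - x')) \<le> \<sigma> * t" .
    have ue: "u \<bullet> e = (x - x') \<bullet> e" if "e \<in> B" for e
    proof -
      have "(x - x') \<bullet> e = v \<bullet> e" by (subst xv) (simp add: inner_add_left rej_orth[OF V1(1) B1(1)[OF that]])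
      then show ?thesis using B1(2)[OF that] by (simp add: u_def inner_diff_left)
    qed
    have "norm (x - x') = norm (u + (v - u) + rej V1 (x - x'))"
      by (rule arg_cong[of _ _ norm]) (use xv in simp)
    then have "norm (x - x') \<le> norm u + norm (v - u) + norm (rej V1 (x - x'))"
      using norm_triangle_ineq[of "u + (v - u)" "rej V1 (x - x')"] norm_triangle_ineq[of u "v - u"] by linarith
    also have "norm u \<le> (\<Sum>e\<in>B. \<bar>(x - x') \<bullet> e\<bar>)" using B(5)[OF uH] ue by simp
    finally show ?thesis using rest by linarith
  qed
  have "\<mu> X \<le> 5 ^ k * real k ^ k * \<Lambda> * \<sigma> * t ^ k"
    by (rule thin_mass[OF B(1) _ B(4) X t \<sigma> thin]) (simp add: B(2) dimH)
  then show False using mass by simp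
qed

text \<open>Two planes are comparable when a ball of mass at least \<delta> t^k lies in both of
  their balls. As a predicate of \<delta> and \<open>K\<close> it can become an assumption of a
  later locale, where both are fixed. The second half concerns affine position: heights of a common
  point over the two planes.\<close>

definition comparable where
  "comparable \<delta> K \<longleftrightarrow> (\<forall>y z a t t1 t2. y \<in> F \<longrightarrow> z \<in> F \<longrightarrow> 0 < t \<longrightarrow> 16 * real k * t \<le> r0 \<longrightarrow>
     t1 \<in> {t..16 * t} \<longrightarrow> t2 \<in> {t..16 * t} \<longrightarrow> cball a t \<subseteq> cball y t1 \<longrightarrow> cball a t \<subseteq> cball z t2 \<longrightarrow>
     \<delta> * t ^ k \<le> \<mu> (cball a t) \<longrightarrow>
     (\<forall>w\<in>V y t1. norm (rej (V z t2) w) \<le> K * t powr \<alpha> * norm w) \<and>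
     (\<forall>q. norm (q - a) \<le> 100 * t \<longrightarrow>
        norm (rej (V z t2) (q - p z t2)) \<le> norm (rej (V y t1) (q - p y t1)) + K * t powr (1 + \<alpha>)))"

text \<open>Points badly approximated at either scale are removed at a threshold of order
  t^\<alpha>, large enough that half of the mass \<delta> t^k survives. The survivors lie near both
  planes, and too much mass is left for them to be thin, so \<open>gap_of_common_points\<close>
  applies.\<close>

lemma compare_planes:
  assumes \<delta>: "0 < \<delta>"
  obtains K where "1 \<le> K" "comparable \<delta> K"
proof -
  \<comment> \<open>Chosen so that the weak bound at threshold N0 t^\<alpha> and radius up to 16 t
    costs at most \<delta> / 4 t^k for each of the two balls.\<close>
  define N0 where "N0 = 4 * 16 ^ (k + 1) * C / \<delta>"
  define c where "c = 5 ^ k * real k ^ k * (\<Lambda> + 1)"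
  \<comment> \<open>Makes the bound of \<open>thin_mass\<close> at most \<delta> / 4 t^k, below the
    surviving \<delta> / 2 t^k.\<close>
  define \<sigma> where "\<sigma> = min 1 (\<delta> / (4 * c))"
  define K1 where "K1 = 96 * N0 / \<sigma>"
  define K where "K = 1 + 32 * N0 + 102 * K1"
  have N0: "0 < N0" using \<delta> C by (simp add: N0_def)
  have c: "0 < c" using k \<Lambda> by (simp add: c_def add_nonneg_pos)
  have \<sigma>: "0 < \<sigma>" "\<sigma> \<le> 1" using c \<delta> by (auto simp: \<sigma>_def)
  have "0 \<le> K1" using N0 \<sigma> by (simp add: K1_def)
  then have K1: "0 \<le> K1" "K1 \<le> K" using N0 by (auto simp: K_def)
  show thesis
  proof (rule that[of K])
    show "1 \<le> K" using K1 N0 by (simp add: K_def)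
    show "comparable \<delta> K"
      unfolding comparable_def
    proof (intro allI impI)
      fix y z a and t t1 t2 :: real
      assume y: "y \<in> F" and z: "z \<in> F" and t: "0 < t" "16 * real k * t \<le> r0"
        and "t1 \<in> {t..16 * t}" "t2 \<in> {t..16 * t}"
        and sub: "cball a t \<subseteq> cball y t1" "cball a t \<subseteq> cball z t2" and dens: "\<delta> * t ^ k \<le> \<mu> (cball a t)"
      then have t1: "t \<le> t1" "t1 \<le> 16 * t" and t2: "t \<le> t2" "t2 \<le> 16 * t" by auto
      have tr: "16 * t \<le> r0" "k * t \<le> r0"
      proof -
        have "t * 1 \<le> t * real k" using k t by (intro mult_left_mono) auto
        then have "t \<le> real k * t" "16 * (real k * t) \<le> r0" using t(2) by (simp_all add: mult_ac)
        then show "16 * t \<le> r0" "k * t \<le> r0" using t(1) by linarith+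
      qed
      define \<tau> where "\<tau> = N0 * t powr \<alpha>"
      have \<tau>: "0 < \<tau>" using N0 t by (simp add: \<tau>_def)
      define bad where "bad y s = {x \<in> cball y s. \<tau> * s < norm (rej (V y s) (x - p y s))}" for y s
      have bad: "\<mu> (bad y s) \<le> \<delta> / 4 * t ^ k" if "y \<in> F" "t \<le> s" "s \<le> 16 * t" for y s
      proof -
        have "\<mu> (bad y s) \<le> C * s powr \<alpha> / \<tau> * s ^ k"
          unfolding bad_def by (rule weak) (use that t tr \<tau> in auto)
        also have "\<dots> \<le> C * (16 * t powr \<alpha>) / \<tau> * (16 * t) ^ k"
        proof (intro mult_mono divide_right_mono power_mono)
          have "s powr \<alpha> \<le> (16 * t) powr \<alpha>" using that t \<alpha> by (intro powr_mono2) auto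
          also have "\<dots> \<le> 16 * t powr \<alpha>" using t \<alpha> by (intro powr_scale_le) auto
          finally show "s powr \<alpha> \<le> 16 * t powr \<alpha>" .
        qed (use that t C \<tau> in auto)
        also have "\<dots> = \<delta> / 4 * t ^ k"
          using t C \<delta> by (simp add: \<tau>_def N0_def power_mult_distrib)
        finally show ?thesis .
      qed
      define X where "X = F \<inter> cball a t - bad y t1 - bad z t2"
      have "\<mu> (cball a t) \<le> \<mu> (X \<union> (bad y t1 \<union> bad z t2))" by (rule mass_mono) (auto simp: X_def)
      also have "\<dots> \<le> \<mu> X + (\<mu> (bad y t1) + \<mu> (bad z t2))"
        using mass_Un[of X "bad y t1 \<union> bad z t2"] mass_Un[of "bad y t1" "bad z t2"] by linarith
      finally have mX: "\<delta> / 2 * t ^ k \<le> \<mu> X"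
        using dens bad[OF y t1] bad[OF z t2] by simp
      have tk: "0 < t ^ k" using t by simp
      have pos: "0 < \<mu> X" using mX tk \<delta> by (meson half_gt_zero less_le_trans mult_pos_pos)
      have "X \<noteq> {}" using pos by (auto simp: mass_def)
      then obtain x0 where x0: "x0 \<in> X" by blast
      define \<eta> where "\<eta> = 16 * \<tau>"
      have \<eta>: "0 \<le> \<eta>" using \<tau> by (simp add: \<eta>_def)
      have near: "norm (rej (V y t1) (x - p y t1)) \<le> \<eta> * t" "norm (rej (V z t2) (x - p z t2)) \<le> \<eta> * t"
        if "x \<in> X" for x
      proof -
        have "\<tau> * t1 \<le> \<eta> * t" "\<tau> * t2 \<le> \<eta> * t"
          using t1 t2 \<tau> mult_left_mono[of _ "16 * t" \<tau>] by (auto simp: \<eta>_def)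
        then show "norm (rej (V y t1) (x - p y t1)) \<le> \<eta> * t" "norm (rej (V z t2) (x - p z t2)) \<le> \<eta> * t"
          using that sub by (auto simp: X_def bad_def)
      qed
      have near': "norm (rej (V y t1) (x - x')) \<le> 2 * \<eta> * t" "norm (rej (V z t2) (x - x')) \<le> 2 * \<eta> * t"
        if x: "x \<in> X" "x' \<in> X" for x x'
      proof -
        have "norm (rej W (x - x')) \<le> norm (rej W (x - q)) + norm (rej W (x' - q))" if "subspace W" for W q
          using norm_triangle_ineq4[of "rej W (x - q)" "rej W (x' - q)"] rej_diff[OF that, of "x - q" "x' - q"] by simp
        from this[OF V(1), of y t1 "p y t1"] this[OF V(1), of z t2 "p z t2"]
        show "norm (rej (V y t1) (x - x')) \<le> 2 * \<eta> * t" "norm (rej (V z t2) (x - x')) \<le> 2 * \<eta> * t"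
          using near[OF x(1)] near[OF x(2)] by linarith+
      qed
      have thick: "5 ^ k * real k ^ k * \<Lambda> * \<sigma> * t ^ k < \<mu> X"
      proof -
        have "5 ^ k * real k ^ k * \<Lambda> * \<sigma> \<le> c * \<sigma>"
          using \<sigma> by (intro mult_right_mono) (auto simp: c_def intro!: mult_left_mono)
        also have "\<dots> \<le> c * (\<delta> / (4 * c))" using c by (intro mult_left_mono) (auto simp: \<sigma>_def)
        also have "\<dots> < \<delta> / 2" using c \<delta> by simp
        finally have "5 ^ k * real k ^ k * \<Lambda> * \<sigma> * t ^ k < \<delta> / 2 * t ^ k"
          using tk by (rule mult_strict_right_mono)
        then show ?thesis using mX by linarith
      qed
      have X: "X \<subseteq> F" "X \<subseteq> cball a t" by (auto simp: X_def)
      have K1eq: "6 * \<eta> / \<sigma> = K1 * t powr \<alpha>" by (simp add: \<eta>_def \<tau>_def K1_def)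
      have gap: "norm (rej (V z t2) w) \<le> K1 * t powr \<alpha> * norm w" if w: "w \<in> V y t1" for w
        unfolding K1eq[symmetric]
        by (rule gap_of_common_points[OF V V(1) X t(1) tr(2) \<sigma> \<eta> near' thick w])
      show "(\<forall>w\<in>V y t1. norm (rej (V z t2) w) \<le> K * t powr \<alpha> * norm w) \<and>
         (\<forall>q. norm (q - a) \<le> 100 * t \<longrightarrow>
            norm (rej (V z t2) (q - p z t2)) \<le> norm (rej (V y t1) (q - p y t1)) + K * t powr (1 + \<alpha>))"
      proof (intro conjI ballI allI impI)
        fix w assume "w \<in> V y t1"
        note gap[OF this]
        also have "K1 * t powr \<alpha> * norm w \<le> K * t powr \<alpha> * norm w"
          using K1 by (intro mult_right_mono) auto
        finally show "norm (rej (V z t2) w) \<le> K * t powr \<alpha> * norm w" .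
      next
        fix q assume q: "norm (q - a) \<le> 100 * t"
        \<comment> \<open>\<open>q\<close> is reached from a surviving point \<open>x0\<close>: the
          component along the first plane is controlled by the gap, the residual by the height of
          \<open>q\<close> up to \<eta> t.\<close>
        define v where "v = oproj (V y t1) (q - x0)"
        define r where "r = rej (V y t1) (q - x0)"
        have "norm (x0 - a) \<le> t" using x0 X by (auto simp: dist_norm norm_minus_commute)
        then have "norm (q - x0) \<le> 101 * t"
          using q norm_triangle_ineq4[of "q - a" "x0 - a"] by simp
        then have nv: "norm v \<le> 101 * t" using norm_oproj_le[OF V(1), of y t1 "q - x0"] by (simp add: v_def)
        have "norm (rej (V z t2) v) \<le> K1 * t powr \<alpha> * norm v"
          by (rule gap) (simp add: v_def oproj_mem V)
        also have "\<dots> \<le> K1 * t powr \<alpha> * (101 * t)" using nv K1 by (intro mult_left_mono) auto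
        finally have e1: "norm (rej (V z t2) v) \<le> 101 * K1 * t powr (1 + \<alpha>)" using t by (simp add: powr_one_plus mult_ac)
        have "r = rej (V y t1) (q - p y t1) - rej (V y t1) (x0 - p y t1)"
          unfolding r_def by (simp flip: rej_diff[OF V(1)])
        then have e2: "norm r \<le> norm (rej (V y t1) (q - p y t1)) + \<eta> * t"
          using near(1)[OF x0] norm_triangle_ineq4[of "rej (V y t1) (q - p y t1)" "rej (V y t1) (x0 - p y t1)"] by simp
        have "q = x0 + (v + r)" by (simp add: v_def r_def oproj_plus_rej)
        then have "q - p z t2 = (x0 - p z t2) + v + r" by simp
        then have "rej (V z t2) (q - p z t2) = rej (V z t2) (x0 - p z t2) + rej (V z t2) v + rej (V z t2) r"
          by (simp only: linear_add[OF linear_rej[OF V(1)]])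
        then have "norm (rej (V z t2) (q - p z t2)) \<le> norm (rej (V z t2) (x0 - p z t2)) + norm (rej (V z t2) v) + norm (rej (V z t2) r)"
          using norm_triangle_ineq[of "rej (V z t2) (x0 - p z t2) + rej (V z t2) v" "rej (V z t2) r"]
            norm_triangle_ineq[of "rej (V z t2) (x0 - p z t2)" "rej (V z t2) v"] by simp
        then have "norm (rej (V z t2) (q - p z t2)) \<le> norm (rej (V y t1) (q - p y t1)) + (2 * (\<eta> * t) + 101 * K1 * t powr (1 + \<alpha>))"
          using near(2)[OF x0] e1 e2 norm_rej_le[OF V(1), of z t2 r] by linarith
        also have "2 * (\<eta> * t) + 101 * K1 * t powr (1 + \<alpha>) = (32 * N0 + 101 * K1) * t powr (1 + \<alpha>)"
          using t by (simp add: \<eta>_def \<tau>_def powr_one_plus algebra_simps)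
        also have "\<dots> \<le> K * t powr (1 + \<alpha>)" using K1 by (intro mult_right_mono) (auto simp: K_def)
        finally show "norm (rej (V z t2) (q - p z t2)) \<le> norm (rej (V y t1) (q - p y t1)) + K * t powr (1 + \<alpha>)" by simp
      qed
    qed
  qed
qed

end

section \<open>Stopping time argument\<close>

lemma geometric_limit:
  fixes a :: "nat \<Rightarrow> 'b::banach" and q :: real
  assumes q: "0 < q" "q < 1" and step: "\<And>i. norm (a (Suc i) - a i) \<le> B * q ^ i" and B: "0 \<le> B"
  obtains l where "a \<longlonglongrightarrow> l" "\<And>i. norm (a i - l) \<le> B * q ^ i * (1 / (1 - q))"
proof -
  have "summable (\<lambda>i. B * q ^ i)" using q by (intro summable_mult summable_geometric) auto
  then have "summable (\<lambda>i. a (Suc i) - a i)"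
    by (rule summable_comparison_test'[where N = 0]) (use step in auto)
  then have "(\<lambda>n. a 0 + (\<Sum>i<n. a (Suc i) - a i)) \<longlonglongrightarrow> a 0 + (\<Sum>i. a (Suc i) - a i)"
    by (intro tendsto_intros summable_LIMSEQ)
  then have "\<exists>l. a \<longlonglongrightarrow> l" by (auto simp: sum_lessThan_telescope)
  then obtain l where l: "a \<longlonglongrightarrow> l" by blast
  \<comment> \<open>The factor 1 - q^n makes the induction close with equality.\<close>
  have tel: "norm (a i - a (i + n)) \<le> B * q ^ i * (1 / (1 - q)) * (1 - q ^ n)" for i n
  proof (induction n)
    case (Suc n)
    have "norm (a i - a (i + Suc n)) \<le> norm (a i - a (i + n)) + norm (a (Suc (i + n)) - a (i + n))"
      using norm_triangle_ineq4[of "a i - a (i + n)" "a (Suc (i + n)) - a (i + n)"] by simp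
    also have "\<dots> \<le> B * q ^ i * (1 / (1 - q)) * (1 - q ^ n) + B * q ^ (i + n)"
      by (intro add_mono Suc.IH step)
    also have "\<dots> = B * q ^ i * (1 / (1 - q)) * (1 - q ^ Suc n)"
      using q by (simp add: field_simps power_add)
    finally show ?case .
  qed simp
  show thesis
  proof (rule that[OF l])
    fix i
    have "(\<lambda>n. norm (a i - a (i + n))) \<longlonglongrightarrow> norm (a i - l)"
      by (intro tendsto_intros) (use LIMSEQ_ignore_initial_segment[OF l, of i] in \<open>simp add: add.commute\<close>)
    moreover have "norm (a i - a (i + n)) \<le> B * q ^ i * (1 / (1 - q))" for n
    proof -
      have "B * q ^ i * (1 / (1 - q)) * (1 - q ^ n) \<le> B * q ^ i * (1 / (1 - q)) * 1"
        using B q by (intro mult_left_mono) auto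
      then show ?thesis using tel[of i n] by simp
    qed
    ultimately show "norm (a i - l) \<le> B * q ^ i * (1 / (1 - q))"
      by (intro LIMSEQ_le_const2) auto
  qed
qed

lemma disjoint_cballs_dist:
  fixes a b :: "'a::euclidean_space"
  assumes "disjnt (cball a r) (cball b s)" "0 < r" "0 < s"
  shows "r + s < dist a b"
proof (rule ccontr)
  assume "\<not> ?thesis"
  then have d: "dist a b \<le> r + s" by simp
  define z where "z = a + (r / (r + s)) *\<^sub>R (b - a)"
  have "dist a z = r / (r + s) * dist a b" using assms by (simp add: z_def dist_norm norm_minus_commute)
  also have "\<dots> \<le> r / (r + s) * (r + s)" using assms d by (intro mult_left_mono) auto
  finally have 1: "dist a z \<le> r" using assms by simp
  have "b - z = (s / (r + s)) *\<^sub>R (b - a)"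
  proof -
    have "(s / (r + s)) *\<^sub>R (b - a) = (1 - r / (r + s)) *\<^sub>R (b - a)"
      using assms by (simp add: field_simps)
    then show ?thesis by (simp add: z_def scaleR_diff_left)
  qed
  then have "dist b z = s / (r + s) * dist a b" using assms by (simp add: dist_norm norm_minus_commute)
  also have "\<dots> \<le> s / (r + s) * (r + s)" using assms d by (intro mult_left_mono) auto
  finally have "dist b z \<le> s" using assms by simp
  then show False using 1 assms(1) by (auto simp: disjnt_iff)
qed

text \<open>
  The smallness of \<open>\<delta>\<close> is chosen before
  \<open>K\<close>, and that of \<open>r\<close> after \<open>K\<close>; \<open>S\<close> is the sum of the geometric series of the numbers \<open>2\<^sup>-\<^sup>j\<^sup>\<alpha>\<close>.
\<close>

locale flat_ball = flat_set F k \<alpha> \<Lambda> C r0 p V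
  for F :: "'a::euclidean_space set" and k \<alpha> \<Lambda> C r0 p V +
  fixes \<delta> K S r :: real and x0 :: 'a
  assumes \<delta>: "0 < \<delta>" "2 * 32 ^ k * \<delta> \<le> 1" "8 * (20 * real k) ^ k * \<delta> \<le> 1" and K: "1 \<le> K"
    and cmp: "comparable \<delta> K"
    and x0: "x0 \<in> F" and r: "0 < r" "512 * k * r \<le> r0" and dens: "r ^ k / 2 \<le> \<mu> (cball x0 r)"
    and S: "S = 1 / (1 - 2 powr - \<alpha>)"
    and small: "1000 * K * (32 * r) powr \<alpha> * S \<le> 1"
    and small_far: "8 * (128 * 8 ^ k * C * 400 * (\<Lambda> * 33 ^ k / \<delta>)) * (32 * r) powr \<alpha> * S \<le> 1"
begin

section \<open>Dyadic scales, density and tilt in the initial ball\<close>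

definition t where "t j = 32 * r / 2 ^ j" for j :: nat

definition U where "U = V x0 (32 * r)"

definition q where "q = 2 powr - \<alpha>"

definition dense where "dense y j \<longleftrightarrow> \<delta> * t j ^ k \<le> \<mu> (cball y (t j))"

definition height where "height y j = norm (rej (V y (t j)) (y - p y (t j)))"

text \<open>At the scale t \<le> 20 l where \<open>cone\<close> uses the threshold, it amounts to l
  / 20. Density belongs to the condition because far points are counted by mass in disjoint balls
  and their planes are compared through such mass.\<close>

definition far where "far j = {y \<in> F \<inter> cball x0 r. dense y j \<and> t j / 400 < height y j}"

lemma q: "0 < q" "q < 1" using \<alpha> powr_less_mono2_neg[of "- \<alpha>" 1 2] by (auto simp: q_def)

lemma S_ge_1: "1 \<le> S" using q by (simp add: S q_def[symmetric])

lemma t_pos: "0 < t j" using r by (simp add: t_def)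

lemma t_nonneg: "0 \<le> t j" using r by (simp add: t_def)

lemma t_Suc: "t j = 2 * t (Suc j)" by (simp add: t_def)

lemma t_le: "t j \<le> 32 * r" using r by (simp add: t_def divide_le_eq mult_left_le)

lemma t_mono: "i \<le> j \<Longrightarrow> t j \<le> t i"
  unfolding t_def using r by (intro divide_left_mono power_increasing) auto

lemma t_lessD: "t j < t i \<Longrightarrow> i < j"
  using t_mono[of j i] by (meson leD leI)

lemma t_tendsto: "t \<longlonglongrightarrow> 0"
proof -
  have "(\<lambda>j. 32 * r * (1 / 2) ^ j) \<longlonglongrightarrow> 32 * r * 0"
    by (intro tendsto_intros LIMSEQ_realpow_zero) auto
  then show ?thesis by (simp add: t_def[abs_def] power_divide)
qed

lemma t_powr: "t j powr \<alpha> = (32 * r) powr \<alpha> * q ^ j"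
proof -
  have "(2 ^ j) powr \<alpha> = (2 powr \<alpha>) ^ j"
    by (simp add: powr_powr mult.commute flip: powr_realpow)
  then show ?thesis using r by (simp add: t_def q_def powr_divide powr_minus power_inverse field_simps)
qed

lemma K_small: "K * t j powr \<alpha> \<le> 1 / 1000"
proof -
  have "K * t j powr \<alpha> \<le> K * (32 * r) powr \<alpha>"
    using t_le K \<alpha> by (intro mult_left_mono powr_mono2) (auto simp: t_pos t_nonneg)
  also have "\<dots> \<le> K * (32 * r) powr \<alpha> * S" using mult_left_mono[OF S_ge_1, of "K * (32 * r) powr \<alpha>"] K by simp
  finally show ?thesis using small by linarith
qed

lemma scale_ok: "s \<le> 32 * r \<Longrightarrow> 16 * k * s \<le> r0" for s :: real
proof -
  assume "s \<le> 32 * r"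
  then have "16 * real k * s \<le> 16 * real k * (32 * r)" by (intro mult_left_mono) auto
  then show ?thesis using r(2) by linarith
qed

lemma r_le: "256 * r \<le> r0"
proof -
  have "512 * r * 1 \<le> 512 * r * k" using k r by (intro mult_left_mono) auto
  moreover have "512 * r * k \<le> r0" using r(2) by (simp add: mult_ac)
  ultimately show ?thesis using r(1) by linarith
qed

lemma exists_scale:
  assumes "0 < l" "10 * l \<le> 32 * r"
  obtains i where "10 * l \<le> t i" "t i \<le> 20 * l"
proof -
  have "\<forall>\<^sub>F j in sequentially. t j < 10 * l" using order_tendstoD(2)[OF t_tendsto] assms by auto
  then have ex: "\<exists>j. t j < 10 * l" by (auto simp: eventually_sequentially)
  define j where "j = (LEAST j. t j < 10 * l)"
  have j: "t j < 10 * l" unfolding j_def by (rule LeastI_ex[OF ex])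
  have "j \<noteq> 0" using j assms(2) by (cases j) (auto simp: t_def)
  then obtain i where i: "j = Suc i" by (cases j) auto
  have "\<not> t i < 10 * l" using not_less_Least[of i "\<lambda>j. t j < 10 * l"] i by (simp add: j_def)
  then show thesis using that[of i] j t_Suc[of i] i by auto
qed

text \<open>The top scale is 32 r so that scales down to 2 r come for free: such a ball about a
  point of the initial ball contains the initial ball. Stopping then occurs only at scales at most
  r. The first smallness condition on \<delta> originates here.\<close>

lemma dense_top:
  assumes "y \<in> cball x0 r" "j \<le> 4" shows "dense y j"
proof -
  have "t 4 \<le> t j" using assms by (intro t_mono)
  then have "2 * r \<le> t j" by (simp add: t_def)
  then have "cball x0 r \<subseteq> cball y (t j)" using assms(1)
    by (auto simp: cball_subset_cball_iff dist_commute)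
  then have "\<mu> (cball x0 r) \<le> \<mu> (cball y (t j))" by (intro mass_mono) auto
  moreover have "\<delta> * t j ^ k \<le> r ^ k / 2"
  proof -
    have "\<delta> * t j ^ k \<le> \<delta> * (32 * r) ^ k"
      using \<delta> t_le by (intro mult_left_mono power_mono) (auto simp: t_pos t_nonneg)
    also have "\<dots> = (2 * 32 ^ k * \<delta>) * (r ^ k / 2)" by (simp add: power_mult_distrib)
    also have "\<dots> \<le> 1 * (r ^ k / 2)" using \<delta> r by (intro mult_right_mono) auto
    finally show ?thesis by simp
  qed
  ultimately show ?thesis using dens by (simp add: dense_def)
qed

lemma compare_dense:
  assumes "y \<in> F" "z \<in> F" "a \<in> F" "dense a j" "t j \<le> t1" "t1 \<le> 16 * t j" "t j \<le> t2" "t2 \<le> 16 * t j"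
    "dist a y + t j \<le> t1" "dist a z + t j \<le> t2"
  shows "w \<in> V y t1 \<Longrightarrow> norm (rej (V z t2) w) \<le> K * t j powr \<alpha> * norm w"
    "norm (x - a) \<le> 100 * t j \<Longrightarrow>
       norm (rej (V z t2) (x - p z t2)) \<le> norm (rej (V y t1) (x - p y t1)) + K * t j powr (1 + \<alpha>)"
proof -
  have "cball a (t j) \<subseteq> cball y t1" "cball a (t j) \<subseteq> cball z t2"
    using assms(9,10) by (auto simp: cball_subset_cball_iff dist_commute)
  moreover have "16 * real k * t j \<le> r0" using scale_ok[OF t_le[of j]] by simp
  moreover have "t1 \<in> {t j..16 * t j}" "t2 \<in> {t j..16 * t j}" using assms(5-8) by auto
  ultimately have "(\<forall>w\<in>V y t1. norm (rej (V z t2) w) \<le> K * t j powr \<alpha> * norm w) \<and>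
     (\<forall>q. norm (q - a) \<le> 100 * t j \<longrightarrow>
        norm (rej (V z t2) (q - p z t2)) \<le> norm (rej (V y t1) (q - p y t1)) + K * t j powr (1 + \<alpha>))"
    using cmp assms(1,2,4) t_pos[of j] unfolding comparable_def dense_def by blast
  then show "w \<in> V y t1 \<Longrightarrow> norm (rej (V z t2) w) \<le> K * t j powr \<alpha> * norm w"
    "norm (x - a) \<le> 100 * t j \<Longrightarrow>
       norm (rej (V z t2) (x - p z t2)) \<le> norm (rej (V y t1) (x - p y t1)) + K * t j powr (1 + \<alpha>)"
    by auto
qed

text \<open>Gaps between consecutive scales are at most K t^\<alpha> and add up by
  \<open>gap_triangle\<close>. The geometric sum is at most K (32 r)^\<alpha> S, so the tilt is
  bounded independently of the depth \<open>i\<close>.\<close>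

lemma gap_U:
  assumes y: "y \<in> F" "y \<in> cball x0 r" and dn: "\<And>j. j \<le> i \<Longrightarrow> dense y j" and w: "w \<in> V y (t i)"
  shows "norm (rej U w) \<le> norm w / 4"
proof -
  have "norm (rej U w) \<le> (K * (32 * r) powr \<alpha> * (\<Sum>m\<le>i. q ^ m)) * norm w"
    if "\<And>j. j \<le> i \<Longrightarrow> dense y j" "w \<in> V y (t i)" for i w
    using that
  proof (induction i arbitrary: w)
    \<comment> \<open>Here the centre changes from \<open>y\<close> to \<open>x0\<close>: both balls
      of radius 32 r contain the dense ball of radius 16 r about \<open>y\<close>.\<close>
    case 0
    have t0: "t 0 = 32 * r" "t (Suc 0) = 16 * r" by (simp_all add: t_def)
    have "norm (rej (V x0 (32 * r)) w) \<le> K * t (Suc 0) powr \<alpha> * norm w"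
    proof (rule compare_dense(1))
      show "w \<in> V y (32 * r)" using 0 t0 by simp
      show "dense y (Suc 0)" by (rule dense_top) (use y in auto)
    qed (use y x0 r t0 in \<open>auto simp: dist_commute\<close>)
    also have "\<dots> \<le> K * (32 * r) powr \<alpha> * norm w"
      using t_le K \<alpha> by (intro mult_left_mono mult_right_mono powr_mono2) (auto simp: t_pos t_nonneg)
    finally show ?case by (simp add: U_def)
  next
    case (Suc i)
    have g: "norm (rej (V y (t i)) w) \<le> K * t (Suc i) powr \<alpha> * norm w"
      using t_Suc[of i] y(1) Suc.prems t_pos[of "Suc i"]
      by (intro compare_dense(1)[of y y y "Suc i" "t (Suc i)" "t i"]) auto
    have "norm (rej U w) \<le> (K * t (Suc i) powr \<alpha> + K * (32 * r) powr \<alpha> * (\<Sum>m\<le>i. q ^ m)) * norm w"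
    proof (rule gap_triangle[OF _ _ g])
      show "norm (rej U v) \<le> K * (32 * r) powr \<alpha> * (\<Sum>m\<le>i. q ^ m) * norm v" if "v \<in> V y (t i)" for v
        using Suc.IH[OF _ that] Suc.prems(1) by auto
      show "0 \<le> K * (32 * r) powr \<alpha> * (\<Sum>m\<le>i. q ^ m)" using K q by (auto intro!: mult_nonneg_nonneg sum_nonneg)
    qed (auto simp: U_def V)
    then show ?case by (simp add: t_powr algebra_simps)
  qed
  from this[OF dn w] have "norm (rej U w) \<le> (K * (32 * r) powr \<alpha> * (\<Sum>m\<le>i. q ^ m)) * norm w" by simp
  also have "\<dots> \<le> (K * (32 * r) powr \<alpha> * S) * norm w"
  proof (intro mult_right_mono mult_left_mono)
    have "(\<Sum>m\<le>i. q ^ m) \<le> (\<Sum>m. q ^ m)"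
      using q by (intro sum_le_suminf summable_geometric) auto
    then show "(\<Sum>m\<le>i. q ^ m) \<le> S" using q suminf_geometric[of q] by (simp add: S q_def[symmetric])
  qed (use K in auto)
  also have "\<dots> \<le> 1/4 * norm w" using small by (intro mult_right_mono) auto
  finally show ?thesis by simp
qed

text \<open>Neighbouring far points may be tested against one common plane at a slightly larger scale.\<close>

lemma mass_far: "\<mu> (far j) \<le> 128 * 8 ^ k * C * 400 * (\<Lambda> * 33 ^ k / \<delta>) * t j powr \<alpha> * r ^ k"
proof -
  have sub: "far j \<subseteq> (\<Union>y\<in>far j. cball y (t j))" by (auto simp: t_nonneg)
  have rad: "\<And>y. y \<in> far j \<Longrightarrow> 0 < t j \<and> t j \<le> t j" by (simp add: t_pos)
  obtain J where J: "countable J" "J \<subseteq> far j"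
    "pairwise (\<lambda>y z. disjnt (cball y (t j)) (cball z (t j))) J" "far j \<subseteq> (\<Union>y\<in>J. cball y (5 * t j))"
    by (rule Vitali_covering_lemma_cballs[OF sub rad]) (assumption, rule that)
  \<comment> \<open>A height above t / 400 for \<open>x\<close> leaves more than t / 800 over the
    plane of \<open>y\<close> at scale 8 t, since the comparison costs t / 1000; in units of 8 t
    this is 1/6400.\<close>
  define A where "A y = {x \<in> cball y (8 * t j). 1 / 6400 * (8 * t j) < norm (rej (V y (8 * t j)) (x - p y (8 * t j)))}" for y
  show ?thesis
  proof (rule mass_cover[OF J(1)])
    show "F \<inter> far j \<subseteq> (\<Union>y\<in>J. A y)"
    proof
      fix x assume "x \<in> F \<inter> far j"
      then obtain y where y: "y \<in> J" "dist y x \<le> 5 * t j" and x: "x \<in> far j" using J(4) by auto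
      have F: "x \<in> F" "y \<in> F" using x y J(2) by (auto simp: far_def)
      have "norm (rej (V x (t j)) (x - p x (t j))) \<le> norm (rej (V y (8 * t j)) (x - p y (8 * t j))) + K * t j powr (1 + \<alpha>)"
        using x y F t_pos[of j] by (intro compare_dense(2)[of y x x j]) (auto simp: far_def dist_commute)
      moreover have "K * t j powr (1 + \<alpha>) \<le> t j / 1000"
        using mult_right_mono[OF K_small[of j], of "t j"] t_pos[of j] by (simp add: powr_one_plus t_nonneg mult_ac)
      ultimately have "1 / 800 * t j < norm (rej (V y (8 * t j)) (x - p y (8 * t j)))"
        using x t_pos[of j] by (simp add: far_def height_def)
      then have "x \<in> A y" using y t_pos[of j] by (simp add: A_def)
      then show "x \<in> (\<Union>y\<in>J. A y)" using y by blast
    qed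
    show "0 \<le> 128 * 8 ^ k * C * 400 * (\<Lambda> * 33 ^ k / \<delta>) * t j powr \<alpha> * r ^ k"
      using C \<Lambda> \<delta> r by simp
    fix T assume T: "finite T" "T \<subseteq> J"
    \<comment> \<open>The number of balls: each carries mass \<delta> t^k, they are disjoint, and
      all lie in the ball of radius r + 32 r.\<close>
    have "card T * (\<delta> * t j ^ k) \<le> (\<Sum>y\<in>T. \<mu> (cball y (t j)))"
      using T J(2) by (intro sum_bounded_below) (auto simp: far_def dense_def)
    also have "\<dots> \<le> \<mu> (cball x0 (33 * r))"
    proof (rule mass_disjoint_balls[OF T(1)])
      show "pairwise (\<lambda>i j'. disjnt (cball i (t j)) (cball j' (t j))) T" using J(3) T(2) by (rule pairwise_subset)
      fix y assume "y \<in> T"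
      then have "dist x0 y \<le> r" using T J by (auto simp: far_def)
      then show "cball y (t j) \<subseteq> cball x0 (33 * r)" using t_le[of j] by (auto simp: cball_subset_cball_iff dist_commute)
    qed
    also have "\<dots> \<le> \<Lambda> * (33 * r) ^ k" using x0 r r_le by (intro growth) auto
    finally have card: "card T * t j ^ k \<le> \<Lambda> * 33 ^ k / \<delta> * r ^ k"
      using \<delta> by (simp add: field_simps power_mult_distrib)
    have "(\<Sum>y\<in>T. \<mu> (A y)) \<le> card T * (128 * 8 ^ k * C * 400 * t j powr \<alpha> * t j ^ k)"
    proof (rule sum_bounded_above)
      fix y assume "y \<in> T"
      then have "y \<in> F" using T J by (auto simp: far_def)
      then have "\<mu> (A y) \<le> C * (8 * t j) powr \<alpha> / (1 / 6400) * (8 * t j) ^ k"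
        unfolding A_def using t_le[of j] r_le t_pos[of j] by (intro weak) auto
      also have "\<dots> \<le> C * (8 * t j powr \<alpha>) / (1 / 6400) * (8 * t j) ^ k"
        using C \<alpha> by (intro mult_right_mono divide_right_mono mult_left_mono powr_scale_le) (auto simp: t_pos t_nonneg)
      also have "\<dots> = 128 * 8 ^ k * C * 400 * t j powr \<alpha> * t j ^ k" by (simp add: power_mult_distrib)
      finally show "\<mu> (A y) \<le> 128 * 8 ^ k * C * 400 * t j powr \<alpha> * t j ^ k" .
    qed
    also have "\<dots> = (128 * 8 ^ k * C * 400 * t j powr \<alpha>) * (card T * t j ^ k)" by simp
    also have "\<dots> \<le> (128 * 8 ^ k * C * 400 * t j powr \<alpha>) * (\<Lambda> * 33 ^ k / \<delta> * r ^ k)"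
      using C by (intro mult_left_mono card) auto
    finally show "(\<Sum>y\<in>T. \<mu> (A y)) \<le> 128 * 8 ^ k * C * 400 * (\<Lambda> * 33 ^ k / \<delta>) * t j powr \<alpha> * r ^ k"
      by (simp add: mult_ac)
  qed
qed

lemma mass_UN_far: "\<mu> (\<Union>j. far j) \<le> r ^ k / 8"
proof (rule mass_cover[of UNIV _ far])
  fix T :: "nat set" assume T: "finite T"
  define c where "c = 128 * 8 ^ k * C * 400 * (\<Lambda> * 33 ^ k / \<delta>)"
  have c: "0 \<le> c" using C \<Lambda> \<delta> by (simp add: c_def)
  have "(\<Sum>j\<in>T. \<mu> (far j)) \<le> (\<Sum>j\<in>T. c * (32 * r) powr \<alpha> * r ^ k * q ^ j)"
    using mass_far by (intro sum_mono) (simp add: t_powr c_def mult_ac)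
  also have "\<dots> = c * (32 * r) powr \<alpha> * r ^ k * (\<Sum>j\<in>T. q ^ j)" by (simp add: sum_distrib_left)
  also have "\<dots> \<le> c * (32 * r) powr \<alpha> * r ^ k * S"
  proof (intro mult_left_mono)
    have "(\<Sum>m\<in>T. q ^ m) \<le> (\<Sum>m. q ^ m)"
      using q T by (intro sum_le_suminf summable_geometric) auto
    then show "(\<Sum>m\<in>T. q ^ m) \<le> S" using q suminf_geometric[of q] by (simp add: S q_def[symmetric])
  qed (use c r in auto)
  also have "\<dots> = (c * (32 * r) powr \<alpha> * S) * r ^ k" by simp
  also have "\<dots> \<le> 1/8 * r ^ k"
  proof (rule mult_right_mono)
    have "8 * c * (32 * r) powr \<alpha> * S \<le> 1" using small_far unfolding c_def .
    then show "c * (32 * r) powr \<alpha> * S \<le> 1/8" by simp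
  qed (use r in simp)
  finally show "(\<Sum>j\<in>T. \<mu> (far j)) \<le> r ^ k / 8" by simp
qed (use r in auto)

text \<open>At a scale t between 10 and 20 times |y - z| both points are within t / 400 + t / 1000
  of the plane of \<open>y\<close>, and that plane tilts by at most 1/4 from \<open>U\<close>; this
  sums to 1/4 + 12/100. Density is requested down to 5 |y - z| because the two planes are compared
  through a ball of half the scale.\<close>

lemma cone:
  assumes y: "y \<in> F" "y \<in> cball x0 r" and z: "z \<in> F" "z \<in> cball x0 r"
    and nf: "\<And>j. y \<notin> far j" "\<And>j. z \<notin> far j"
    and dn: "\<And>j. 5 * norm (y - z) \<le> t j \<Longrightarrow> dense y j \<and> dense z j"
  shows "norm (rej U (y - z)) \<le> norm (y - z) / 2"
proof (cases "y = z")
  case True then show ?thesis using V(1) by (simp add: U_def rej_eq_0 subspace_0)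
next
  case False
  define l where "l = norm (y - z)"
  have l: "0 < l" using False by (simp add: l_def)
  have "dist y z \<le> r + r" using y z dist_triangle3[of y z x0] by auto
  then have lr: "l \<le> 2 * r" by (simp add: l_def dist_norm)
  obtain i where i: "10 * l \<le> t i" "t i \<le> 20 * l" by (rule exists_scale[OF l]) (use lr r in auto)
  have ti: "t i = 2 * t (Suc i)" by (rule t_Suc)
  have dni: "dense y j" "dense z j" if "j \<le> i" for j
    using dn[of j] t_mono[OF that] i l by (auto simp: l_def)
  have dnS: "dense y (Suc i)" using dn[of "Suc i"] ti i by (auto simp: l_def)
  have hy: "height y i \<le> t i / 400" "height z i \<le> t i / 400"
    using nf[of i] y z dni[of i] by (auto simp: far_def)
  have "norm (rej (V y (t i)) (z - p y (t i))) \<le> norm (rej (V z (t i)) (z - p z (t i))) + K * t (Suc i) powr (1 + \<alpha>)"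
    using y z dnS ti i l t_pos[of "Suc i"]
    by (intro compare_dense(2)[of z y y "Suc i"]) (auto simp: l_def dist_norm norm_minus_commute)
  also have "\<dots> \<le> t i / 400 + t i / 1000"
  proof (rule add_mono)
    show "K * t (Suc i) powr (1 + \<alpha>) \<le> t i / 1000"
      using mult_right_mono[OF K_small[of "Suc i"], of "t (Suc i)"] ti t_pos[of "Suc i"] by (simp add: powr_one_plus t_nonneg mult_ac)
  qed (use hy in \<open>simp add: height_def\<close>)
  finally have hz: "norm (rej (V y (t i)) (z - p y (t i))) \<le> t i / 400 + t i / 1000" .
  define v where "v = oproj (V y (t i)) (y - z)"
  define n where "n = rej (V y (t i)) (y - z)"
  have "n = rej (V y (t i)) (y - p y (t i)) - rej (V y (t i)) (z - p y (t i))"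
    unfolding n_def by (simp flip: rej_diff[OF V(1)])
  then have "norm n \<le> height y i + (t i / 400 + t i / 1000)"
    using hz norm_triangle_ineq4[of "rej (V y (t i)) (y - p y (t i))" "rej (V y (t i)) (z - p y (t i))"]
    by (simp add: height_def)
  then have nl: "norm n \<le> 12 / 100 * l" using hy i by linarith
  have "norm (rej U v) \<le> norm v / 4"
    by (rule gap_U[OF y dni(1)]) (auto simp: v_def oproj_mem V)
  also have "norm v \<le> l" unfolding v_def l_def by (rule norm_oproj_le[OF V(1)])
  finally have vl: "norm (rej U v) \<le> l / 4" by simp
  have US: "subspace U" by (simp add: U_def V)
  have "rej U (y - z) = rej U v + rej U n"
    using linear_add[OF linear_rej[OF US], of v n] by (simp add: v_def n_def oproj_plus_rej)
  then have "norm (rej U (y - z)) \<le> l / 4 + 12 / 100 * l"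
    using vl nl norm_rej_le[OF US, of n] norm_triangle_ineq[of "rej U v" "rej U n"] by simp
  then show ?thesis using l unfolding l_def[symmetric] by linarith
qed

section \<open>Stopped points and surviving points\<close>

definition bad where "bad = {y \<in> F \<inter> cball x0 r. (\<forall>j. y \<notin> far j) \<and> (\<exists>j. \<not> dense y j)}"

definition good where "good = {y \<in> F \<inter> cball x0 r. (\<forall>j. y \<notin> far j) \<and> (\<forall>j. dense y j)}"

definition stop where "stop y = (LEAST j. \<not> dense y j)"

lemma stop:
  assumes "y \<in> bad"
  shows "\<not> dense y (stop y)" "\<And>j. j < stop y \<Longrightarrow> dense y j" "t (stop y) \<le> r"
proof -
  show nd: "\<not> dense y (stop y)" unfolding stop_def by (rule LeastI_ex) (use assms in \<open>simp add: bad_def\<close>)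
  show "\<And>j. j < stop y \<Longrightarrow> dense y j" unfolding stop_def by (drule not_less_Least) simp
  have "\<not> stop y \<le> 4" using nd dense_top[of y "stop y"] assms by (auto simp: bad_def)
  then have "t (stop y) \<le> t 5" by (intro t_mono) auto
  then show "t (stop y) \<le> r" by (simp add: t_def)
qed

text \<open>Vitali balls of radius s / 5 are disjoint, so by the cone condition the projections to
  \<open>U\<close> are more than (s y + s z) / 10 apart, and one of the \<open>k\<close> coordinates
  differs by more than (s y + s z) / (10 k). Packing in dimension \<open>k\<close> bounds the sum of
  s^k by (20 k)^k r^k, and each ball of radius s has mass below \<delta> s^k. The last smallness
  condition on \<delta> makes this r^k / 8.\<close>

lemma mass_bad: "\<mu> bad \<le> r ^ k / 8"
proof -
  define s where "s y = t (stop y)" for y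
  have sub: "bad \<subseteq> (\<Union>y\<in>bad. cball y (s y / 5))" by (auto simp: s_def t_nonneg)
  have rad: "\<And>y. y \<in> bad \<Longrightarrow> 0 < s y / 5 \<and> s y / 5 \<le> r"
  proof -
    fix y assume "y \<in> bad"
    then show "0 < s y / 5 \<and> s y / 5 \<le> r" using stop(3)[of y] r t_pos[of "stop y"] by (simp add: s_def)
  qed
  obtain J where J: "countable J" "J \<subseteq> bad"
    "pairwise (\<lambda>y z. disjnt (cball y (s y / 5)) (cball z (s z / 5))) J" "bad \<subseteq> (\<Union>y\<in>J. cball y (5 * (s y / 5)))"
    by (rule Vitali_covering_lemma_cballs[OF sub rad]) (assumption, rule that)
  show ?thesis
  proof (rule mass_cover[OF J(1)])
    show "F \<inter> bad \<subseteq> (\<Union>y\<in>J. cball y (s y))" using J(4) by auto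
    show "0 \<le> r ^ k / 8" using r by simp
    fix T assume T: "finite T" "T \<subseteq> J"
    have US: "subspace U" "dim U = k" by (simp_all add: U_def V)
    obtain B where B: "finite B" "card B = dim U" "B \<subseteq> U" "\<And>e. e \<in> B \<Longrightarrow> norm e = 1"
      "\<And>u. u \<in> U \<Longrightarrow> norm u \<le> (\<Sum>e\<in>B. \<bar>u \<bullet> e\<bar>)"
      by (rule subspace_norm_le_l1[OF US(1)]) (rule that)
    have k0: "0 < real k" using k by simp
    have "(\<Sum>y\<in>T. (s y / (10 * k)) ^ card B) \<le> (2 * r) ^ card B"
    proof (rule box_packing[where c = "\<lambda>y e. (y - x0) \<bullet> e", OF T(1) B(1)])
      show "0 \<le> 2 * r" using r by simp
      show "0 \<le> s y / (10 * k)" for y by (simp add: s_def t_nonneg)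
      fix y e assume y: "y \<in> T" and e: "e \<in> B"
      then have yb: "y \<in> bad" using T J by blast
      have "\<bar>(y - x0) \<bullet> e\<bar> \<le> norm (y - x0) * norm e" by (rule Cauchy_Schwarz_ineq2)
      also have "\<dots> \<le> r" using yb B(4)[OF e] by (auto simp: bad_def dist_norm norm_minus_commute)
      finally have "\<bar>(y - x0) \<bullet> e\<bar> \<le> r" .
      moreover have "s y / (10 * k) \<le> s y / 1"
        using k t_pos[of "stop y"] by (intro divide_left_mono) (auto simp: s_def)
      ultimately show "\<bar>(y - x0) \<bullet> e\<bar> + s y / (10 * k) \<le> 2 * r"
        using stop(3)[OF yb] by (simp add: s_def)
    next
      fix y z assume yz: "y \<in> T" "z \<in> T" "y \<noteq> z"
      then have b: "y \<in> bad" "z \<in> bad" using T J by auto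
      have "disjnt (cball y (s y / 5)) (cball z (s z / 5))"
        using J(3) yz T(2) by (auto simp: pairwise_def)
      from disjoint_cballs_dist[OF this] have sep: "s y / 5 + s z / 5 < norm (y - z)"
        by (simp add: s_def dist_norm t_pos)
      \<comment> \<open>Disjointness puts 5 |y - z| above both stopping scales, so every scale that
        \<open>cone\<close> asks for precedes stopping.\<close>
      have dn: "dense y j \<and> dense z j" if j: "5 * norm (y - z) \<le> t j" for j
      proof -
        have "t (stop y) < t j" "t (stop z) < t j"
          using sep j t_pos[of "stop y"] t_pos[of "stop z"] unfolding s_def by linarith+
        then show ?thesis using stop(2) b t_lessD by blast
      qed
      have "norm (rej U (y - z)) \<le> norm (y - z) / 2"
        by (rule cone[OF _ _ _ _ _ _ dn]) (use b in \<open>auto simp: bad_def\<close>)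
      then have half: "norm (y - z) / 2 \<le> norm (oproj U (y - z))"
        using norm_triangle_ineq[of "oproj U (y - z)" "rej U (y - z)"] by (simp add: oproj_plus_rej)
      show "\<exists>e\<in>B. s y / (10 * k) + s z / (10 * k) < \<bar>(y - x0) \<bullet> e - (z - x0) \<bullet> e\<bar>"
      proof (rule ccontr)
        assume "\<not> ?thesis"
        then have le: "\<bar>(y - z) \<bullet> e\<bar> \<le> (s y + s z) / (10 * k)" if "e \<in> B" for e
          using that by (force simp: inner_diff_left add_divide_distrib)
        have "norm (oproj U (y - z)) \<le> (\<Sum>e\<in>B. \<bar>oproj U (y - z) \<bullet> e\<bar>)" by (rule B(5)[OF oproj_mem[OF US(1)]])
        also have "\<dots> = (\<Sum>e\<in>B. \<bar>(y - z) \<bullet> e\<bar>)"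
        proof (rule sum.cong[OF refl])
          fix e assume "e \<in> B"
          then have "rej U (y - z) \<bullet> e = 0" using rej_orth[OF US(1)] B(3) by blast
          then show "\<bar>oproj U (y - z) \<bullet> e\<bar> = \<bar>(y - z) \<bullet> e\<bar>"
            by (simp add: rej_def inner_diff_left)
        qed
        also have "\<dots> \<le> card B * ((s y + s z) / (10 * k))" by (rule sum_bounded_above[OF le])
        also have "\<dots> = (s y + s z) / 10" using B(2) US(2) k0 by simp
        finally have "norm (oproj U (y - z)) \<le> (s y + s z) / 10" .
        moreover have "(s y + s z) / 10 < norm (y - z) / 2" using sep by (simp add: field_simps)
        ultimately show False using half by (meson leD le_less_trans)
      qed
    qed
    then have "(\<Sum>y\<in>T. s y ^ k) / (10 * real k) ^ k \<le> (2 * r) ^ k"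
      using B(2) US(2) by (simp add: power_divide sum_divide_distrib)
    then have "(\<Sum>y\<in>T. s y ^ k) \<le> (2 * r) ^ k * (10 * real k) ^ k"
      using k0 by (subst (asm) pos_divide_le_eq) auto
    also have "\<dots> = ((20 * real k) * r) ^ k" unfolding power_mult_distrib[symmetric] by (simp add: mult_ac)
    also have "\<dots> = (20 * real k) ^ k * r ^ k" by (rule power_mult_distrib)
    finally have pack: "(\<Sum>y\<in>T. s y ^ k) \<le> (20 * real k) ^ k * r ^ k" .
    have "(\<Sum>y\<in>T. \<mu> (cball y (s y))) \<le> (\<Sum>y\<in>T. \<delta> * s y ^ k)"
      using stop(1) T J by (intro sum_mono) (force simp: s_def dense_def)
    also have "\<dots> = \<delta> * (\<Sum>y\<in>T. s y ^ k)" by (simp add: sum_distrib_left)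
    also have "\<dots> \<le> \<delta> * ((20 * real k) ^ k * r ^ k)" using \<delta> by (intro mult_left_mono pack) auto
    also have "\<dots> = (8 * (20 * real k) ^ k * \<delta>) * (r ^ k / 8)" by simp
    also have "\<dots> \<le> 1 * (r ^ k / 8)" using \<delta> r by (intro mult_right_mono) auto
    finally show "(\<Sum>y\<in>T. \<mu> (cball y (s y))) \<le> r ^ k / 8" by simp
  qed
qed

lemma mass_good: "0 < \<mu> good"
proof -
  have "\<mu> (cball x0 r) \<le> \<mu> (good \<union> (bad \<union> (\<Union>j. far j)))"
    by (rule mass_mono) (auto simp: good_def bad_def)
  also have "\<dots> \<le> \<mu> good + (\<mu> bad + \<mu> (\<Union>j. far j))"
    using mass_Un[of good "bad \<union> (\<Union>j. far j)"] mass_Un[of bad "\<Union>j. far j"] by linarith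
  finally have "r ^ k / 2 \<le> \<mu> good + (r ^ k / 8 + r ^ k / 8)"
    using dens mass_bad mass_UN_far by linarith
  moreover have "0 < r ^ k" using r by simp
  ultimately show ?thesis by linarith
qed

lemma goodD:
  assumes "y \<in> good"
  shows "y \<in> F" "y \<in> cball x0 r" "y \<notin> far j" "dense y j" "height y j \<le> t j / 400"
  using assms by (auto simp: good_def far_def not_less)

text \<open>Moving one scale down loses at most K t^(1+\<alpha>) at the smaller scale, and this
  power at least doubles when the scale does. Hence \<open>a\<close> is nondecreasing in the index;
  it is also bounded by t / 400, which tends to 0, so it is never positive.\<close>

lemma good_height:
  assumes y: "y \<in> good" shows "height y i \<le> K * t i powr (1 + \<alpha>)"
proof -
  define a where "a j = height y j - K * t j powr (1 + \<alpha>)" for j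
  have step: "a j \<le> a (Suc j)" for j
  proof -
    have "height y j \<le> height y (Suc j) + K * t (Suc j) powr (1 + \<alpha>)"
      unfolding height_def using goodD[OF y] t_Suc[of j] t_pos[of "Suc j"]
      by (intro compare_dense(2)[of y y y "Suc j"]) auto
    moreover have "2 * t (Suc j) powr (1 + \<alpha>) \<le> t j powr (1 + \<alpha>)"
    proof -
      have "2 powr 1 * t (Suc j) powr (1 + \<alpha>) \<le> 2 powr (1 + \<alpha>) * t (Suc j) powr (1 + \<alpha>)"
        using \<alpha> by (intro mult_right_mono powr_mono) auto
      then show ?thesis using t_Suc[of j] t_pos[of "Suc j"] by (simp add: powr_mult t_nonneg)
    qed
    then have "2 * (K * t (Suc j) powr (1 + \<alpha>)) \<le> K * t j powr (1 + \<alpha>)"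
      using mult_left_mono[of _ _ K] K by fastforce
    ultimately show ?thesis by (simp add: a_def)
  qed
  have "a i \<le> t (i + n) / 400" for n
  proof -
    have "a i \<le> a (i + n)" by (rule lift_Suc_mono_le[of a]) (use step in auto)
    also have "\<dots> \<le> height y (i + n)" using K by (simp add: a_def)
    also have "\<dots> \<le> t (i + n) / 400" by (rule goodD(5)[OF y])
    finally show ?thesis .
  qed
  then have "400 * a i \<le> t (i + n)" for n by (simp add: mult.commute)
  moreover have "(\<lambda>n. t (i + n)) \<longlonglongrightarrow> 0"
    using LIMSEQ_ignore_initial_segment[OF t_tendsto, of i] by (simp add: add.commute)
  ultimately have "400 * a i \<le> 0" using LIMSEQ_le_const by blast
  then show ?thesis by (simp add: a_def)
qed

section \<open>The jet carried by the surviving points\<close>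

definition is_slope where
  "is_slope y i M \<longleftrightarrow> linear M \<and> (\<forall>x. \<forall>v\<in>U. M x \<bullet> v = 0) \<and> (\<forall>x. norm (M x) \<le> norm x) \<and>
     (\<forall>w\<in>V y (t i). rej U w = M w) \<and> (\<forall>x. M (oproj U x) = M x) \<and> (\<forall>u\<in>U. u + M u \<in> V y (t i))"

definition slope where "slope y i = (SOME M. is_slope y i M)"

lemma slope:
  assumes y: "y \<in> good"
  shows "linear (slope y i)" "\<And>x v. v \<in> U \<Longrightarrow> slope y i x \<bullet> v = 0" "\<And>x. norm (slope y i x) \<le> norm x"
    "\<And>w. w \<in> V y (t i) \<Longrightarrow> rej U w = slope y i w" "\<And>x. slope y i (oproj U x) = slope y i x"
    "\<And>u. u \<in> U \<Longrightarrow> u + slope y i u \<in> V y (t i)"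
proof -
  have gap: "norm (rej U w) \<le> norm w / 2" if "w \<in> V y (t i)" for w
  proof -
    have "norm (rej U w) \<le> norm w / 4" by (rule gap_U[OF _ _ _ that]) (use goodD[OF y] in auto)
    then show ?thesis using norm_ge_zero[of w] by linarith
  qed
  have "\<exists>M. is_slope y i M"
    unfolding is_slope_def
  proof (rule graph_over_subspace[OF V(1)[of y "t i"], of U])
    show "subspace U" "dim (V y (t i)) = dim U" by (simp_all add: U_def V)
    show "w \<in> V y (t i) \<Longrightarrow> norm (rej U w) \<le> norm w / 2" for w by (rule gap)
  qed blast
  then have "is_slope y i (slope y i)" unfolding slope_def by (rule someI_ex)
  then show "linear (slope y i)" "\<And>x v. v \<in> U \<Longrightarrow> slope y i x \<bullet> v = 0" "\<And>x. norm (slope y i x) \<le> norm x"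
    "\<And>w. w \<in> V y (t i) \<Longrightarrow> rej U w = slope y i w" "\<And>x. slope y i (oproj U x) = slope y i x"
    "\<And>u. u \<in> U \<Longrightarrow> u + slope y i u \<in> V y (t i)"
    unfolding is_slope_def by blast+
qed

lemma slope_diff:
  assumes y: "y \<in> good" and z: "z \<in> good"
    and gap: "\<And>w. w \<in> V y (t i) \<Longrightarrow> norm (rej (V z (t j)) w) \<le> g * norm w" "0 \<le> g"
  shows "norm (slope y i x - slope z j x) \<le> 4 * g * norm x"
proof (rule graph_slope_diff[OF V(1)[of z "t j"] _ _ _ _ _ _ _ _ _ gap(1) gap(2)])
  show "subspace U" by (simp add: U_def V)
qed (use slope[OF y] slope[OF z] in auto)

definition limslope where "limslope y x = lim (\<lambda>i. slope y i x)"

text \<open>Consecutive slopes differ by at most four times the gap of the planes, a geometric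
  sequence in the scale; \<open>S\<close> is the factor of its tail.\<close>

lemma limslope:
  assumes y: "y \<in> good"
  shows "(\<lambda>i. slope y i x) \<longlonglongrightarrow> limslope y x"
    and "norm (slope y i x - limslope y x) \<le> 4 * K * S * t i powr \<alpha> * norm x"
proof -
  define B where "B = 4 * K * (32 * r) powr \<alpha> * norm x"
  have step: "norm (slope y (Suc j) x - slope y j x) \<le> B * q ^ j" for j
  proof -
    have "norm (slope y j x - slope y (Suc j) x) \<le> 4 * (K * t (Suc j) powr \<alpha>) * norm x"
    proof (rule slope_diff[OF y y])
      show "norm (rej (V y (t (Suc j))) w) \<le> K * t (Suc j) powr \<alpha> * norm w" if "w \<in> V y (t j)" for w
        using goodD[OF y] that t_Suc[of j] t_pos[of "Suc j"]
        by (intro compare_dense(1)[of y y y "Suc j" "t j" "t (Suc j)"]) auto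
    qed (use K in simp)
    also have "\<dots> = B * q ^ j * q" by (simp add: B_def t_powr)
    also have "\<dots> \<le> B * q ^ j * 1" using q K by (intro mult_left_mono) (auto simp: B_def)
    finally show ?thesis by (simp add: norm_minus_commute)
  qed
  have "0 \<le> B" using K by (simp add: B_def)
  then obtain l where l: "(\<lambda>i. slope y i x) \<longlonglongrightarrow> l"
    "\<And>i. norm (slope y i x - l) \<le> B * q ^ i * (1 / (1 - q))"
    by (rule geometric_limit[OF q step]) (rule that)
  have eq: "limslope y x = l" unfolding limslope_def by (rule limI[OF l(1)])
  show "(\<lambda>i. slope y i x) \<longlonglongrightarrow> limslope y x" using l(1) eq by simp
  have "B * q ^ i * (1 / (1 - q)) = 4 * K * S * t i powr \<alpha> * norm x"
    by (simp add: B_def t_powr S q_def[symmetric])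
  then show "norm (slope y i x - limslope y x) \<le> 4 * K * S * t i powr \<alpha> * norm x"
    using l(2)[of i] eq by simp
qed

lemma limslope_props:
  assumes y: "y \<in> good"
  shows "linear (limslope y)" "v \<in> U \<Longrightarrow> limslope y x \<bullet> v = 0" "limslope y (oproj U x) = limslope y x"
proof -
  note lim = limslope(1)[OF y]
  show "linear (limslope y)"
  proof (rule linearI)
    fix a b
    have "(\<lambda>i. slope y i (a + b)) \<longlonglongrightarrow> limslope y a + limslope y b"
      unfolding linear_add[OF slope(1)[OF y]] by (intro tendsto_intros lim)
    then show "limslope y (a + b) = limslope y a + limslope y b" by (rule LIMSEQ_unique[OF lim])
  next
    fix c a
    have "(\<lambda>i. slope y i (c *\<^sub>R a)) \<longlonglongrightarrow> c *\<^sub>R limslope y a"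
      unfolding linear_scale[OF slope(1)[OF y]] by (intro tendsto_intros lim)
    then show "limslope y (c *\<^sub>R a) = c *\<^sub>R limslope y a" by (rule LIMSEQ_unique[OF lim])
  qed
  show "limslope y x \<bullet> v = 0" if "v \<in> U"
  proof -
    have "(\<lambda>i. slope y i x \<bullet> v) \<longlonglongrightarrow> limslope y x \<bullet> v" by (intro tendsto_intros lim)
    then show ?thesis using slope(2)[OF y that] LIMSEQ_unique[OF tendsto_const] by fastforce
  qed
  have "(\<lambda>i. slope y i (oproj U x)) \<longlonglongrightarrow> limslope y x" unfolding slope(5)[OF y] by (rule lim)
  then show "limslope y (oproj U x) = limslope y x" by (rule LIMSEQ_unique[OF lim])
qed

text \<open>Both bounds compare at a scale between 10 and 20 times |y - z|. The slopes there differ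
  by the gap of the planes, and each is within a geometric tail of its limit. For the first bound
  \<open>z - y\<close> is split along the plane of \<open>y\<close>: in the plane
  \<open>rej U\<close> is exactly the slope, and the residual is of order t^(1+\<alpha>) by
  \<open>good_height\<close> at both points.\<close>

lemma limslope_holder:
  assumes y: "y \<in> good" and z: "z \<in> good"
  shows "norm (rej U (z - y) - limslope y (z - y)) \<le> 4000 * K * S * dist y z powr (1 + \<alpha>)"
    "norm (limslope y u - limslope z u) \<le> 4000 * K * S * dist y z powr \<alpha> * norm u"
proof -
  have US: "subspace U" by (simp add: U_def V)
  have KS: "K \<le> K * S" "0 \<le> K * S" using K S_ge_1 mult_left_mono[of 1 S K] by auto
  have "norm (rej U (z - y) - limslope y (z - y)) \<le> 4000 * K * S * dist y z powr (1 + \<alpha>) \<and>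
    norm (limslope y u - limslope z u) \<le> 4000 * K * S * dist y z powr \<alpha> * norm u"
  proof (cases "y = z")
    case True
    then show ?thesis using US linear_0[OF limslope_props(1)[OF z]] by (simp add: rej_eq_0 subspace_0)
  next
    case False
    define l where "l = dist y z"
    have l: "0 < l" using False by (simp add: l_def)
    have "dist y z \<le> r + r" using goodD(2)[OF y] goodD(2)[OF z] dist_triangle3[of y z x0] by auto
    then have lr: "l \<le> 2 * r" by (simp add: l_def)
    obtain i where i: "10 * l \<le> t i" "t i \<le> 20 * l" by (rule exists_scale[OF l]) (use lr r in auto)
    have ti: "t i = 2 * t (Suc i)" by (rule t_Suc)
    have tS: "t (Suc i) powr b \<le> t i powr b" if "0 \<le> b" for b
      using t_mono[of i "Suc i"] that by (intro powr_mono2) (auto simp: t_pos t_nonneg)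
    have gap: "norm (rej (V z (t i)) w) \<le> K * t i powr \<alpha> * norm w" if "w \<in> V y (t i)" for w
    proof -
      have "norm (rej (V z (t i)) w) \<le> K * t (Suc i) powr \<alpha> * norm w"
        using goodD[OF y] goodD[OF z] that ti t_pos[of "Suc i"] i l
        by (intro compare_dense(1)[of y z y "Suc i" "t i" "t i"]) (auto simp: l_def)
      also have "\<dots> \<le> K * t i powr \<alpha> * norm w"
        using tS \<alpha> K by (intro mult_right_mono mult_left_mono) auto
      finally show ?thesis .
    qed
    have mid: "norm (slope y i u - slope z i u) \<le> 4 * (K * t i powr \<alpha>) * norm u"
      by (rule slope_diff[OF y z gap]) (use K in auto)
    have "norm (limslope y u - limslope z u) \<le> norm (slope y i u - limslope y u) + norm (slope y i u - slope z i u) + norm (slope z i u - limslope z u)"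
      using norm_triangle_ineq[of "limslope y u - slope y i u + (slope y i u - slope z i u)" "slope z i u - limslope z u"]
        norm_triangle_ineq[of "limslope y u - slope y i u" "slope y i u - slope z i u"]
      by (simp add: norm_minus_commute)
    also have "\<dots> \<le> 4 * K * S * t i powr \<alpha> * norm u + 4 * (K * t i powr \<alpha>) * norm u + 4 * K * S * t i powr \<alpha> * norm u"
      by (intro add_mono limslope(2) y z mid)
    also have "\<dots> = (8 * (K * S) + 4 * K) * (t i powr \<alpha> * norm u)" by (simp add: algebra_simps)
    also have "\<dots> \<le> (12 * (K * S)) * ((20 * l powr \<alpha>) * norm u)"
    proof (intro mult_mono mult_right_mono)
      have "t i powr \<alpha> \<le> (20 * l) powr \<alpha>" using i \<alpha> by (intro powr_mono2) (auto simp: t_pos t_nonneg)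
      also have "\<dots> \<le> 20 * l powr \<alpha>" using l \<alpha> by (intro powr_scale_le) auto
      finally show "t i powr \<alpha> \<le> 20 * l powr \<alpha>" .
    qed (use KS in auto)
    also have "\<dots> = 240 * (K * S * l powr \<alpha> * norm u)" by simp
    also have "\<dots> \<le> 4000 * (K * S * l powr \<alpha> * norm u)" using KS by (intro mult_right_mono) auto
    finally have j1: "norm (limslope y u - limslope z u) \<le> 4000 * K * S * dist y z powr \<alpha> * norm u"
      by (simp add: l_def mult_ac)
    define x where "x = z - y"
    define w where "w = oproj (V y (t i)) x"
    define n where "n = rej (V y (t i)) x"
    have nx: "norm x = l" by (simp add: x_def l_def dist_norm norm_minus_commute)
    have "norm (rej (V y (t i)) (z - p y (t i))) \<le> norm (rej (V z (t i)) (z - p z (t i))) + K * t (Suc i) powr (1 + \<alpha>)"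
      using goodD[OF y] goodD[OF z] ti t_pos[of "Suc i"] i l
      by (intro compare_dense(2)[of z y y "Suc i" "t i" "t i"]) (auto simp: l_def dist_norm norm_minus_commute)
    also have "\<dots> \<le> K * t i powr (1 + \<alpha>) + K * t i powr (1 + \<alpha>)"
      using good_height[OF z, of i] tS \<alpha> K by (intro add_mono mult_left_mono) (auto simp: height_def)
    finally have hz: "norm (rej (V y (t i)) (z - p y (t i))) \<le> 2 * K * t i powr (1 + \<alpha>)" by simp
    have "n = rej (V y (t i)) (z - p y (t i)) - rej (V y (t i)) (y - p y (t i))"
      unfolding n_def x_def by (simp flip: rej_diff[OF V(1)])
    then have "norm n \<le> norm (rej (V y (t i)) (z - p y (t i))) + height y i"
      unfolding height_def by (metis norm_triangle_ineq4)
    then have nn: "norm n \<le> 3 * K * t i powr (1 + \<alpha>)" using hz good_height[OF y, of i] by simp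
    have xwn: "x = w + n" by (simp add: w_def n_def oproj_plus_rej)
    have "rej U w = slope y i w" by (rule slope(4)[OF y]) (simp add: w_def oproj_mem V)
    then have "rej U x - slope y i x = rej U n - slope y i n"
      unfolding xwn by (simp add: linear_add[OF linear_rej[OF US]] linear_add[OF slope(1)[OF y]])
    then have eq: "rej U x - limslope y x = (rej U n - slope y i n) + (slope y i x - limslope y x)" by (simp add: algebra_simps)
    have "norm (rej U x - limslope y x) \<le> (norm (rej U n) + norm (slope y i n)) + norm (slope y i x - limslope y x)"
      unfolding eq using norm_triangle_ineq[of "rej U n - slope y i n" "slope y i x - limslope y x"]
        norm_triangle_ineq4[of "rej U n" "slope y i n"] by linarith
    also have "\<dots> \<le> (norm n + norm n) + 4 * K * S * t i powr \<alpha> * norm x"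
      by (intro add_mono norm_rej_le US slope(3) limslope(2) y)
    also have "\<dots> \<le> (6 * K * t i powr (1 + \<alpha>)) + 4 * (K * S) * t i powr (1 + \<alpha>)"
    proof (rule add_mono)
      show "norm n + norm n \<le> 6 * K * t i powr (1 + \<alpha>)" using nn by simp
      have "4 * (K * S) * t i powr \<alpha> * norm x \<le> 4 * (K * S) * t i powr \<alpha> * t i"
        using KS nx i l by (intro mult_left_mono) auto
      then show "4 * K * S * t i powr \<alpha> * norm x \<le> 4 * (K * S) * t i powr (1 + \<alpha>)"
        by (simp add: powr_one_plus t_nonneg mult_ac)
    qed
    also have "\<dots> = (6 * K + 4 * (K * S)) * t i powr (1 + \<alpha>)" by (simp add: algebra_simps)
    also have "\<dots> \<le> (10 * (K * S)) * (20\<^sup>2 * l powr (1 + \<alpha>))"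
    proof (rule mult_mono)
      have "t i powr (1 + \<alpha>) \<le> (20 * l) powr (1 + \<alpha>)" using i \<alpha> by (intro powr_mono2) (auto simp: t_pos t_nonneg)
      also have "\<dots> \<le> 20\<^sup>2 * l powr (1 + \<alpha>)" using l \<alpha> by (intro powr_scale_le) auto
      finally show "t i powr (1 + \<alpha>) \<le> 20\<^sup>2 * l powr (1 + \<alpha>)" .
    qed (use KS in auto)
    finally have "norm (rej U x - limslope y x) \<le> 4000 * K * S * l powr (1 + \<alpha>)" by (simp add: mult_ac)
    then show ?thesis using j1 by (simp add: x_def l_def)
  qed
  then show "norm (rej U (z - y) - limslope y (z - y)) \<le> 4000 * K * S * dist y z powr (1 + \<alpha>)"
    "norm (limslope y u - limslope z u) \<le> 4000 * K * S * dist y z powr \<alpha> * norm u" by auto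
qed

lemma good_in_graph:
  obtains \<Gamma> where "C1_holder_graph k \<alpha> \<Gamma>" "0 < hausdorff_outer k (F \<inter> \<Gamma>)"
proof -
  have ne: "good \<noteq> {}" using mass_good by (auto simp: mass_def)
  have KS: "0 \<le> 4000 * K * S" using K S_ge_1 by simp
  have U: "subspace U" "dim U = k" by (simp_all add: U_def V)
  obtain \<Gamma> where \<Gamma>: "C1_holder_graph k \<alpha> \<Gamma>" "good \<subseteq> \<Gamma>"
  proof (rule jet_graph[OF U ne \<alpha> KS, of limslope])
    fix y z assume yz: "y \<in> good" "z \<in> good"
    show "norm (rej U (y - z)) \<le> norm (y - z) / 2"
      by (rule cone) (use goodD[OF yz(1)] goodD[OF yz(2)] in auto)
  qed (rule limslope_props limslope_holder that; assumption)+
  have "0 < ennreal (\<mu> good)" using mass_good by simp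
  also have "\<dots> \<le> hausdorff_outer k (F \<inter> \<Gamma>)"
    unfolding ennreal_mass by (rule hausdorff_outer_mono) (use \<Gamma> in auto)
  finally show thesis using that \<Gamma> by blast
qed

end

theorem (in flat_set) graph_charges_flat_set:
  assumes pos: "0 < hausdorff_outer k F"
  shows "\<exists>\<Gamma>. C1_holder_graph k \<alpha> \<Gamma> \<and> 0 < hausdorff_outer k (F \<inter> \<Gamma>)"
proof -
  define \<delta> where "\<delta> = min (1 / (2 * 32 ^ k)) (1 / (8 * (20 * real k) ^ k))"
  have \<delta>: "0 < \<delta>" "2 * 32 ^ k * \<delta> \<le> 1" "8 * (20 * real k) ^ k * \<delta> \<le> 1"
  proof -
    have pos: "0 < (2 * 32 ^ k :: real)" "0 < 8 * (20 * real k) ^ k" using k by simp_all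
    show "0 < \<delta>" unfolding \<delta>_def using pos by simp
    have "\<delta> \<le> 1 / (2 * 32 ^ k)" "\<delta> \<le> 1 / (8 * (20 * real k) ^ k)" unfolding \<delta>_def by simp_all
    then show "2 * 32 ^ k * \<delta> \<le> 1" "8 * (20 * real k) ^ k * \<delta> \<le> 1"
      using pos by (simp_all only: pos_le_divide_eq mult.commute)
  qed
  obtain K where K: "1 \<le> K" "comparable \<delta> K"
    by (rule compare_planes[OF \<delta>(1)]) (rule that)
  define S where "S = 1 / (1 - 2 powr - \<alpha>)"
  have "2 powr - \<alpha> < 1" using \<alpha> by (simp add: powr_less_one)
  then have S: "0 \<le> S" by (simp add: S_def)
  define c1 c2 where "c1 = 1000 * K * S" and "c2 = 8 * (128 * 8 ^ k * C * 400 * (\<Lambda> * 33 ^ k / \<delta>)) * S"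
  have c: "0 \<le> c1" "0 \<le> c2" using K S C \<Lambda> \<delta> by (auto simp: c1_def c2_def)
  obtain e where e: "0 < e" "\<And>s. 0 \<le> s \<Longrightarrow> s \<le> e \<Longrightarrow> (c1 + c2) * s powr \<alpha> < 1"
    using powr_bound_small[of "c1 + c2" \<alpha> 1] c \<alpha> by auto
  \<comment> \<open>The second entry keeps 16 k times the top scale 32 r below \<open>r0\<close>, as
    \<open>comparable\<close> requires.\<close>
  define r1 where "r1 = min (e / 32) (r0 / (512 * k))"
  have r1: "0 < r1" using e r0 k by (simp add: r1_def)
  obtain x r where x: "x \<in> F" "0 < r" "r \<le> r1" "ennreal (r ^ k / 2) < hausdorff_outer k (F \<inter> cball x r)"
    using upper_density_ge_half[OF k finite_F pos r1] by blast
  have "(c1 + c2) * (32 * r) powr \<alpha> < 1" using x by (intro e) (auto simp: r1_def)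
  moreover have "0 \<le> c1 * (32 * r) powr \<alpha>" "0 \<le> c2 * (32 * r) powr \<alpha>" using c by auto
  ultimately have small: "c1 * (32 * r) powr \<alpha> \<le> 1" "c2 * (32 * r) powr \<alpha> \<le> 1"
    by (simp_all add: distrib_right)
  interpret flat_ball F k \<alpha> \<Lambda> C r0 p V \<delta> K S r x
  proof (rule flat_ball.intro[OF flat_set_axioms flat_ball_axioms.intro])
    show "512 * k * r \<le> r0" using x(3) k by (simp add: r1_def le_divide_eq mult_ac)
    show "r ^ k / 2 \<le> \<mu> (cball x r)"
      using x(4) unfolding ennreal_mass[symmetric] by (simp add: ennreal_less_iff x less_imp_le)
    show "1000 * K * (32 * r) powr \<alpha> * S \<le> 1" using small(1) by (simp add: c1_def mult_ac)
    show "8 * (128 * 8 ^ k * C * 400 * (\<Lambda> * 33 ^ k / \<delta>)) * (32 * r) powr \<alpha> * S \<le> 1"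
      using small(2) unfolding c2_def by (simp only: mult_ac)
  qed (fact S_def \<delta> K x)+
  show ?thesis using good_in_graph by blast
qed

section \<open>From beta numbers to uniformly flat pieces\<close>

lemma affine_plane_rej:
  assumes "W \<in> affine_planes k"
  obtains p V where "subspace V" "dim V = k" "\<And>y. infdist y W = norm (rej V (y - p))"
proof -
  have W: "affine W" "aff_dim W = int k" using assms by (auto simp: affine_planes_def)
  then have "W \<noteq> {}" by auto
  then obtain p where p: "p \<in> W" by blast
  define V where "V = (\<lambda>x. x - p) ` W"
  have V: "subspace V" unfolding V_def by (rule affine_diffs_subspace_subtract[OF W(1) p])
  show thesis
  proof (rule that[OF V])
    show "dim V = k" using aff_dim_dim_affine_diffs[OF W(1) p] W(2) by (simp add: V_def)
    fix y
    have "infdist (y - p) V = infdist y W"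
      using p by (auto simp: infdist_def V_def image_image dist_norm)
    then show "infdist y W = norm (rej V (y - p))" by (simp add: norm_rej_eq_infdist[OF V])
  qed
qed

text \<open>Markov's inequality gives the bound with (B / \<tau>)^p. Restricting to B \<le> \<tau>
  makes this at most B / \<tau>, and the exponent disappears.\<close>

lemma beta_fin_weak:
  fixes E :: "'a::euclidean_space set"
  assumes E: "E \<in> sets borel" "hausdorff_outer k E < \<infinity>" and p: "1 \<le> p" and r: "0 < r" and B: "0 < B"
    and beta: "beta_fin k E p x r < ennreal B"
  obtains W where "W \<in> affine_planes k"
    "\<And>\<tau>. B \<le> \<tau> \<Longrightarrow> hausdorff_outer k {y \<in> E \<inter> cball x r. \<tau> * r < infdist y W} \<le> ennreal (B / \<tau> * r ^ k)"
proof -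
  define J where "J W = ennreal (1 / r ^ k) *
     (\<integral>\<^sup>+ y \<in> E \<inter> cball x r. ennreal ((infdist y W / r) powr p) \<partial>hausdorff_measure k)" for W
  define X where "X = (INF W\<in>affine_planes k. J W)"
  have X: "enn_powr X (1 / p) < ennreal B" using beta by (simp add: beta_fin_def J_def X_def)
  then have Xt: "X \<noteq> top" by (auto simp: enn_powr_def)
  then have "enn2real X powr (1 / p) < B"
    using X by (simp add: enn_powr_def ennreal_less_iff)
  then have "(enn2real X powr (1 / p)) powr p < B powr p" using p by (intro powr_less_mono2) auto
  then have "enn2real X < B powr p" using p by (simp add: powr_powr)
  then have "X < ennreal (B powr p)"
    using Xt by (metis enn2real_nonneg ennreal_enn2real ennreal_less_iff less_top)
  then obtain W where W: "W \<in> affine_planes k" "J W < ennreal (B powr p)"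
    by (auto simp: X_def INF_less_iff)
  show thesis
  proof (rule that[OF W(1)])
    fix \<tau> assume \<tau>: "B \<le> \<tau>"
    define A where "A = {y \<in> E \<inter> cball x r. \<tau> * r < infdist y W}"
    have "A = E \<inter> cball x r \<inter> {y. \<tau> * r < infdist y W}" by (auto simp: A_def)
    moreover have "{y. \<tau> * r < infdist y W} \<in> sets borel"
      by (intro borel_open open_Collect_less continuous_intros)
    ultimately have A: "A \<in> sets borel" using E(1) by (simp add: sets.Int)
    have "hausdorff_outer k A \<le> hausdorff_outer k E" by (rule hausdorff_outer_mono) (auto simp: A_def)
    then have "hausdorff_outer k A < \<infinity>" using E(2) by (rule le_less_trans)
    then obtain h where h: "0 \<le> h" "hausdorff_outer k A = ennreal h"
      by (cases "hausdorff_outer k A") auto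
    have "ennreal (\<tau> powr p) * ennreal h = (\<integral>\<^sup>+ y. ennreal (\<tau> powr p) * indicator A y \<partial>hausdorff_measure k)"
      using A by (simp add: nn_integral_cmult_indicator emeasure_hausdorff_measure h)
    also have "\<dots> \<le> (\<integral>\<^sup>+ y \<in> E \<inter> cball x r. ennreal ((infdist y W / r) powr p) \<partial>hausdorff_measure k)"
    proof (rule nn_integral_mono)
      fix y
      show "ennreal (\<tau> powr p) * indicator A y \<le> ennreal ((infdist y W / r) powr p) * indicator (E \<inter> cball x r) y"
      proof (cases "y \<in> A")
        case True
        then have "\<tau> powr p \<le> (infdist y W / r) powr p"
          using r B \<tau> p by (intro powr_mono2) (auto simp: A_def pos_le_divide_eq)
        then show ?thesis using True by (auto simp: A_def intro: ennreal_leI)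
      qed simp
    qed
    finally have "ennreal (1 / r ^ k) * (ennreal (\<tau> powr p) * ennreal h) \<le> J W"
      unfolding J_def by (intro mult_left_mono) auto
    also have "\<dots> < ennreal (B powr p)" by (rule W(2))
    also have "ennreal (1 / r ^ k) * (ennreal (\<tau> powr p) * ennreal h) = ennreal (1 / r ^ k * (\<tau> powr p * h))"
    proof -
      have "ennreal (1 / r ^ k * (\<tau> powr p * h)) = ennreal (1 / r ^ k) * ennreal (\<tau> powr p * h)"
        by (rule ennreal_mult) (use r h in auto)
      also have "ennreal (\<tau> powr p * h) = ennreal (\<tau> powr p) * ennreal h"
        by (rule ennreal_mult) (use h in auto)
      finally show ?thesis by (rule sym)
    qed
    finally have "1 / r ^ k * (\<tau> powr p * h) < B powr p"
      using r h by (subst (asm) ennreal_less_iff) auto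
    then have "\<tau> powr p * h \<le> B powr p * r ^ k" using r by (simp add: divide_less_eq less_imp_le)
    then have "h \<le> (B / \<tau>) powr p * r ^ k"
      using B \<tau> by (simp add: powr_divide pos_le_divide_eq mult_ac)
    also have "\<dots> \<le> (B / \<tau>) powr 1 * r ^ k"
      using B \<tau> p r by (intro mult_right_mono powr_mono') auto
    also have "\<dots> = B / \<tau> * r ^ k" using B \<tau> by simp
    finally show "hausdorff_outer k {y \<in> E \<inter> cball x r. \<tau> * r < infdist y W} \<le> ennreal (B / \<tau> * r ^ k)"
      unfolding A_def[symmetric] h(2) by (rule ennreal_leI)
  qed
qed

lemma beta_inf_weak:
  fixes E :: "'a::euclidean_space set"
  assumes E: "E \<in> sets borel" and r: "0 < r" and beta: "beta_inf k E x r < ennreal B"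
  obtains W where "W \<in> affine_planes k"
    "\<And>\<tau>. B \<le> \<tau> \<Longrightarrow> hausdorff_outer k {y \<in> E \<inter> cball x r. \<tau> * r < infdist y W} = 0"
proof -
  obtain W where W: "W \<in> affine_planes k"
    "esssup (restrict_space (hausdorff_measure k) (E \<inter> cball x r)) (\<lambda>y. ennreal (infdist y W / r)) < ennreal B"
    using beta by (auto simp: beta_inf_def INF_less_iff)
  have "(\<lambda>y. ennreal (infdist y W / r)) \<in> borel_measurable borel"
    by (intro measurable_compose[OF _ measurable_ennreal] borel_measurable_continuous_onI continuous_intros) (use r in auto)
  then have m: "(\<lambda>y. ennreal (infdist y W / r)) \<in> borel_measurable (restrict_space (hausdorff_measure k) (E \<inter> cball x r))"
    by (intro measurable_restrict_space1) (simp cong: measurable_cong_sets)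
  have "AE y in restrict_space (hausdorff_measure k) (E \<inter> cball x r). ennreal (infdist y W / r) \<le>
      esssup (restrict_space (hausdorff_measure k) (E \<inter> cball x r)) (\<lambda>y. ennreal (infdist y W / r))"
    by (rule esssup_AE)
  then have "AE y in restrict_space (hausdorff_measure k) (E \<inter> cball x r). ennreal (infdist y W / r) < ennreal B"
    by eventually_elim (use W(2) in \<open>auto intro: le_less_trans\<close>)
  then have "AE y in hausdorff_measure k. y \<in> E \<inter> cball x r \<longrightarrow> ennreal (infdist y W / r) < ennreal B"
    by (subst (asm) AE_restrict_space_iff) (use E in auto)
  then have null: "hausdorff_outer k {y. \<not> (y \<in> E \<inter> cball x r \<longrightarrow> ennreal (infdist y W / r) < ennreal B)} = 0"
    by (simp only: AE_hausdorff_measure_iff)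
  show thesis
  proof (rule that[OF W(1)])
    fix \<tau> assume \<tau>: "B \<le> \<tau>"
    have "hausdorff_outer k {y \<in> E \<inter> cball x r. \<tau> * r < infdist y W} \<le>
        hausdorff_outer k {y. \<not> (y \<in> E \<inter> cball x r \<longrightarrow> ennreal (infdist y W / r) < ennreal B)}"
    proof (rule hausdorff_outer_mono, clarsimp)
      fix y assume "\<tau> * r < infdist y W" "ennreal (infdist y W / r) < ennreal B"
      then have "infdist y W / r < B" by (simp add: ennreal_less_iff r infdist_nonneg less_imp_le)
      then have "infdist y W < B * r" using r by (simp add: divide_less_eq)
      also have "\<dots> \<le> \<tau> * r" using \<tau> r by simp
      finally show False using \<open>\<tau> * r < infdist y W\<close> by simp
    qed
    then show "hausdorff_outer k {y \<in> E \<inter> cball x r. \<tau> * r < infdist y W} = 0" using null by simp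
  qed
qed

lemma beta_weak:
  fixes E :: "'a::euclidean_space set"
  assumes E: "E \<in> sets borel" "hausdorff_outer k E < \<infinity>" and p: "1 \<le> p" and r: "0 < r" and B: "0 < B"
    and beta: "beta k E p x r < ennreal B"
  obtains W where "W \<in> affine_planes k"
    "\<And>\<tau>. B \<le> \<tau> \<Longrightarrow> hausdorff_outer k {y \<in> E \<inter> cball x r. \<tau> * r < infdist y W} \<le> ennreal (B / \<tau> * r ^ k)"
proof (cases "p = \<infinity>")
  case True
  then have "beta_inf k E x r < ennreal B" using beta by (simp add: beta_def)
  then show thesis by (rule beta_inf_weak[OF E(1) r]) (use that in auto)
next
  case False
  then obtain s where s: "p = ennreal s" "0 \<le> s" by (cases p) auto
  then have "1 \<le> enn2real p" "beta_fin k E (enn2real p) x r < ennreal B"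
    using p beta by (auto simp: beta_def ennreal_1[symmetric] simp del: ennreal_1)
  then show thesis using beta_fin_weak[OF E _ r B] that by blast
qed

lemma Limsup_beta_bound:
  assumes "Limsup (at_right 0) (\<lambda>r. ennreal (r powr (- \<alpha>)) * f r) < \<infinity>"
  obtains c \<rho> where "0 < c" "0 < \<rho>" "\<And>r. 0 < r \<Longrightarrow> r < \<rho> \<Longrightarrow> f r < ennreal (c * r powr \<alpha>)"
proof -
  obtain l where l: "0 \<le> l" "Limsup (at_right 0) (\<lambda>r. ennreal (r powr (- \<alpha>)) * f r) = ennreal l"
    using assms by (cases "Limsup (at_right 0) (\<lambda>r. ennreal (r powr (- \<alpha>)) * f r)") auto
  have "\<forall>\<^sub>F r in at_right 0. ennreal (r powr (- \<alpha>)) * f r < ennreal (l + 1)"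
    by (rule Limsup_lessD) (use l in \<open>simp add: ennreal_less_iff\<close>)
  then obtain \<rho> where \<rho>: "0 < \<rho>" "\<And>r. 0 < r \<Longrightarrow> r < \<rho> \<Longrightarrow> ennreal (r powr (- \<alpha>)) * f r < ennreal (l + 1)"
    unfolding eventually_at_right_field by auto
  show thesis
  proof (rule that[of "l + 1" \<rho>])
    fix r :: real assume r: "0 < r" "r < \<rho>"
    have rr: "r powr \<alpha> * r powr (- \<alpha>) = 1" using r by (simp add: powr_minus)
    have "f r = ennreal (r powr \<alpha>) * (ennreal (r powr (- \<alpha>)) * f r)"
      by (simp add: mult.assoc[symmetric] ennreal_mult[symmetric] rr)
    also have "\<dots> < ennreal (r powr \<alpha>) * ennreal (l + 1)"
      by (rule ennreal_mult_strict_left_mono[OF \<rho>(2)[OF r]]) (use r in simp_all)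
    also have "\<dots> = ennreal ((l + 1) * r powr \<alpha>)"
      using l by (simp add: ennreal_mult mult.commute)
    finally show "f r < ennreal ((l + 1) * r powr \<alpha>)" .
  qed (use l \<rho> in auto)
qed

text \<open>One integer controls the density, the flatness constant and the range of scales, so
  countably many pieces suffice. The bound starts at the \<open>\<tau>\<close> from which it has the
  same form for every exponent \<open>p\<close>.\<close>

definition uniformly_flat :: "nat \<Rightarrow> real \<Rightarrow> 'a::euclidean_space set \<Rightarrow> nat \<Rightarrow> 'a set" where
  "uniformly_flat k \<alpha> E N = {x \<in> E. \<forall>r::real. 0 < r \<longrightarrow> r \<le> 1 / Suc N \<longrightarrow>
     hausdorff_outer k (E \<inter> cball x r) \<le> ennreal (Suc N * r ^ k) \<and>
     (\<exists>W\<in>affine_planes k. \<forall>\<tau> \<ge> Suc N * r powr \<alpha>.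
        hausdorff_outer k {y \<in> E \<inter> cball x r. \<tau> * r < infdist y W} \<le> ennreal (Suc N * r powr \<alpha> / \<tau> * r ^ k))}"

lemma uniformly_flatD:
  fixes r :: real
  assumes "x \<in> uniformly_flat k \<alpha> E N" "0 < r" "r \<le> 1 / Suc N"
  shows "hausdorff_outer k (E \<inter> cball x r) \<le> ennreal (Suc N * r ^ k)"
    "\<exists>W\<in>affine_planes k. \<forall>\<tau> \<ge> Suc N * r powr \<alpha>.
        hausdorff_outer k {y \<in> E \<inter> cball x r. \<tau> * r < infdist y W} \<le> ennreal (Suc N * r powr \<alpha> / \<tau> * r ^ k)"
  using assms unfolding uniformly_flat_def by blast+

lemma uniformly_flat_charged:
  fixes F :: "'a::euclidean_space set"
  assumes k: "1 \<le> k" "k \<le> DIM('a)" and \<alpha>: "0 < \<alpha>" "\<alpha> \<le> 1"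
    and E: "hausdorff_outer k E < \<infinity>" and F: "F \<subseteq> uniformly_flat k \<alpha> E N" "0 < hausdorff_outer k F"
  shows "\<exists>\<Gamma>. C1_holder_graph k \<alpha> \<Gamma> \<and> 0 < hausdorff_outer k (F \<inter> \<Gamma>)"
proof -
  define n where "n = real (Suc N)"
  have n: "0 < n" by (simp add: n_def)
  have FE: "F \<subseteq> E" using F(1) by (auto simp: uniformly_flat_def)
  have "hausdorff_outer k F \<le> hausdorff_outer k E" using FE by (rule hausdorff_outer_mono)
  then have fin: "hausdorff_outer k F < \<infinity>" using E by (rule le_less_trans)
  interpret finite_hausdorff F k by standard (rule fin)
  \<comment> \<open>A default plane: \<open>flat_set\<close> wants a k-dimensional subspace for
    every centre and radius, also where flatness says nothing.\<close>
  obtain V0 :: "'a set" where V0: "subspace V0" "dim V0 = k"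
    using choose_subspace_of_subspace[of k "UNIV :: 'a set"] k(2) by auto
  define good_plane where "good_plane x r Q \<longleftrightarrow> subspace (snd Q) \<and> dim (snd Q) = k \<and> (x \<in> F \<longrightarrow> 0 < r \<longrightarrow> r \<le> 1 / n \<longrightarrow>
      (\<forall>\<tau> \<ge> n * r powr \<alpha>. hausdorff_outer k {y \<in> E \<inter> cball x r. \<tau> * r < norm (rej (snd Q) (y - fst Q))}
         \<le> ennreal (n * r powr \<alpha> / \<tau> * r ^ k)))" for x and r :: real and Q :: "'a \<times> 'a set"
  define P where "P x r = (SOME Q. good_plane x r Q)" for x r
  have "\<exists>Q. good_plane x r Q" for x r
  proof (cases "x \<in> F \<and> 0 < r \<and> r \<le> 1 / n")
    case True
    then obtain W where W: "W \<in> affine_planes k" "\<And>\<tau>. n * r powr \<alpha> \<le> \<tau> \<Longrightarrow>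
        hausdorff_outer k {y \<in> E \<inter> cball x r. \<tau> * r < infdist y W} \<le> ennreal (n * r powr \<alpha> / \<tau> * r ^ k)"
      using uniformly_flatD(2)[of x k \<alpha> E N r] F(1) unfolding n_def by blast
    obtain p V where V: "subspace V" "dim V = k" "\<And>y. infdist y W = norm (rej V (y - p))"
      by (rule affine_plane_rej[OF W(1)]) (rule that)
    show ?thesis unfolding good_plane_def
      by (rule exI[of _ "(p, V)"]) (use V(1,2) W(2)[unfolded V(3)] in auto)
  next
    case False
    then show ?thesis unfolding good_plane_def by (intro exI[of _ "(0, V0)"]) (use V0 in auto)
  qed
  then have gp: "good_plane x r (P x r)" for x r unfolding P_def by (rule someI_ex)
  have P: "subspace (snd (P x r))" "dim (snd (P x r)) = k"
    "x \<in> F \<Longrightarrow> 0 < r \<Longrightarrow> r \<le> 1 / n \<Longrightarrow> n * r powr \<alpha> \<le> \<tau> \<Longrightarrow>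
       hausdorff_outer k {y \<in> E \<inter> cball x r. \<tau> * r < norm (rej (snd (P x r)) (y - fst (P x r)))}
         \<le> ennreal (n * r powr \<alpha> / \<tau> * r ^ k)" for x r \<tau>
    using gp[of x r] unfolding good_plane_def by blast+
  have growth: "\<mu> (cball x r) \<le> n * r ^ k" if x: "x \<in> F" "0 < r" "r \<le> 1 / n" for x r
  proof -
    have "ennreal (\<mu> (cball x r)) \<le> hausdorff_outer k (E \<inter> cball x r)"
      unfolding ennreal_mass by (rule hausdorff_outer_mono) (use FE in auto)
    also have "\<dots> \<le> ennreal (n * r ^ k)"
      unfolding n_def by (rule uniformly_flatD(1)) (use F(1) x in \<open>auto simp: n_def\<close>)
    finally show ?thesis using n x by (subst (asm) ennreal_le_iff) auto
  qed
  have flat: "\<mu> {y \<in> cball x r. \<tau> * r < norm (rej (snd (P x r)) (y - fst (P x r)))} \<le> n\<^sup>2 * r powr \<alpha> / \<tau> * r ^ k"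
    (is "\<mu> ?A \<le> _") if x: "x \<in> F" "0 < r" "r \<le> 1 / n" "0 < \<tau>" for x r \<tau>
  proof (cases "n * r powr \<alpha> \<le> \<tau>")
    case True
    have "ennreal (\<mu> ?A) \<le> hausdorff_outer k {y \<in> E \<inter> cball x r. \<tau> * r < norm (rej (snd (P x r)) (y - fst (P x r)))}"
      unfolding ennreal_mass by (rule hausdorff_outer_mono) (use FE in auto)
    also have "\<dots> \<le> ennreal (n * r powr \<alpha> / \<tau> * r ^ k)" by (rule P(3)[OF x(1-3) True])
    finally have "\<mu> ?A \<le> n * r powr \<alpha> / \<tau> * r ^ k" using n x by (subst (asm) ennreal_le_iff) auto
    also have "\<dots> \<le> n\<^sup>2 * r powr \<alpha> / \<tau> * r ^ k"
      using n x by (intro mult_right_mono divide_right_mono) (auto simp: power2_eq_square n_def)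
    finally show ?thesis .
  next
    \<comment> \<open>Below n r^\<alpha> the growth bound n r^k is used; the ratio n r^\<alpha> /
      \<tau> exceeds 1, and the price is a second factor n.\<close>
    case False
    have "\<mu> ?A \<le> \<mu> (cball x r)" by (rule mass_mono) auto
    also have "\<dots> \<le> n * r ^ k" by (rule growth[OF x(1-3)])
    also have "\<dots> \<le> n * (n * r powr \<alpha> / \<tau>) * r ^ k"
    proof (rule mult_right_mono)
      have "1 \<le> n * r powr \<alpha> / \<tau>" using False x by (simp add: le_divide_eq)
      from mult_left_mono[OF this, of n] n show "n \<le> n * (n * r powr \<alpha> / \<tau>)" by (simp only: mult_1_right less_imp_le)
    qed (use x in simp)
    also have "\<dots> = n\<^sup>2 * r powr \<alpha> / \<tau> * r ^ k" by (simp add: power2_eq_square)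
    finally show ?thesis .
  qed
  interpret flat_set F k \<alpha> n "n\<^sup>2" "1 / n" "\<lambda>x r. fst (P x r)" "\<lambda>x r. snd (P x r)"
    by (rule flat_set.intro[OF finite_hausdorff_axioms flat_set_axioms.intro])
       (use k \<alpha> n P growth flat in auto)
  show ?thesis by (rule graph_charges_flat_set[OF F(2)])
qed

lemma mem_uniformly_flat:
  fixes E :: "'a::euclidean_space set"
  assumes E: "E \<in> sets borel" "hausdorff_outer k E < \<infinity>" and x: "x \<in> E"
    and dens: "\<exists>N::nat. \<forall>r::real. 0 < r \<longrightarrow> r \<le> 1 / Suc N \<longrightarrow> hausdorff_outer k (E \<inter> cball x r) \<le> ennreal (Suc N * r ^ k)"
    and p: "1 \<le> p" and beta: "Limsup (at_right 0) (\<lambda>r. ennreal (r powr (- \<alpha>)) * beta k E p x r) < \<infinity>"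
  shows "\<exists>N. x \<in> uniformly_flat k \<alpha> E N"
proof -
  obtain N1 :: nat where N1: "\<And>r::real. 0 < r \<Longrightarrow> r \<le> 1 / Suc N1 \<Longrightarrow>
      hausdorff_outer k (E \<inter> cball x r) \<le> ennreal (Suc N1 * r ^ k)" using dens by blast
  obtain c \<rho> where c: "0 < c" "0 < \<rho>" "\<And>r. 0 < r \<Longrightarrow> r < \<rho> \<Longrightarrow> beta k E p x r < ennreal (c * r powr \<alpha>)"
    by (rule Limsup_beta_bound[OF beta]) (rule that)
  obtain N2 :: nat where N2: "c \<le> N2" using real_arch_simple by blast
  obtain N3 :: nat where N3: "1 / Suc N3 < \<rho>" using nat_approx_posE[OF c(2)] by blast
  define N where "N = max N1 (max N2 N3)"
  have N: "N1 \<le> N" "N2 \<le> N" "N3 \<le> N" by (auto simp: N_def)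
  have "x \<in> uniformly_flat k \<alpha> E N"
    unfolding uniformly_flat_def
  proof (intro CollectI conjI x allI impI)
    fix r :: real assume r: "0 < r" "r \<le> 1 / Suc N"
    have "1 / Suc N \<le> 1 / Suc N1" "1 / Suc N \<le> 1 / Suc N3" using N by (auto intro!: divide_left_mono)
    then have r': "r \<le> 1 / Suc N1" "r < \<rho>" using r N3 by linarith+
    have "hausdorff_outer k (E \<inter> cball x r) \<le> ennreal (Suc N1 * r ^ k)" by (rule N1[OF r(1) r'(1)])
    also have "\<dots> \<le> ennreal (Suc N * r ^ k)" using N r by (intro ennreal_leI mult_right_mono) auto
    finally show "hausdorff_outer k (E \<inter> cball x r) \<le> ennreal (Suc N * r ^ k)" .
    have cN: "c * r powr \<alpha> \<le> Suc N * r powr \<alpha>" using N2 N by (intro mult_right_mono) auto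
    have pos: "0 < c * r powr \<alpha>" using c r by simp
    obtain W where W: "W \<in> affine_planes k" "\<And>\<tau>. c * r powr \<alpha> \<le> \<tau> \<Longrightarrow>
        hausdorff_outer k {y \<in> E \<inter> cball x r. \<tau> * r < infdist y W} \<le> ennreal (c * r powr \<alpha> / \<tau> * r ^ k)"
      by (rule beta_weak[OF E p r(1) pos c(3)[OF r(1) r'(2)]]) (rule that)
    show "\<exists>W\<in>affine_planes k. \<forall>\<tau> \<ge> Suc N * r powr \<alpha>.
        hausdorff_outer k {y \<in> E \<inter> cball x r. \<tau> * r < infdist y W} \<le> ennreal (Suc N * r powr \<alpha> / \<tau> * r ^ k)"
    proof (intro bexI[OF _ W(1)] allI impI)
      fix \<tau> assume \<tau>: "Suc N * r powr \<alpha> \<le> \<tau>"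
      then have "hausdorff_outer k {y \<in> E \<inter> cball x r. \<tau> * r < infdist y W} \<le> ennreal (c * r powr \<alpha> / \<tau> * r ^ k)"
        using cN by (intro W(2)) linarith
      also have "\<dots> \<le> ennreal (Suc N * r powr \<alpha> / \<tau> * r ^ k)"
        by (intro ennreal_leI mult_right_mono divide_right_mono cN) (use r \<tau> cN pos in linarith, use r in simp)
      finally show "hausdorff_outer k {y \<in> E \<inter> cball x r. \<tau> * r < infdist y W} \<le> ennreal (Suc N * r powr \<alpha> / \<tau> * r ^ k)" .
    qed
  qed
  then show ?thesis by blast
qed

text \<open>The exponent chosen at a point leaves no trace in \<open>uniformly_flat\<close>, so up
  to two null sets \<open>E\<close> is a countable union of sets with uniform constants, each
  exhausted by graphs.\<close>

theorem corollary1p6: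
  fixes E :: "(real ^ 'n) set" and k :: nat and \<alpha> :: real
  assumes "k \<in> {1..CARD('n) - 1}"
    and "0 < \<alpha>" and "\<alpha> \<le> 1"
    and "E \<in> sets borel"
    and "hausdorff_outer k E < \<infinity>"
    and "AE x in hausdorff_measure k. x \<in> E \<longrightarrow>
      (\<exists>p::ennreal. 1 \<le> p \<and>
         Limsup (at_right 0) (\<lambda>r. ennreal (r powr (- \<alpha>)) * beta k E p x r) < \<infinity>)"
  shows "C1_holder_rectifiable k \<alpha> E"
proof -
  have k: "1 \<le> k" "k \<le> DIM(real ^ 'n)" using assms(1) by auto
  define D where "D = {x \<in> E. \<forall>N::nat. \<exists>r::real. 0 < r \<and> r \<le> 1 / Suc N \<and>
           ennreal (Suc N * r ^ k) < hausdorff_outer k (E \<inter> cball x r)}"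
  define M where "M = {x. \<not> (x \<in> E \<longrightarrow> (\<exists>p::ennreal. 1 \<le> p \<and>
         Limsup (at_right 0) (\<lambda>r. ennreal (r powr (- \<alpha>)) * beta k E p x r) < \<infinity>))}"
  have D0: "hausdorff_outer k D = 0" unfolding D_def by (rule upper_density_finite) fact
  have M0: "hausdorff_outer k M = 0" unfolding M_def using assms(6) by (simp only: AE_hausdorff_measure_iff)
  have cover: "E \<subseteq> D \<union> M \<union> (\<Union>N. uniformly_flat k \<alpha> E N)"
  proof
    fix x assume x: "x \<in> E"
    show "x \<in> D \<union> M \<union> (\<Union>N. uniformly_flat k \<alpha> E N)"
    proof (cases "x \<in> D \<or> x \<in> M")
      case False
      then obtain p where p: "1 \<le> p" "Limsup (at_right 0) (\<lambda>r. ennreal (r powr (- \<alpha>)) * beta k E p x r) < \<infinity>"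
        using x by (auto simp: M_def)
      have "\<exists>N::nat. \<forall>r::real. 0 < r \<longrightarrow> r \<le> 1 / Suc N \<longrightarrow> hausdorff_outer k (E \<inter> cball x r) \<le> ennreal (Suc N * r ^ k)"
      proof -
        obtain N :: nat where N: "\<not> (\<exists>r::real. 0 < r \<and> r \<le> 1 / Suc N \<and>
            ennreal (Suc N * r ^ k) < hausdorff_outer k (E \<inter> cball x r))"
          using False x unfolding D_def by blast
        show ?thesis
        proof (intro exI[of _ N] allI impI leI notI)
          fix r :: real assume "0 < r" "r \<le> 1 / Suc N" "ennreal (Suc N * r ^ k) < hausdorff_outer k (E \<inter> cball x r)"
          then show False using N by blast
        qed
      qed
      then show ?thesis using mem_uniformly_flat[OF assms(4,5) x _ p] by blast
    qed blast
  qed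
  have "\<exists>\<G>. countable \<G> \<and> (\<forall>\<Gamma>\<in>\<G>. C1_holder_graph k \<alpha> \<Gamma>) \<and>
      hausdorff_outer k (uniformly_flat k \<alpha> E N - \<Union>\<G>) = 0" for N
  proof -
    have "hausdorff_outer k (uniformly_flat k \<alpha> E N) \<le> hausdorff_outer k E"
      by (rule hausdorff_outer_mono) (auto simp: uniformly_flat_def)
    then have fin: "hausdorff_outer k (uniformly_flat k \<alpha> E N) < \<infinity>" using assms(5) by (rule le_less_trans)
    show ?thesis
    proof (rule rectifiable_exhaustion[OF fin])
      show "\<exists>\<Gamma>. C1_holder_graph k \<alpha> \<Gamma> \<and> 0 < hausdorff_outer k (F' \<inter> \<Gamma>)"
        if "F' \<subseteq> uniformly_flat k \<alpha> E N" "0 < hausdorff_outer k F'" for F'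
        by (rule uniformly_flat_charged[OF k assms(2,3,5) that])
    qed blast
  qed
  then obtain \<G> where \<G>: "\<And>N. countable (\<G> N)" "\<And>N \<Gamma>. \<Gamma> \<in> \<G> N \<Longrightarrow> C1_holder_graph k \<alpha> \<Gamma>"
    "\<And>N. hausdorff_outer k (uniformly_flat k \<alpha> E N - \<Union>(\<G> N)) = 0" by metis
  have "hausdorff_outer k (E - \<Union>(\<Union>N. \<G> N)) \<le> hausdorff_outer k ((D \<union> M) \<union> (\<Union>N. uniformly_flat k \<alpha> E N - \<Union>(\<G> N)))"
  proof (rule hausdorff_outer_mono, rule subsetI)
    fix x assume x: "x \<in> E - \<Union>(\<Union>N. \<G> N)"
    then have "x \<in> D \<union> M \<union> (\<Union>N. uniformly_flat k \<alpha> E N)" using cover by (meson DiffD1 subsetD)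
    then consider "x \<in> D \<union> M" | N where "x \<in> uniformly_flat k \<alpha> E N" by (meson UN_E UnE)
    then show "x \<in> (D \<union> M) \<union> (\<Union>N. uniformly_flat k \<alpha> E N - \<Union>(\<G> N))"
    proof cases
      case (2 N)
      then have "x \<in> uniformly_flat k \<alpha> E N - \<Union>(\<G> N)" using x by simp
      then show ?thesis by (intro UnI2 UN_I[of N]) simp_all
    qed (rule UnI1)
  qed
  also have "\<dots> \<le> hausdorff_outer k (D \<union> M) + hausdorff_outer k (\<Union>N. uniformly_flat k \<alpha> E N - \<Union>(\<G> N))"
    by (rule hausdorff_outer_Un)
  also have "\<dots> \<le> (hausdorff_outer k D + hausdorff_outer k M) + (\<Sum>N. hausdorff_outer k (uniformly_flat k \<alpha> E N - \<Union>(\<G> N)))"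
    by (intro add_mono hausdorff_outer_Un hausdorff_outer_UN)
  also have "\<dots> = 0" using D0 M0 \<G>(3) by simp
  finally have "hausdorff_outer k (E - \<Union>(\<Union>N. \<G> N)) = 0" by simp
  then show ?thesis
    unfolding C1_holder_rectifiable_def using assms(4) \<G>(1,2)
    by (intro conjI exI[of _ "\<Union>N. \<G> N"]) auto
qed

end
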